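(* Let $R$ and $\widetilde R$ be $(\mathbb K^d)_{nc}$-evaluation equivalent nc rational expressions in $x_1,\dots,x_d$ over a field $\mathbb K$, i.e., $R(\underline X)=\widetilde R(\underline X)$ for all $\underline X\in dom(R)\cap dom(\widetilde R)$. Then $R$ and $\widetilde R$ are $\mathcal A$-evaluation equivalent for every unital stably finite $\mathbb K$-algebra $\mathcal A$, i.e., $$R^{\mathcal A}(\underline{\mathfrak a})=\widetilde R^{\mathcal A}(\underline{\mathfrak a}),\qquad\forall\,\underline{\mathfrak a}\in dom^{\mathcal A}(R)\cap dom^{\mathcal A}(\widetilde R).$$
   Context: $\mathbb K$ is a field. A nc rational expression $R$ in $x_1,\dots,x_d$ over $\mathbb K$ is a formal expression obtained from nc polynomials in $\mathbb K\langle x_1,\dots,x_d\rangle$ by successive additions, multiplications and inversions. For a unital $\mathbb K$-algebra $\mathcal A$, its domain $dom^{\mathcal A}(R)\subseteq\mathcal A^d$ and evaluation $R^{\mathcal A}(\underline{\mathfrak a})\in\mathcal A$ are defined recursively: for a nc polynomial the domain is $\mathcal A^d$ and evaluation is substitution; for $R=R_1+R_2$ or $R=R_1R_2$ the domain is $dom^{\mathcal A}(R_1)\cap dom^{\mathcal A}(R_2)$ and the value is the sum, resp. product, of the values; for $R=R_1^{-1}$ the domain is $\{\underline{\mathfrak a}\in dom^{\mathcal A}(R_1): R_1^{\mathcal A}(\underline{\mathfrak a})\text{ invertible in }\mathcal A\}$ and $R^{\mathcal A}(\underline{\mathfrak a})=R_1^{\mathcal A}(\underline{\mathfrak a})^{-1}$.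 For $\mathcal A=\mathbb K^{n\times n}$ ($n\ge1$) write $dom_n(R)$ and $R(\underline X)$; $dom(R)=\coprod_{n\ge1}dom_n(R)$. A unital $\mathbb K$-algebra $\mathcal A$ is stably finite if for all $m\ge1$ and $\mathfrak A,\mathfrak B\in\mathcal A^{m\times m}$: $\mathfrak A\mathfrak B=I_m\otimes 1_{\mathcal A}$ iff $\mathfrak B\mathfrak A=I_m\otimes1_{\mathcal A}$. *)

theory Defs
  imports
    "HOL-Library.Poly_Mapping"
    "HOL-Algebra.Module"
    "Jordan_Normal_Form.Matrix"
begin

text \<open>
  The elements of a finite type \<open>'d\<close> index the \<open>d = CARD('d)\<close> noncommuting variables.
  A nc polynomial is a finitely supported function from words in the variables to scalars.
\<close>

type_synonym ('k, 'd) nc_poly = "'d list \<Rightarrow>\<^sub>0 'k"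

context
  notes [[typedef_overloaded]]
begin

datatype ('k :: zero, 'd) nc_rat =
    Poly "('k, 'd) nc_poly"
  | Add "('k, 'd) nc_rat" "('k, 'd) nc_rat"
  | Mult "('k, 'd) nc_rat" "('k, 'd) nc_rat"
  | Inv "('k, 'd) nc_rat"

end

text \<open>
  Algebras are passed to the evaluation as \<open>HOL-Algebra\<close> module records. Such a record also
  carries a multiplication and a unit, and need not be commutative. In this way a single
  definition covers both the matrices over the field, whose size is not a type, and
  an algebra given by a type.
\<close>

definition word_eval :: "('k, 'a, 'm) module_scheme \<Rightarrow> ('d \<Rightarrow> 'a) \<Rightarrow> 'd list \<Rightarrow> 'a" where
  "word_eval A a w = foldr (\<lambda>i y. a i \<otimes>\<^bsub>A\<^esub> y) w \<one>\<^bsub>A\<^esub>"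

definition poly_eval ::
  "('k :: zero, 'a, 'm) module_scheme \<Rightarrow> ('k, 'd) nc_poly \<Rightarrow> ('d \<Rightarrow> 'a) \<Rightarrow> 'a" where
  "poly_eval A p a =
     (\<Oplus>\<^bsub>A\<^esub> w \<in> Poly_Mapping.keys p. Poly_Mapping.lookup p w \<odot>\<^bsub>A\<^esub> word_eval A a w)"

text \<open>
  The value \<open>nc_eval A R a\<close> is meaningful only for \<open>a \<in> nc_dom A R\<close>.
\<close>

primrec nc_eval ::
  "('k :: zero, 'a, 'm) module_scheme \<Rightarrow> ('k, 'd) nc_rat \<Rightarrow> ('d \<Rightarrow> 'a) \<Rightarrow> 'a" where
  "nc_eval A (Poly p) a = poly_eval A p a"
| "nc_eval A (Add R S) a = nc_eval A R a \<oplus>\<^bsub>A\<^esub> nc_eval A S a"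
| "nc_eval A (Mult R S) a = nc_eval A R a \<otimes>\<^bsub>A\<^esub> nc_eval A S a"
| "nc_eval A (Inv R) a = inv\<^bsub>A\<^esub> (nc_eval A R a)"

primrec nc_dom ::
  "('k :: zero, 'a, 'm) module_scheme \<Rightarrow> ('k, 'd) nc_rat \<Rightarrow> ('d \<Rightarrow> 'a) set" where
  "nc_dom A (Poly p) = {a. \<forall>i. a i \<in> carrier A}"
| "nc_dom A (Add R S) = nc_dom A R \<inter> nc_dom A S"
| "nc_dom A (Mult R S) = nc_dom A R \<inter> nc_dom A S"
| "nc_dom A (Inv R) = {a \<in> nc_dom A R. nc_eval A R a \<in> Units A}"

definition evaluation_equivalent ::
  "('k :: zero, 'a, 'm) module_scheme \<Rightarrow> ('k, 'd) nc_rat \<Rightarrow> ('k, 'd) nc_rat \<Rightarrow> bool" where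
  "evaluation_equivalent A R S \<longleftrightarrow>
     (\<forall>a \<in> nc_dom A R \<inter> nc_dom A S. nc_eval A R a = nc_eval A S a)"

text \<open>
  The square case of \<^const>\<open>module_mat\<close> is the matrix algebra. Equality is required
  separately for each size \<open>n \<ge> 1\<close>, i.e. on the disjoint union of the domains.
\<close>

definition nc_space_evaluation_equivalent ::
  "('k :: field, 'd) nc_rat \<Rightarrow> ('k, 'd) nc_rat \<Rightarrow> bool" where
  "nc_space_evaluation_equivalent R S \<longleftrightarrow>
     (\<forall>n \<ge> 1. evaluation_equivalent (module_mat TYPE('k) n n) R S)"

text \<open>
  The sort \<open>{ring, monoid_mult}\<close> is that of unital rings; unlike \<^class>\<open>ring_1\<close> it does not
  exclude the zero ring.
\<close>

locale unital_algebra = vector_space scale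
  for scale :: "'k :: field \<Rightarrow> 'a :: {ring, monoid_mult} \<Rightarrow> 'a" +
  assumes scale_mult_left: "scale c x * y = scale c (x * y)"
    and scale_mult_right: "x * scale c y = scale c (x * y)"

definition algebra_of ::
  "('k \<Rightarrow> 'a :: {ring, monoid_mult} \<Rightarrow> 'a) \<Rightarrow> ('k, 'a) module" where
  "algebra_of scale = \<lparr>carrier = UNIV, mult = (*), one = 1, zero = 0, add = (+), smult = scale\<rparr>"

definition stably_finite :: "'a :: {ring, monoid_mult} itself \<Rightarrow> bool" where
  "stably_finite _ \<longleftrightarrow>
     (\<forall>m \<ge> 1. \<forall>A \<in> carrier_mat m m. \<forall>B \<in> carrier_mat m m.
        A * B = (1\<^sub>m m :: 'a mat) \<longleftrightarrow> B * A = 1\<^sub>m m)"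

end

(*
The inverse of the difference E of R and R' is linearized: every subexpression becomes a linear
system over the algebra, and at a point of its domain the system is uniquely solvable. The direct
sum of these systems, homogenized with one extra variable, is a linear pencil M. If R and R' agree on
all matrices, no blow-up of M (its value at a tuple of N x N matrices) is invertible: an invertible
one, after multiplication by the inverse of the extra variable, would give matrices at which E is
invertible.

The maximal rank of the N x N blow-ups, divided by N, is attained with an integer value h < size M,
uniformly in N. Over an algebraically closed field with a primitive N-th root of unity, specialize
to clock and shift matrices times powers of two Laurent variables; these lie in a division ring of
matrices, where ranks are multiples of N. A regular representation descends to the base field.

Two points of maximal rank can be joined to a block triangular point, again of maximal rank for
every corner. Hence every kernel vector at one point lifts, so the pencil maps the span of the
kernel components into a space of smaller dimension. Such a shrunk subspace factors M through
fewer than size M coordinates, over every algebra. At a point of the domains of R and R' in a stably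
finite algebra, all of the matrix M(a) except for one row and column is invertible, so the Schur
complement of that part, which is E(a), must vanish.
*)

theory Submission
  imports Defs "Jordan_Normal_Form.Char_Poly" "HOL-Algebra.Algebraic_Closure_Type"
    "HOL-Computational_Algebra.Formal_Laurent_Series"
begin

section \<open>Matrices indexed by finite sets\<close>

text \<open>A point of a stably finite algebra cannot be approximated by matrices, so the hypothesis
  must become an algebraic certificate: a factorization of \<open>M\<close> over the base field
  through too few coordinates, which survives substitution into any algebra. That non-invertible
  blow-ups force such a factorization is the equality of noncommutative rank and inner rank for
  linear pencils. The obstacle is that the kernel argument needs one ratio \<open>h\<close> for all
  sizes, while a maximal rank at size N has no evident reason to be a multiple of N; the division
  ring supplies that reason. Expanding matrices in clock and shift matrices divides by N, so N runs
  over powers of 2, or of 3 in characteristic 2. All subexpressions enter the pencil because the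
  value of an expression is recovered by induction from the values of its parts. If R and R' have no
  common matrix point, the hypothesis is empty; this is no separate case, since the argument only
  uses that E is nowhere invertible on matrices.\<close>

lemma stably_finite_index:
  fixes A :: "'i \<Rightarrow> 'j \<Rightarrow> 'a :: {ring, monoid_mult}"
  assumes sf: "stably_finite TYPE('a)" and fin: "finite I" "finite J" and card: "card I = card J"
    and AB: "\<And>i i'. i \<in> I \<Longrightarrow> i' \<in> I \<Longrightarrow> (\<Sum>j\<in>J. A i j * B j i') = (if i = i' then 1 else 0)"
    and j: "j \<in> J" "j' \<in> J"
  shows "(\<Sum>i\<in>I. B j i * A i j') = (if j = j' then 1 else 0)"
proof -
  define m where "m = card J"
  obtain f where f: "bij_betw f {0..<m} I"
    using ex_bij_betw_nat_finite[OF fin(1)] card m_def by metis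
  obtain g where g: "bij_betw g {0..<m} J"
    using ex_bij_betw_nat_finite[OF fin(2)] m_def by metis
  \<comment> \<open>\<open>stably_finite\<close> speaks of positive sizes; the index
    \<open>j\<close> shows that \<open>J\<close> is not empty.\<close>
  have m: "m \<ge> 1" using j fin(2) unfolding m_def by (metis One_nat_def Suc_leI card_gt_0_iff empty_iff)
  define MA where "MA = mat m m (\<lambda>(p, q). A (f p) (g q))"
  define MB where "MB = mat m m (\<lambda>(p, q). B (g p) (f q))"
  have [simp]: "MA \<in> carrier_mat m m" "MB \<in> carrier_mat m m" by (auto simp: MA_def MB_def)
  have fI: "f p \<in> I" if "p < m" for p using f that by (auto simp: bij_betw_def)
  have finj: "f p = f q \<longleftrightarrow> p = q" if "p < m" "q < m" for p q
    using f that by (auto simp: bij_betw_def inj_on_def)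
  have ginj: "g p = g q \<longleftrightarrow> p = q" if "p < m" "q < m" for p q
    using g that by (auto simp: bij_betw_def inj_on_def)
  have "MA * MB = 1\<^sub>m m"
  proof (rule eq_matI)
    fix p q assume "p < dim_row (1\<^sub>m m :: 'a mat)" "q < dim_col (1\<^sub>m m :: 'a mat)"
    hence pq: "p < m" "q < m" by auto
    have "(MA * MB) $$ (p, q) = (\<Sum>k\<in>{0..<m}. A (f p) (g k) * B (g k) (f q))"
      using pq by (simp add: MA_def MB_def scalar_prod_def)
    also have "\<dots> = (\<Sum>j\<in>J. A (f p) j * B j (f q))"
      using sum.reindex_bij_betw[OF g] .
    also have "\<dots> = (1\<^sub>m m) $$ (p, q)" using pq fI finj by (simp add: AB)
    finally show "(MA * MB) $$ (p, q) = (1\<^sub>m m) $$ (p, q)" .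
  qed (auto simp: MA_def MB_def)
  hence BA: "MB * MA = 1\<^sub>m m" using sf m unfolding stably_finite_def by simp
  obtain p q where pq: "p < m" "q < m" "j = g p" "j' = g q"
    using g j by (auto simp: bij_betw_def)
  have "(\<Sum>i\<in>I. B j i * A i j') = (\<Sum>k\<in>{0..<m}. B j (f k) * A (f k) j')"
    using sum.reindex_bij_betw[OF f, symmetric] .
  also have "\<dots> = (MB * MA) $$ (p, q)" using pq by (simp add: MA_def MB_def scalar_prod_def)
  also have "\<dots> = (if j = j' then 1 else 0)" using pq ginj by (simp add: BA)
  finally show ?thesis .
qed

lemma field_stably_finite: "stably_finite TYPE('k :: field)"
  unfolding stably_finite_def using mat_mult_left_right_inverse by blast

text \<open>If \<open>I\<close> were larger than \<open>J\<close>, a subset \<open>I'\<close> of the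
  size of \<open>J\<close> would give a square one-sided inverse, hence a two-sided one. Multiplying
  by it shows that every column of \<open>B\<close> at an index in \<open>I\<close> outside
  \<open>I'\<close> is zero, against \<open>A B = 1\<close>.\<close>

lemma card_le_of_right_inverse:
  fixes A :: "'i \<Rightarrow> 'j \<Rightarrow> 'k :: field"
  assumes fin: "finite I" "finite J"
    and AB: "\<And>i i'. i \<in> I \<Longrightarrow> i' \<in> I \<Longrightarrow> (\<Sum>j\<in>J. A i j * B j i') = (if i = i' then 1 else 0)"
  shows "card I \<le> card J"
proof (rule ccontr)
  assume "\<not> ?thesis"
  then obtain I' where I': "I' \<subseteq> I" "card I' = card J" "I' \<noteq> I"
    by (metis linorder_not_le nat_le_linear obtain_subset_with_card_n order_less_imp_le less_irrefl)
  then obtain i where i: "i \<in> I" "i \<notin> I'" by blast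
  have fin': "finite I'" using I' fin finite_subset by blast
  have BA: "(\<Sum>i\<in>I'. B j i * A i j') = (if j = j' then 1 else 0)" if "j \<in> J" "j' \<in> J" for j j'
    by (rule stably_finite_index[OF field_stably_finite fin' fin(2) I'(2) AB that])
      (use I' in auto)
  have B0: "B j i = 0" if j: "j \<in> J" for j
  proof -
    have "B j i = (\<Sum>j'\<in>J. (if j = j' then 1 else 0) * B j' i)"
      using j fin by (simp add: if_distrib[of "\<lambda>x. x * _"] cong: if_cong)
    also have "\<dots> = (\<Sum>j'\<in>J. (\<Sum>k\<in>I'. B j k * A k j') * B j' i)"
      using j BA by (intro sum.cong) auto
    also have "\<dots> = (\<Sum>k\<in>I'. B j k * (\<Sum>j'\<in>J. A k j' * B j' i))"
      by (simp add: sum_distrib_right sum_distrib_left mult.assoc) (rule sum.swap)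
    also have "\<dots> = 0" using i I' by (intro sum.neutral) (auto simp: AB subset_iff)
    finally show ?thesis .
  qed
  show False using AB[OF i(1) i(1)] B0 by simp
qed

section \<open>Rank through bilinear forms\<close>

text \<open>
  Dual families replace minors and row spaces as the definition of rank. They are preserved by ring
  homomorphisms, and they can be chosen with entries in a subring.
\<close>

definition bil :: "'t set \<Rightarrow> ('t \<Rightarrow> 't \<Rightarrow> 'a :: comm_ring_1) \<Rightarrow> ('t \<Rightarrow> 'a) \<Rightarrow> ('t \<Rightarrow> 'a) \<Rightarrow> 'a" where
  "bil T Z f g = (\<Sum>s\<in>T. \<Sum>t\<in>T. f s * Z s t * g t)"

definition rank_ge :: "'t set \<Rightarrow> ('t \<Rightarrow> 't \<Rightarrow> 'a :: comm_ring_1) \<Rightarrow> nat \<Rightarrow> bool" where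
  "rank_ge T Z r \<longleftrightarrow>
     (\<exists>P Q. \<forall>a<r. \<forall>b<r. bil T Z (P a) (Q b) = (if a = b then 1 else 0))"

lemma bil_diff_left: "bil T Z (\<lambda>s. f s - g s) h = bil T Z f h - bil T Z g h"
  by (simp add: bil_def algebra_simps sum_subtractf)

lemma bil_diff_right: "bil T Z h (\<lambda>s. f s - g s) = bil T Z h f - bil T Z h g"
  by (simp add: bil_def algebra_simps sum_subtractf)

lemma bil_scale_left: "bil T Z (\<lambda>s. c * f s) h = c * bil T Z f h"
  by (simp add: bil_def algebra_simps sum_distrib_left)

lemma bil_sum_left: "bil T Z (\<lambda>s. \<Sum>c\<in>R. k c * f c s) h = (\<Sum>c\<in>R. k c * bil T Z (f c) h)"
proof -
  have "bil T Z (\<lambda>s. \<Sum>c\<in>R. k c * f c s) h = (\<Sum>s\<in>T. \<Sum>t\<in>T. \<Sum>c\<in>R. k c * (f c s * Z s t * h t))"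
    by (simp add: bil_def sum_distrib_right mult.assoc)
  also have "\<dots> = (\<Sum>s\<in>T. \<Sum>c\<in>R. \<Sum>t\<in>T. k c * (f c s * Z s t * h t))"
    by (rule sum.cong[OF refl]) (rule sum.swap)
  also have "\<dots> = (\<Sum>c\<in>R. \<Sum>s\<in>T. \<Sum>t\<in>T. k c * (f c s * Z s t * h t))"
    by (rule sum.swap)
  finally show ?thesis by (simp add: bil_def sum_distrib_left)
qed

lemma bil_swap: "bil T Z f g = bil T (\<lambda>s t. Z t s) g f"
  unfolding bil_def by (subst sum.swap) (simp add: mult.commute mult.left_commute)

lemma bil_sum_right: "bil T Z h (\<lambda>s. \<Sum>c\<in>R. k c * f c s) = (\<Sum>c\<in>R. k c * bil T Z h (f c))"
  by (subst (1 2) bil_swap) (rule bil_sum_left)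

lemma bil_cong:
  assumes "\<And>s t. s \<in> T \<Longrightarrow> t \<in> T \<Longrightarrow> Z s t = Z' s t" "\<And>s. s \<in> T \<Longrightarrow> f s = f' s"
    "\<And>t. t \<in> T \<Longrightarrow> g t = g' t"
  shows "bil T Z f g = bil T Z' f' g'"
  unfolding bil_def by (intro sum.cong refl) (simp add: assms)

lemma bil_unit_left:
  assumes "finite T" "s \<in> T"
  shows "bil T Z (\<lambda>s'. if s' = s then 1 else 0) g = (\<Sum>t\<in>T. Z s t * g t)"
proof -
  have "bil T Z (\<lambda>s'. if s' = s then 1 else 0) g
      = (\<Sum>s'\<in>T. if s' = s then (\<Sum>t\<in>T. Z s t * g t) else 0)"
    unfolding bil_def by (intro sum.cong refl) auto
  thus ?thesis using assms by simp
qed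

lemma bil_unit:
  assumes "finite T" "s \<in> T" "t \<in> T"
  shows "bil T Z (\<lambda>s'. if s' = s then 1 else 0) (\<lambda>t'. if t' = t then 1 else 0) = Z s t"
  using assms by (simp add: bil_unit_left if_distrib[of "\<lambda>x. _ * x"] cong: if_cong)

text \<open>A Gram-Schmidt step with respect to \<open>Z\<close>: the new vectors are corrected by
  their components along the old pairs, and what remains of their pairing is the Schur complement in
  \<open>ev\<close>. The new pairs come as a set \<open>R'\<close> because over a division ring of
  matrices a whole block is added at once.\<close>

lemma bil_extend:
  fixes Z :: "'t \<Rightarrow> 't \<Rightarrow> 'a :: comm_ring_1"
  assumes fin: "finite R" and disj: "R \<inter> R' = {}"
    and PQ: "\<And>a b. a \<in> R \<Longrightarrow> b \<in> R \<Longrightarrow> bil T Z (P a) (Q b) = (if a = b then 1 else 0)"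
    and ev: "\<And>a b. a \<in> R' \<Longrightarrow> b \<in> R' \<Longrightarrow>
      bil T Z (e a) (v b) - (\<Sum>c\<in>R. bil T Z (e a) (Q c) * bil T Z (P c) (v b)) = (if a = b then 1 else 0)"
  defines "P' \<equiv> \<lambda>a. if a \<in> R then P a else (\<lambda>s. e a s - (\<Sum>c\<in>R. bil T Z (e a) (Q c) * P c s))"
  defines "Q' \<equiv> \<lambda>b. if b \<in> R then Q b else (\<lambda>t. v b t - (\<Sum>c\<in>R. bil T Z (P c) (v b) * Q c t))"
  assumes ab: "a \<in> R \<union> R'" "b \<in> R \<union> R'"
  shows "bil T Z (P' a) (Q' b) = (if a = b then 1 else 0)"
proof -
  have delta1: "(\<Sum>c\<in>R. k c * (if c = b then 1 else 0)) = k b" if "b \<in> R" for b and k :: "_ \<Rightarrow> 'a"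
    using that fin by (simp add: if_distrib[of "\<lambda>x. _ * x"] cong: if_cong)
  have delta2: "(\<Sum>c\<in>R. k c * (if b = c then 1 else 0)) = k b" if "b \<in> R" for b and k :: "_ \<Rightarrow> 'a"
    using that fin by (simp add: if_distrib[of "\<lambda>x. _ * x"] cong: if_cong)
  have new_old: "bil T Z (P' a) (Q b) = 0" if "a \<in> R'" "b \<in> R" for a b
    using that disj by (auto simp: P'_def bil_diff_left bil_sum_left PQ delta1)
  consider "a \<in> R" "b \<in> R" | "a \<in> R" "b \<in> R'" "b \<notin> R" | "a \<in> R'" "b \<in> R" "a \<notin> R"
    | "a \<in> R'" "a \<notin> R" "b \<in> R'" "b \<notin> R" using ab by blast
  then show ?thesis
  proof cases
    case 1 thus ?thesis by (simp add: P'_def Q'_def PQ)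
  next
    case 2 thus ?thesis by (auto simp: P'_def Q'_def PQ bil_diff_right bil_sum_right delta2)
  next
    case 3 thus ?thesis using new_old[of a b] by (auto simp: Q'_def)
  next
    case 4
    have "bil T Z (P' a) (Q' b) = bil T Z (P' a) (v b) - (\<Sum>c\<in>R. bil T Z (P c) (v b) * bil T Z (P' a) (Q c))"
      using 4 by (simp add: Q'_def bil_diff_right bil_sum_right)
    also have "\<dots> = bil T Z (P' a) (v b)" using 4 new_old by simp
    also have "\<dots> = bil T Z (e a) (v b) - (\<Sum>c\<in>R. bil T Z (e a) (Q c) * bil T Z (P c) (v b))"
      using 4 by (simp add: P'_def bil_diff_left bil_sum_left)
    finally show ?thesis using ev 4 by simp
  qed
qed

text \<open>For a single new pair, a nonzero Schur complement \<open>d\<close> is normalized by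
  scaling \<open>f\<close> by \<open>1 / d\<close>. The shape of \<open>Q' r\<close> is recorded so
  that the \<open>Q\<close>s can be kept inside a given subspace.\<close>

lemma bil_extend_one:
  fixes Z :: "'t \<Rightarrow> 't \<Rightarrow> 'a :: field"
  assumes PQ: "\<And>a b. a < r \<Longrightarrow> b < r \<Longrightarrow> bil T Z (P a) (Q b) = (if a = b then 1 else 0)"
    and neq: "bil T Z f g \<noteq> (\<Sum>c<r. bil T Z f (Q c) * bil T Z (P c) g)"
  obtains P' Q' where
    "\<And>a b. a < Suc r \<Longrightarrow> b < Suc r \<Longrightarrow> bil T Z (P' a) (Q' b) = (if a = b then 1 else 0)"
    "\<And>a. a < r \<Longrightarrow> P' a = P a" "\<And>a. a < r \<Longrightarrow> Q' a = Q a"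
    "Q' r = (\<lambda>t. g t - (\<Sum>c<r. bil T Z (P c) g * Q c t))"
proof -
  define d where "d = bil T Z f g - (\<Sum>c<r. bil T Z f (Q c) * bil T Z (P c) g)"
  have d: "d \<noteq> 0" using neq by (simp add: d_def)
  define e where "e = (\<lambda>a::nat. \<lambda>s. (1 / d) * f s)"
  define v where "v = (\<lambda>a::nat. g)"
  have ev: "bil T Z (e a) (v b) - (\<Sum>c\<in>{..<r}. bil T Z (e a) (Q c) * bil T Z (P c) (v b)) = 1" for a b
  proof -
    have "bil T Z (e a) (v b) - (\<Sum>c\<in>{..<r}. bil T Z (e a) (Q c) * bil T Z (P c) (v b)) = (1/d) * d"
      unfolding e_def v_def bil_scale_left d_def
      by (simp only: right_diff_distrib sum_distrib_left mult.assoc)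
    thus ?thesis using d by simp
  qed
  define P' where "P' = (\<lambda>a. if a \<in> {..<r} then P a else (\<lambda>s. e a s - (\<Sum>c\<in>{..<r}. bil T Z (e a) (Q c) * P c s)))"
  define Q' where "Q' = (\<lambda>b. if b \<in> {..<r} then Q b else (\<lambda>t. v b t - (\<Sum>c\<in>{..<r}. bil T Z (P c) (v b) * Q c t)))"
  have "bil T Z (P' a) (Q' b) = (if a = b then 1 else 0)" if "a < Suc r" "b < Suc r" for a b
    unfolding P'_def Q'_def
    by (rule bil_extend[where R' = "{r}"]) (use PQ ev that in auto)
  thus ?thesis by (rule that[of P' Q']) (auto simp: P'_def Q'_def v_def)
qed

text \<open>A nonzero defect would extend the dual families by \<open>bil_extend_one\<close>. At
  maximal rank the families therefore give a rank factorization of \<open>Z\<close>; the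
  construction of kernel vectors and the reflection of ranks along homomorphisms rest on it.\<close>

lemma bil_maximal:
  fixes Z :: "'t \<Rightarrow> 't \<Rightarrow> 'a :: field"
  assumes PQ: "\<And>a b. a < r \<Longrightarrow> b < r \<Longrightarrow> bil T Z (P a) (Q b) = (if a = b then 1 else 0)"
    and max: "\<not> rank_ge T Z (Suc r)"
  shows "bil T Z f g = (\<Sum>c<r. bil T Z f (Q c) * bil T Z (P c) g)"
proof (rule ccontr)
  assume neq: "\<not> ?thesis"
  have "rank_ge T Z (Suc r)"
    unfolding rank_ge_def
    by (rule bil_extend_one[where P = P and Q = Q and f = f and g = g and T = T and Z = Z, OF PQ neq]) blast+
  with max show False by simp
qed

lemma rank_geI:
  assumes "finite R"
    "\<And>a b. a \<in> R \<Longrightarrow> b \<in> R \<Longrightarrow> bil T Z (P a) (Q b) = (if a = b then 1 else 0)"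
  shows "rank_ge T Z (card R)"
proof -
  obtain f where f: "bij_betw f {0..<card R} R" using ex_bij_betw_nat_finite[OF assms(1)] by blast
  have fR: "f a \<in> R" if "a < card R" for a using f that by (auto simp: bij_betw_def)
  have finj: "f a = f b \<longleftrightarrow> a = b" if "a < card R" "b < card R" for a b
    using f that by (auto simp: bij_betw_def inj_on_def)
  show ?thesis unfolding rank_ge_def
    by (rule exI[of _ "P \<circ> f"], rule exI[of _ "Q \<circ> f"]) (simp add: assms(2) fR finj)
qed

lemma rank_ge_mono:
  assumes "rank_ge T Z r" "r' \<le> r"
  shows "rank_ge T Z r'"
proof -
  obtain P Q where "\<forall>a<r. \<forall>b<r. bil T Z (P a) (Q b) = (if a = b then 1 else 0)"
    using assms(1) unfolding rank_ge_def by blast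
  hence "\<forall>a<r'. \<forall>b<r'. bil T Z (P a) (Q b) = (if a = b then 1 else 0)"
    using assms(2) by simp
  thus ?thesis unfolding rank_ge_def by blast
qed

lemma rank_ge_0: "rank_ge T Z 0"
  by (simp add: rank_ge_def)

lemma rank_ge_cong:
  assumes "\<And>s t. s \<in> T \<Longrightarrow> t \<in> T \<Longrightarrow> Z s t = Z' s t"
  shows "rank_ge T Z r \<longleftrightarrow> rank_ge T Z' r"
proof -
  have "bil T Z f g = bil T Z' f g" for f g by (rule bil_cong) (use assms in auto)
  thus ?thesis by (simp add: rank_ge_def)
qed

text \<open>The coordinates \<open>G (P a)\<close> and \<open>H (Q b)\<close> form two matrices
  whose product is the identity of size \<open>r\<close>.\<close>

lemma rank_ge_factor:
  fixes Z :: "'t \<Rightarrow> 't \<Rightarrow> 'a :: field"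
  assumes fin: "finite R" and Z: "\<And>f g. bil T Z f g = (\<Sum>c\<in>R. G f c * H c g)"
    and r: "rank_ge T Z r"
  shows "r \<le> card R"
proof -
  obtain P Q where "\<forall>a<r. \<forall>b<r. bil T Z (P a) (Q b) = (if a = b then 1 else 0)"
    using r unfolding rank_ge_def by blast
  hence "card {..<r} \<le> card R"
    by (intro card_le_of_right_inverse[where A = "\<lambda>a c. G (P a) c" and B = "\<lambda>c b. H c (Q b)"])
      (use fin in \<open>auto simp: Z[symmetric]\<close>)
  thus ?thesis by simp
qed

lemma rank_ge_le_card:
  fixes Z :: "'t \<Rightarrow> 't \<Rightarrow> 'a :: field"
  assumes "finite T" "rank_ge T Z r"
  shows "r \<le> card T"
  by (rule rank_ge_factor[OF assms(1) _ assms(2), where G = "\<lambda>f s. f s" and H = "\<lambda>s g. \<Sum>t\<in>T. Z s t * g t"])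
    (simp add: bil_def sum_distrib_left mult.assoc)

lemma rank_ge_max:
  fixes Z :: "'t \<Rightarrow> 't \<Rightarrow> 'a :: field"
  assumes "finite T"
  obtains r where "rank_ge T Z r" "\<And>r'. rank_ge T Z r' \<Longrightarrow> r' \<le> r"
proof -
  have "finite {r. rank_ge T Z r}"
    by (rule finite_subset[of _ "{..card T}"]) (use rank_ge_le_card[OF assms] in auto)
  moreover have "{r. rank_ge T Z r} \<noteq> {}" using rank_ge_0 by blast
  ultimately show ?thesis using that[of "Max {r. rank_ge T Z r}"] Max_in[of "{r. rank_ge T Z r}"]
    by (auto intro: Max_ge)
qed

text \<open>With \<open>card T\<close> dual pairs, the square matrix \<open>P\<close> has the right
  inverse \<open>Z Q\<close>, and \<open>P Z\<close> has the right inverse \<open>Q\<close>. Over a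
  field both are two-sided, so \<open>Y = Q P\<close> inverts \<open>Z\<close> from either
  side.\<close>

lemma rank_ge_full_inverse:
  fixes Z :: "'t \<Rightarrow> 't \<Rightarrow> 'a :: field"
  assumes fin: "finite T" and r: "rank_ge T Z (card T)"
  obtains Y where
    "\<And>s t. s \<in> T \<Longrightarrow> t \<in> T \<Longrightarrow> (\<Sum>u\<in>T. Z s u * Y u t) = (if s = t then 1 else 0)"
    "\<And>s t. s \<in> T \<Longrightarrow> t \<in> T \<Longrightarrow> (\<Sum>u\<in>T. Y s u * Z u t) = (if s = t then 1 else 0)"
proof -
  obtain P Q where PQ: "\<forall>a<card T. \<forall>b<card T. bil T Z (P a) (Q b) = (if a = b then 1 else 0)"
    using r unfolding rank_ge_def by blast
  define Y where "Y = (\<lambda>s t. \<Sum>c<card T. Q c s * P c t)"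
  have 1: "bil T Z (P a) (Q b) = (\<Sum>s\<in>T. P a s * (\<Sum>t\<in>T. Z s t * Q b t))" for a b
    by (simp add: bil_def sum_distrib_left mult.assoc)
  have 2: "bil T Z (P a) (Q b) = (\<Sum>t\<in>T. (\<Sum>s\<in>T. P a s * Z s t) * Q b t)" for a b
    unfolding bil_def by (subst sum.swap) (simp add: sum_distrib_right)
  have A: "(\<Sum>c<card T. (\<Sum>u\<in>T. Z s u * Q c u) * P c t) = (if s = t then 1 else 0)"
    if "s \<in> T" "t \<in> T" for s t
    by (rule stably_finite_index[OF field_stably_finite _ fin _ _ that, where A = P])
      (use PQ 1 in auto)
  have B: "(\<Sum>c<card T. Q c s * (\<Sum>u\<in>T. P c u * Z u t)) = (if s = t then 1 else 0)"
    if "s \<in> T" "t \<in> T" for s t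
    by (rule stably_finite_index[OF field_stably_finite _ fin _ _ that,
          where A = "\<lambda>c t. \<Sum>u\<in>T. P c u * Z u t" and B = "\<lambda>s c. Q c s"])
      (use PQ 2 in auto)
  show ?thesis
  proof (rule that[of Y])
    fix s t assume st: "s \<in> T" "t \<in> T"
    show "(\<Sum>u\<in>T. Z s u * Y u t) = (if s = t then 1 else 0)"
      unfolding A[OF st, symmetric] Y_def sum_distrib_left sum_distrib_right mult.assoc
      by (rule sum.swap)
    show "(\<Sum>u\<in>T. Y s u * Z u t) = (if s = t then 1 else 0)"
      unfolding B[OF st, symmetric] Y_def sum_distrib_left sum_distrib_right mult.assoc
      by (rule sum.swap)
  qed
qed

lemma rank_ge_inverse_full:
  fixes Z :: "'t \<Rightarrow> 't \<Rightarrow> 'a :: field"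
  assumes fin: "finite T"
    and Y: "\<And>s t. s \<in> T \<Longrightarrow> t \<in> T \<Longrightarrow> (\<Sum>u\<in>T. Z s u * Y u t) = (if s = t then 1 else 0)"
  shows "rank_ge T Z (card T)"
  by (rule rank_geI[OF fin, where P = "\<lambda>s s'. if s' = s then 1 else 0" and Q = "\<lambda>t u. Y u t"])
    (use fin Y in \<open>simp add: bil_unit_left\<close>)

text \<open>A unit vector minus its components along the dual pairs lies in the kernel, by
  \<open>bil_maximal\<close>. If all these differences vanished on \<open>T\<close>, the identity of
  size \<open>card T\<close> would factor through \<open>r < card T\<close> coordinates.\<close>

lemma kernel_nonzero:
  fixes Z :: "'t \<Rightarrow> 't \<Rightarrow> 'a :: field"
  assumes fin: "finite T" and r: "rank_ge T Z r" "\<not> rank_ge T Z (Suc r)" "r < card T"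
  obtains v t where "\<And>s. s \<in> T \<Longrightarrow> (\<Sum>t\<in>T. Z s t * v t) = 0" "t \<in> T" "v t \<noteq> 0"
proof -
  obtain P Q where PQ: "\<And>a b. a < r \<Longrightarrow> b < r \<Longrightarrow> bil T Z (P a) (Q b) = (if a = b then 1 else 0)"
    using r unfolding rank_ge_def by blast
  define E where "E = (\<lambda>s s' :: 't. if s' = s then 1 else 0 :: 'a)"
  define v where "v = (\<lambda>u t. E u t - (\<Sum>c<r. bil T Z (P c) (E u) * Q c t))"
  have ker: "bil T Z f (v u) = 0" for f u
    unfolding v_def bil_diff_right bil_sum_right
    using bil_maximal[where P = P and Q = Q and Z = Z, OF PQ r(2), of f "E u"]
    by (simp add: mult.commute)
  have "\<exists>u\<in>T. \<exists>t\<in>T. v u t \<noteq> 0"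
  proof (rule ccontr)
    assume "\<not> ?thesis"
    hence "(\<Sum>c<r. Q c t * bil T Z (P c) (E u)) = (if t = u then 1 else 0)" if "u \<in> T" "t \<in> T" for u t
      using that by (auto simp: v_def E_def mult.commute)
    hence "card T \<le> card {..<r}"
      by (intro card_le_of_right_inverse[where A = "\<lambda>t c. Q c t" and B = "\<lambda>c u. bil T Z (P c) (E u)"])
        (use fin in auto)
    with r(3) show False by simp
  qed
  then obtain u t where "t \<in> T" "v u t \<noteq> 0" by blast
  moreover have "(\<Sum>t\<in>T. Z s t * v u t) = 0" if "s \<in> T" for s
    using ker[of "E s" u] bil_unit_left[OF fin that, of Z "v u"] by (simp add: E_def)
  ultimately show ?thesis using that by blast
qed

section \<open>Spans and bases adapted to a subspace\<close>

inductive_set lspan :: "('i \<Rightarrow> 'k :: comm_ring_1) set \<Rightarrow> ('i \<Rightarrow> 'k) set" for G where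
  zero: "(\<lambda>i. 0) \<in> lspan G"
| gen: "g \<in> G \<Longrightarrow> g \<in> lspan G"
| comb: "v \<in> lspan G \<Longrightarrow> w \<in> lspan G \<Longrightarrow> (\<lambda>i. v i + c * w i) \<in> lspan G"

lemma lspan_sum: "(\<And>a. a < r \<Longrightarrow> q a \<in> lspan G) \<Longrightarrow> (\<lambda>i. \<Sum>a<(r::nat). k a * q a i) \<in> lspan G"
proof (induction r)
  case (Suc r)
  show ?case using lspan.comb[OF Suc.IH Suc.prems[of r], of "k r"] Suc.prems by simp
qed (simp add: lspan.zero)

lemma lspan_diff: "v \<in> lspan G \<Longrightarrow> w \<in> lspan G \<Longrightarrow> (\<lambda>i. v i - w i) \<in> lspan G"
  using lspan.comb[of v G w "-1"] by simp

text \<open>A biorthogonal system of maximal length with its \<open>Q\<close>s in the span is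
  completed to one of length \<open>card I\<close>. The matrix \<open>S\<close> holds the basis as
  columns, \<open>S'\<close> the dual basis as rows, and the first \<open>u\<close> columns span the
  given subspace on \<open>I\<close>.\<close>

lemma adapted_basis:
  fixes G :: "('i \<Rightarrow> 'k :: field) set"
  assumes fin: "finite I"
  obtains S S' u where "u \<le> card I"
    "\<And>i i'. i \<in> I \<Longrightarrow> i' \<in> I \<Longrightarrow> (\<Sum>a<card I. S i a * S' a i') = (if i = i' then 1 else 0)"
    "\<And>a b. a < card I \<Longrightarrow> b < card I \<Longrightarrow> (\<Sum>i\<in>I. S' a i * S i b) = (if a = b then 1 else 0)"
    "\<And>a. a < u \<Longrightarrow> (\<lambda>i. S i a) \<in> lspan G"
    "\<And>v i. v \<in> lspan G \<Longrightarrow> i \<in> I \<Longrightarrow> v i = (\<Sum>a<u. S i a * (\<Sum>j\<in>I. S' a j * v j))"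
proof -
  \<comment> \<open>For the identity form, dual families are biorthogonal systems, so the extension
    lemmas for \<open>bil\<close> build bases.\<close>
  define D :: "'i \<Rightarrow> 'i \<Rightarrow> 'k" where "D = (\<lambda>i j. if i = j then 1 else 0)"
  have dot: "bil I D f g = (\<Sum>i\<in>I. f i * g i)" for f g
    using fin unfolding bil_def D_def
    by (intro sum.cong refl) (simp add: if_distrib[of "\<lambda>x. _ * x"] if_distrib[of "\<lambda>x. x * _"] cong: if_cong)
  define dual where "dual = (\<lambda>(r::nat) P Q. \<forall>a<r. \<forall>b<r. bil I D (P a) (Q b) = (if a = b then 1 else (0::'k)))"
  define ok where "ok = (\<lambda>r. \<exists>P Q. dual r P Q \<and> (\<forall>a<r. Q a \<in> lspan G))"
  have bound: "r \<le> card I" if "ok r" for r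
  proof -
    have "rank_ge I D r" using that unfolding ok_def dual_def rank_ge_def by blast
    thus ?thesis by (rule rank_ge_le_card[OF fin])
  qed
  have "finite {r. ok r}" by (rule finite_subset[of _ "{..card I}"]) (use bound in auto)
  moreover have "ok 0" by (simp add: ok_def dual_def)
  ultimately have "ok (Max {r. ok r})" "\<And>r. ok r \<Longrightarrow> r \<le> Max {r. ok r}"
    using Max_in[of "{r. ok r}"] Max_ge[of "{r. ok r}"] by auto
  then obtain u where u: "ok u" "\<not> ok (Suc u)" by (meson Suc_n_not_le_n)
  then obtain P Q where PQ: "dual u P Q" "\<And>a. a < u \<Longrightarrow> Q a \<in> lspan G" unfolding ok_def by blast
  \<comment> \<open>A vector \<open>v\<close> violating this could be added to the system: the new
    member is \<open>v\<close> minus a combination of the \<open>Q\<close>s, so it stays in the span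
    and contradicts the choice of \<open>u\<close>.\<close>
  have spanned: "bil I D f v = (\<Sum>c<u. bil I D f (Q c) * bil I D (P c) v)" if v: "v \<in> lspan G" for f v
  proof (rule ccontr)
    assume neq: "\<not> ?thesis"
    obtain P' Q' where P'Q': "\<And>a b. a < Suc u \<Longrightarrow> b < Suc u \<Longrightarrow> bil I D (P' a) (Q' b) = (if a = b then 1 else 0)"
      "\<And>a. a < u \<Longrightarrow> Q' a = Q a"
      "Q' u = (\<lambda>t. v t - (\<Sum>c<u. bil I D (P c) v * Q c t))"
      by (rule bil_extend_one[of u I D P Q f v]) (use neq PQ(1) in \<open>auto simp: dual_def\<close>)
    have "Q' u \<in> lspan G" unfolding P'Q'(3) by (intro lspan_diff v lspan_sum PQ(2))
    hence "\<forall>a<Suc u. Q' a \<in> lspan G" using P'Q'(2) PQ(2) by (auto simp: less_Suc_eq)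
    moreover have "dual (Suc u) P' Q'" using P'Q'(1) unfolding dual_def by blast
    ultimately have "ok (Suc u)" unfolding ok_def by blast
    with u(2) show False by simp
  qed
  have "\<exists>P' Q'. dual r P' Q' \<and> (\<forall>a<u. Q' a = Q a)" if "u \<le> r" "r \<le> card I" for r
    using that
  proof (induction r rule: dec_induct)
    case base
    show ?case using PQ(1) by blast
  next
    case (step r)
    have "\<exists>P' Q'. dual r P' Q' \<and> (\<forall>a<u. Q' a = Q a)"
      by (rule step.IH) (use step.prems step.hyps in linarith)+
    then obtain P' Q' where P'Q': "dual r P' Q'" "\<forall>a<u. Q' a = Q a" by blast
    \<comment> \<open>Otherwise the identity form, of rank \<open>card I\<close>, would factor
      through \<open>r < card I\<close> coordinates.\<close>
    have "\<exists>f g. bil I D f g \<noteq> (\<Sum>c<r. bil I D f (Q' c) * bil I D (P' c) g)"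
    proof (rule ccontr)
      assume "\<not> ?thesis"
      hence "bil I D f g = (\<Sum>c\<in>{..<r}. bil I D f (Q' c) * bil I D (P' c) g)" for f g by blast
      moreover have "rank_ge I D (card I)"
        by (rule rank_ge_inverse_full[OF fin, where Y = D]) (use fin in \<open>simp add: D_def if_distrib[of "\<lambda>x. x * _"] cong: if_cong\<close>)
      ultimately have "card I \<le> card {..<r}" by (rule rank_ge_factor[OF finite_lessThan])
      thus False using step.prems by simp
    qed
    then obtain f g where neq: "bil I D f g \<noteq> (\<Sum>c<r. bil I D f (Q' c) * bil I D (P' c) g)" by blast
    obtain P'' Q'' where "\<And>a b. a < Suc r \<Longrightarrow> b < Suc r \<Longrightarrow> bil I D (P'' a) (Q'' b) = (if a = b then 1 else 0)"
      "\<And>a. a < r \<Longrightarrow> Q'' a = Q' a"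
      by (rule bil_extend_one[of r I D P' Q' f g]) (use P'Q'(1) neq in \<open>auto simp: dual_def\<close>)
    hence "dual (Suc r) P'' Q''" "\<forall>a<u. Q'' a = Q a" using P'Q'(2) step(1) unfolding dual_def by auto
    thus ?case by blast
  qed
  then obtain P' Q' where P'Q': "dual (card I) P' Q'" "\<And>a. a < u \<Longrightarrow> Q' a = Q a"
    using bound[OF u(1)] by blast
  have SS: "(\<Sum>i\<in>I. P' a i * Q' b i) = (if a = b then 1 else 0)" if "a < card I" "b < card I" for a b
    using P'Q'(1) that unfolding dual_def dot by simp
  show ?thesis
  proof (rule that[of u "\<lambda>i a. Q' a i" P'])
    show "u \<le> card I" by (rule bound[OF u(1)])
    show "(\<Sum>a<card I. Q' a i * P' a i') = (if i = i' then 1 else 0)" if "i \<in> I" "i' \<in> I" for i i'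
      by (rule stably_finite_index[OF field_stably_finite _ fin _ _ that, where A = P'])
        (use SS in auto)
    show "(\<Sum>i\<in>I. P' a i * Q' b i) = (if a = b then 1 else 0)" if "a < card I" "b < card I" for a b
      using SS that .
    show "(\<lambda>i. Q' a i) \<in> lspan G" if "a < u" for a using P'Q'(2) PQ(2) that by simp
    show "v i = (\<Sum>a<u. Q' a i * (\<Sum>j\<in>I. P' a j * v j))" if v: "v \<in> lspan G" and i: "i \<in> I" for v i
    proof -
      \<comment> \<open>The completion is only known to keep the first \<open>Q\<close>s. On the
        span, \<open>P'\<close> and \<open>P\<close> nevertheless give the same coordinates, as both
        are dual to these \<open>Q\<close>s.\<close>
      have dd: "bil I D (P' a) v = bil I D (P a) v" if "a < u" for a
      proof -
        have "bil I D (P' a) (Q c) = (if a = c then 1 else 0)" if c: "c < u" for c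
        proof -
          have "a < card I" "c < card I" using \<open>a < u\<close> c bound[OF u(1)] by auto
          hence "bil I D (P' a) (Q' c) = (if a = c then 1 else 0)" using P'Q'(1) unfolding dual_def by blast
          thus ?thesis unfolding P'Q'(2)[OF c] .
        qed
        hence "bil I D (P' a) v = (\<Sum>c<u. (if a = c then 1 else 0) * bil I D (P c) v)"
          unfolding spanned[OF v, of "P' a"] by (intro sum.cong refl) simp
        thus ?thesis using that by (simp add: if_distrib[of "\<lambda>x. x * _"] cong: if_cong)
      qed
      have "v i = bil I D (\<lambda>j. if j = i then 1 else 0) v"
        unfolding dot using fin i by (simp add: if_distrib[of "\<lambda>x. x * _"] cong: if_cong)
      also have "\<dots> = (\<Sum>c<u. Q c i * bil I D (P c) v)"
      proof -
        have "bil I D (\<lambda>j. if j = i then 1 else 0) (Q c) = Q c i" for c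
          unfolding dot using fin i by (simp add: if_distrib[of "\<lambda>x. x * _"] cong: if_cong)
        thus ?thesis by (subst spanned[OF v]) simp
      qed
      also have "\<dots> = (\<Sum>a<u. Q' a i * bil I D (P' a) v)"
        using dd P'Q'(2) by (intro sum.cong) auto
      finally show ?thesis by (simp add: dot)
    qed
  qed
qed

section \<open>Block triangular matrices\<close>

lemma bil_support:
  assumes "finite T" "A \<subseteq> T" "B \<subseteq> T"
    "\<And>s. s \<in> T - A \<Longrightarrow> f s = 0" "\<And>t. t \<in> T - B \<Longrightarrow> g t = 0"
  shows "bil T Z f g = (\<Sum>s\<in>A. \<Sum>t\<in>B. f s * Z s t * g t)"
proof -
  have "bil T Z f g = (\<Sum>s\<in>A. \<Sum>t\<in>T. f s * Z s t * g t)"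
    unfolding bil_def by (rule sum.mono_neutral_right) (use assms in auto)
  also have "\<dots> = (\<Sum>s\<in>A. \<Sum>t\<in>B. f s * Z s t * g t)"
    by (intro sum.cong refl sum.mono_neutral_right) (use assms in auto)
  finally show ?thesis .
qed

text \<open>The dual families of the two corners are extended by zero. The vanishing block makes the
  left vectors of the second corner orthogonal to the right vectors of the first, so only the right
  vectors of the second corner need a correction. The two support conditions are what the lifting of
  kernel vectors uses.\<close>

lemma triangular_dual:
  fixes Z :: "'t \<Rightarrow> 't \<Rightarrow> 'a :: field"
  assumes fin: "finite T1" "finite T2" and disj: "T1 \<inter> T2 = {}"
    and Z: "\<And>s t. s \<in> T2 \<Longrightarrow> t \<in> T1 \<Longrightarrow> Z s t = 0"
    and r: "rank_ge T1 Z r1" "rank_ge T2 Z r2"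
  obtains P Q where
    "\<And>a b. a < r1 + r2 \<Longrightarrow> b < r1 + r2 \<Longrightarrow> bil (T1 \<union> T2) Z (P a) (Q b) = (if a = b then 1 else 0)"
    "\<And>c t. c < r1 \<Longrightarrow> t \<in> T2 \<Longrightarrow> Q c t = 0"
    "\<And>c s. r1 \<le> c \<Longrightarrow> s \<in> T1 \<Longrightarrow> P c s = 0"
proof -
  obtain P1 Q1 where PQ1: "\<And>a b. a < r1 \<Longrightarrow> b < r1 \<Longrightarrow> bil T1 Z (P1 a) (Q1 b) = (if a = b then 1 else 0)"
    using r(1) unfolding rank_ge_def by blast
  obtain P2 Q2 where PQ2: "\<And>a b. a < r2 \<Longrightarrow> b < r2 \<Longrightarrow> bil T2 Z (P2 a) (Q2 b) = (if a = b then 1 else 0)"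
    using r(2) unfolding rank_ge_def by blast
  let ?T = "T1 \<union> T2"
  define ext where "ext = (\<lambda>A (f :: 't \<Rightarrow> 'a) s. if s \<in> A then f s else 0)"
  have bil11: "bil ?T Z (ext T1 f) (ext T1 g) = bil T1 Z f g" for f g
    by (subst bil_support[where A = T1 and B = T1]) (use fin disj in \<open>auto simp: ext_def bil_def\<close>)
  have bil22: "bil ?T Z (ext T2 f) (ext T2 g) = bil T2 Z f g" for f g
    by (subst bil_support[where A = T2 and B = T2]) (use fin disj in \<open>auto simp: ext_def bil_def\<close>)
  have bil21: "bil ?T Z (ext T2 f) (ext T1 g) = 0" for f g
    by (subst bil_support[where A = T2 and B = T1]) (use fin disj Z in \<open>auto simp: ext_def\<close>)
  define P0 where "P0 = (\<lambda>a. ext T1 (P1 a))"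
  define Q0 where "Q0 = (\<lambda>a. ext T1 (Q1 a))"
  define e where "e = (\<lambda>a. ext T2 (P2 (a - r1)))"
  define v where "v = (\<lambda>a. ext T2 (Q2 (a - r1)))"
  define P where "P = (\<lambda>a. if a \<in> {..<r1} then P0 a else (\<lambda>s. e a s - (\<Sum>c\<in>{..<r1}. bil ?T Z (e a) (Q0 c) * P0 c s)))"
  define Q where "Q = (\<lambda>b. if b \<in> {..<r1} then Q0 b else (\<lambda>t. v b t - (\<Sum>c\<in>{..<r1}. bil ?T Z (P0 c) (v b) * Q0 c t)))"
  show ?thesis
  proof (rule that[of P Q])
    fix a b assume ab: "a < r1 + r2" "b < r1 + r2"
    show "bil ?T Z (P a) (Q b) = (if a = b then 1 else 0)"
      unfolding P_def Q_def
    proof (rule bil_extend[where R' = "{r1..<r1+r2}"])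
      show "bil ?T Z (e a) (v b) - (\<Sum>c<r1. bil ?T Z (e a) (Q0 c) * bil ?T Z (P0 c) (v b)) = (if a = b then 1 else 0)"
        if "a \<in> {r1..<r1+r2}" "b \<in> {r1..<r1+r2}" for a b
        using that PQ2[of "a - r1" "b - r1"] by (auto simp: e_def v_def Q0_def bil22 bil21)
    qed (use ab PQ1 in \<open>auto simp: P0_def Q0_def bil11\<close>)
  next
    show "Q c t = 0" if "c < r1" "t \<in> T2" for c t
      using that disj by (auto simp: Q_def Q0_def ext_def)
    show "P c s = 0" if "r1 \<le> c" "s \<in> T1" for c s
      using that disj by (auto simp: P_def e_def Q0_def bil21) (auto simp: ext_def)
  qed
qed

lemma rank_ge_triangular:
  fixes Z :: "'t \<Rightarrow> 't \<Rightarrow> 'a :: field"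
  assumes "finite T1" "finite T2" "T1 \<inter> T2 = {}"
    "\<And>s t. s \<in> T2 \<Longrightarrow> t \<in> T1 \<Longrightarrow> Z s t = 0"
    "rank_ge T1 Z r1" "rank_ge T2 Z r2"
  shows "rank_ge (T1 \<union> T2) Z (r1 + r2)"
proof (rule triangular_dual[OF assms])
  fix P Q
  assume PQ: "\<And>a b. a < r1 + r2 \<Longrightarrow> b < r1 + r2 \<Longrightarrow> bil (T1 \<union> T2) Z (P a) (Q b) = (if a = b then 1 else 0)"
  show ?thesis unfolding rank_ge_def by (intro exI allI impI) (rule PQ)
qed

text \<open>The vector \<open>v'\<close>, extended by zero, is projected into the kernel along the
  dual families, which are maximal by assumption. The pairs of the \<open>T2\<close> corner
  contribute nothing because \<open>v'\<close> is already in the kernel there, and the others change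
  only the \<open>T1\<close> part.\<close>

lemma triangular_kernel_lift:
  fixes Z :: "'t \<Rightarrow> 't \<Rightarrow> 'a :: field"
  assumes fin: "finite T1" "finite T2" and disj: "T1 \<inter> T2 = {}"
    and Z: "\<And>s t. s \<in> T2 \<Longrightarrow> t \<in> T1 \<Longrightarrow> Z s t = 0"
    and r: "rank_ge T1 Z r1" "rank_ge T2 Z r2" "\<not> rank_ge (T1 \<union> T2) Z (Suc (r1 + r2))"
    and v': "\<And>s. s \<in> T2 \<Longrightarrow> (\<Sum>t\<in>T2. Z s t * v' t) = 0"
  obtains v where "\<And>s. s \<in> T1 \<union> T2 \<Longrightarrow> (\<Sum>t\<in>T1 \<union> T2. Z s t * v t) = 0" "\<And>t. t \<in> T2 \<Longrightarrow> v t = v' t"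
proof (rule triangular_dual[OF fin disj Z r(1,2)])
  let ?T = "T1 \<union> T2"
  have finT: "finite ?T" using fin by simp
  fix P Q
  assume PQ: "\<And>a b. a < r1 + r2 \<Longrightarrow> b < r1 + r2 \<Longrightarrow> bil ?T Z (P a) (Q b) = (if a = b then 1 else 0)"
    and Q0: "\<And>c t. c < r1 \<Longrightarrow> t \<in> T2 \<Longrightarrow> Q c t = 0"
    and P0: "\<And>c s. r1 \<le> c \<Longrightarrow> s \<in> T1 \<Longrightarrow> P c s = 0"
  define w where "w = (\<lambda>t. if t \<in> T2 then v' t else 0)"
  define v where "v = (\<lambda>t. w t - (\<Sum>c<r1+r2. bil ?T Z (P c) w * Q c t))"
  have ker: "bil ?T Z f v = 0" for f
    unfolding v_def bil_diff_right bil_sum_right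
    using bil_maximal[where P = P and Q = Q and Z = Z, OF PQ r(3), of f w]
    by (simp add: mult.commute)
  have Pw: "bil ?T Z (P c) w = 0" if "r1 \<le> c" for c
  proof -
    have "bil ?T Z (P c) w = (\<Sum>s\<in>T2. \<Sum>t\<in>T2. P c s * Z s t * w t)"
      by (rule bil_support) (use finT P0 that in \<open>auto simp: w_def\<close>)
    also have "\<dots> = (\<Sum>s\<in>T2. P c s * (\<Sum>t\<in>T2. Z s t * v' t))"
      by (simp add: w_def sum_distrib_left mult.assoc)
    finally show ?thesis using v' by simp
  qed
  show ?thesis
  proof (rule that[of v])
    show "(\<Sum>t\<in>?T. Z s t * v t) = 0" if s: "s \<in> ?T" for s
      using ker[of "\<lambda>s'. if s' = s then 1 else 0"] bil_unit_left[OF finT s, of Z v] by simp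
    show "v t = v' t" if "t \<in> T2" for t
    proof -
      have "(\<Sum>c<r1+r2. bil ?T Z (P c) w * Q c t) = 0"
        proof (intro sum.neutral ballI)
        fix c
        show "bil ?T Z (P c) w * Q c t = 0"
        proof (cases "c < r1")
          case True
          thus ?thesis using Q0 that by simp
        next
          case False
          thus ?thesis using Pw[of c] by simp
        qed
      qed
      thus ?thesis using that by (simp add: v_def w_def)
    qed
  qed
qed

section \<open>Generic specialization of coefficients\<close>

lemma rank_ge_line:
  fixes A B :: "'t \<Rightarrow> 't \<Rightarrow> 'a :: field"
  assumes "rank_ge T A r"
  shows "finite {x. \<not> rank_ge T (\<lambda>s t. A s t + x * B s t) r}"
proof -
  obtain P Q where PQ: "\<And>a b. a < r \<Longrightarrow> b < r \<Longrightarrow> bil T A (P a) (Q b) = (if a = b then 1 else 0)"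
    using assms unfolding rank_ge_def by blast
  \<comment> \<open>The Gram matrix of the dual families along the line. It is the identity at 0, so
    its determinant is a nonzero polynomial in \<open>x\<close>; wherever that does not vanish, the
    inverse Gram matrix turns \<open>P\<close> into a dual family again.\<close>
  define MP where "MP = mat r r (\<lambda>(a, b). [:bil T A (P a) (Q b), bil T B (P a) (Q b):])"
  define MX where "MX = (\<lambda>x. mat r r (\<lambda>(a, b). bil T (\<lambda>s t. A s t + x * B s t) (P a) (Q b)))"
  have MX: "MX x \<in> carrier_mat r r" for x by (simp add: MX_def)
  have bil_line: "bil T (\<lambda>s t. A s t + x * B s t) f g = bil T A f g + x * bil T B f g" for x f g
    by (simp add: bil_def algebra_simps sum.distrib sum_distrib_left)
  have det: "poly (det MP) x = det (MX x)" for x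
    by (rule poly_det_cong[of _ r]) (auto simp: MP_def MX_def bil_line)
  have "MX 0 = 1\<^sub>m r" by (rule eq_matI) (auto simp: MX_def PQ)
  hence "poly (det MP) 0 = 1" by (simp add: det)
  hence "det MP \<noteq> 0" by auto
  hence fin: "finite {x. poly (det MP) x = 0}" by (rule poly_roots_finite)
  have "rank_ge T (\<lambda>s t. A s t + x * B s t) r" if x: "poly (det MP) x \<noteq> 0" for x
  proof -
    obtain H where H: "H \<in> carrier_mat r r" "H * MX x = 1\<^sub>m r"
      using det_non_zero_imp_unit[OF MX, of x undefined] x
      unfolding det Units_def by (auto simp: ring_mat_simps)
    show ?thesis unfolding rank_ge_def
    proof (intro exI allI impI)
      fix a b assume ab: "a < r" "b < r"
      have "bil T (\<lambda>s t. A s t + x * B s t) (\<lambda>s. \<Sum>c<r. H $$ (a, c) * P c s) (Q b)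
          = (\<Sum>c<r. H $$ (a, c) * bil T (\<lambda>s t. A s t + x * B s t) (P c) (Q b))"
        by (rule bil_sum_left)
      also have "\<dots> = (H * MX x) $$ (a, b)"
        using ab H(1) by (simp add: MX_def scalar_prod_def atLeast0LessThan)
      finally show "bil T (\<lambda>s t. A s t + x * B s t) (\<lambda>s. \<Sum>c<r. H $$ (a, c) * P c s) (Q b) = (if a = b then 1 else 0)"
        using ab by (simp add: H)
    qed
  qed
  thus ?thesis by (intro finite_subset[OF _ fin]) auto
qed

text \<open>The coefficients are moved into their sets one at a time. Each move stays on a line,
  where the rank drops below \<open>r\<close> at finitely many points only, while the set of
  admissible values is infinite.\<close>

lemma rank_ge_generic:
  fixes B :: "'j \<Rightarrow> 't \<Rightarrow> 't \<Rightarrow> 'a :: field"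
  assumes fin: "finite J" and inf: "\<And>j. j \<in> J \<Longrightarrow> infinite (S j)"
    and r: "rank_ge T (\<lambda>s t. \<Sum>j\<in>J. c j * B j s t) r"
  shows "\<exists>c'. (\<forall>j\<in>J. c' j \<in> S j) \<and> rank_ge T (\<lambda>s t. \<Sum>j\<in>J. c' j * B j s t) r"
proof -
  have "\<exists>c'. (\<forall>j\<in>K. c' j \<in> S j) \<and> rank_ge T (\<lambda>s t. \<Sum>j\<in>J. c' j * B j s t) r" if "finite K" "K \<subseteq> J" for K
    using that
  proof (induction K rule: finite_induct)
    case empty
    thus ?case using r by auto
  next
    case (insert k K)
    then obtain c' where c': "\<forall>j\<in>K. c' j \<in> S j" "rank_ge T (\<lambda>s t. \<Sum>j\<in>J. c' j * B j s t) r" by auto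
    have k: "k \<in> J" using insert by simp
    define Sk where "Sk = (\<lambda>y. y - c' k) ` S k"
    define Bad where "Bad = {x. \<not> rank_ge T (\<lambda>s t. (\<Sum>j\<in>J. c' j * B j s t) + x * B k s t) r}"
    have "inj_on (\<lambda>y. y - c' k) (S k)" by (rule inj_onI) simp
    hence "infinite Sk" unfolding Sk_def using inf[OF k] finite_imageD by blast
    moreover have "finite Bad" unfolding Bad_def by (rule rank_ge_line[OF c'(2)])
    ultimately obtain x where "x \<in> Sk" "x \<notin> Bad" by (meson finite_subset subsetI)
    hence x: "x \<in> (\<lambda>y. y - c' k) ` S k"
      "rank_ge T (\<lambda>s t. (\<Sum>j\<in>J. c' j * B j s t) + x * B k s t) r"
      by (simp_all add: Sk_def Bad_def)
    have "(\<Sum>j\<in>J. c' j * B j s t) + x * B k s t = (\<Sum>j\<in>J. (c'(k := c' k + x)) j * B j s t)" for s t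
      using sum.remove[OF fin k, of "\<lambda>j. c' j * B j s t"]
        sum.remove[OF fin k, of "\<lambda>j. (c'(k := c' k + x)) j * B j s t"]
      by (simp add: algebra_simps)
    with x have "rank_ge T (\<lambda>s t. \<Sum>j\<in>J. (c'(k := c' k + x)) j * B j s t) r" by simp
    moreover have "\<forall>j\<in>insert k K. (c'(k := c' k + x)) j \<in> S j" using c'(1) x(1) by auto
    ultimately show ?case by blast
  qed
  from this[OF fin] show ?thesis by blast
qed

section \<open>Blow-ups of linear pencils\<close>

text \<open>The Kronecker sum of the \<open>M x\<close> with the \<open>V x\<close>. The size is not
  part of the point: it is fixed by the index set \<open>I \<times> {..<N}\<close> over which ranks
  are taken, so points of different sizes have one type.\<close>

definition blow ::
  "('x :: finite \<Rightarrow> 'i \<Rightarrow> 'i \<Rightarrow> 'k :: comm_ring_1) \<Rightarrow> ('x \<Rightarrow> nat \<Rightarrow> nat \<Rightarrow> 'k) \<Rightarrow> 'i \<times> nat \<Rightarrow> 'i \<times> nat \<Rightarrow> 'k" where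
  "blow M V s t = (\<Sum>x\<in>UNIV. M x (fst s) (fst t) * V x (snd s) (snd t))"

lemma blow_apply:
  "(\<Sum>t\<in>I \<times> A. blow M V (i, p) t * y t) = (\<Sum>q\<in>A. \<Sum>x\<in>UNIV. V x p q * (\<Sum>j\<in>I. M x i j * y (j, q)))"
proof -
  have "(\<Sum>t\<in>I \<times> A. blow M V (i, p) t * y t) = (\<Sum>j\<in>I. \<Sum>q\<in>A. blow M V (i, p) (j, q) * y (j, q))"
    by (simp add: sum.cartesian_product)
  also have "\<dots> = (\<Sum>q\<in>A. \<Sum>j\<in>I. \<Sum>x\<in>UNIV. V x p q * (M x i j * y (j, q)))"
    by (subst sum.swap) (simp add: blow_def sum_distrib_left sum_distrib_right mult_ac)
  also have "\<dots> = (\<Sum>q\<in>A. \<Sum>x\<in>UNIV. \<Sum>j\<in>I. V x p q * (M x i j * y (j, q)))"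
    by (intro sum.cong refl sum.swap)
  finally show ?thesis by (simp add: sum_distrib_left)
qed

lemma rank_ge_reindex:
  assumes f: "bij_betw f T' T" and Z: "\<And>s t. s \<in> T' \<Longrightarrow> t \<in> T' \<Longrightarrow> Z' s t = Z (f s) (f t)"
    and r: "rank_ge T Z r"
  shows "rank_ge T' Z' r"
proof -
  have "bil T' Z' (g \<circ> f) (h \<circ> f) = bil T Z g h" for g h
  proof -
    have "bil T' Z' (g \<circ> f) (h \<circ> f) = (\<Sum>s\<in>T'. \<Sum>t\<in>T'. g (f s) * Z (f s) (f t) * h (f t))"
      unfolding bil_def by (intro sum.cong refl) (simp add: Z)
    also have "\<dots> = (\<Sum>s\<in>T'. \<Sum>t\<in>T. g (f s) * Z (f s) t * h t)"
      by (intro sum.cong refl sum.reindex_bij_betw[OF f])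
    also have "\<dots> = bil T Z g h" unfolding bil_def by (rule sum.reindex_bij_betw[OF f])
    finally show ?thesis .
  qed
  moreover obtain P Q where "\<forall>a<r. \<forall>b<r. bil T Z (P a) (Q b) = (if a = b then 1 else 0)"
    using r unfolding rank_ge_def by blast
  ultimately show ?thesis unfolding rank_ge_def
    by (intro exI[of _ "\<lambda>a. P a \<circ> f"] exI[of _ "\<lambda>a. Q a \<circ> f"]) simp
qed

section \<open>Block triangular points\<close>

definition tri :: "nat \<Rightarrow> ('x \<Rightarrow> nat \<Rightarrow> nat \<Rightarrow> 'k :: comm_ring_1) \<Rightarrow> ('x \<Rightarrow> nat \<Rightarrow> nat \<Rightarrow> 'k) \<Rightarrow>
    ('x \<Rightarrow> nat \<Rightarrow> nat \<Rightarrow> 'k) \<Rightarrow> 'x \<Rightarrow> nat \<Rightarrow> nat \<Rightarrow> 'k" where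
  "tri N V Y V' x p q =
     (if p < N then (if q < N then V x p q else Y x p (q - N)) else (if q < N then 0 else V' x (p - N) (q - N)))"

lemma blow_tri:
  shows "p < N \<Longrightarrow> q < N \<Longrightarrow> blow M (tri N V Y V') (i, p) (j, q) = blow M V (i, p) (j, q)"
    and "p < N \<Longrightarrow> N \<le> q \<Longrightarrow> blow M (tri N V Y V') (i, p) (j, q) = blow M Y (i, p) (j, q - N)"
    and "N \<le> p \<Longrightarrow> q < N \<Longrightarrow> blow M (tri N V Y V') (i, p) (j, q) = 0"
    and "N \<le> p \<Longrightarrow> N \<le> q \<Longrightarrow> blow M (tri N V Y V') (i, p) (j, q) = blow M V' (i, p - N) (j, q - N)"
  by (simp_all add: blow_def tri_def)

lemma bij_shift: "bij_betw (\<lambda>(i, p). (i, p - N)) (I \<times> {N..<N + N'}) (I \<times> {..<(N' :: nat)})"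
  by (rule bij_betw_byWitness[where f' = "\<lambda>(i, p). (i, p + N)"]) auto

lemma split_index: "I \<times> {..<N + N'} = I \<times> {..<N} \<union> I \<times> {N..<N + (N' :: nat)}"
  by auto

lemma tri_blocks:
  fixes M :: "'x :: finite \<Rightarrow> 'i \<Rightarrow> 'i \<Rightarrow> 'k :: field"
  assumes r: "rank_ge (I \<times> {..<N}) (blow M V) r" "rank_ge (I \<times> {..<N'}) (blow M V') r'"
  shows "rank_ge (I \<times> {..<N}) (blow M (tri N V Y V')) r"
    and "rank_ge (I \<times> {N..<N + N'}) (blow M (tri N V Y V')) r'"
proof -
  show "rank_ge (I \<times> {..<N}) (blow M (tri N V Y V')) r"
    using r(1) by (rule rank_ge_cong[THEN iffD1, rotated]) (auto simp: blow_tri)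
  show "rank_ge (I \<times> {N..<N + N'}) (blow M (tri N V Y V')) r'"
    by (rule rank_ge_reindex[OF bij_shift _ r(2)]) (auto simp: blow_tri)
qed

lemma rank_ge_tri:
  fixes M :: "'x :: finite \<Rightarrow> 'i \<Rightarrow> 'i \<Rightarrow> 'k :: field"
  assumes fin: "finite I"
    and r: "rank_ge (I \<times> {..<N}) (blow M V) r" "rank_ge (I \<times> {..<N'}) (blow M V') r'"
  shows "rank_ge (I \<times> {..<N + N'}) (blow M (tri N V Y V')) (r + r')"
  unfolding split_index
  by (rule rank_ge_triangular[OF _ _ _ _ tri_blocks[OF r]]) (use fin in \<open>auto simp: blow_tri\<close>)

text \<open>The second conclusion reads off the top rows of the kernel equation. The corner
  \<open>Y\<close> is free, so the image of a kernel vector under any choice of \<open>Y\<close>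
  lies in the image of the blow-up at \<open>V\<close>.\<close>

lemma kernel_tri_lift:
  fixes M :: "'x :: finite \<Rightarrow> 'i \<Rightarrow> 'i \<Rightarrow> 'k :: field"
  assumes fin: "finite I"
    and r: "rank_ge (I \<times> {..<N}) (blow M V) r" "rank_ge (I \<times> {..<N'}) (blow M V') r'"
    and max: "\<not> rank_ge (I \<times> {..<N + N'}) (blow M (tri N V Y V')) (Suc (r + r'))"
    and v': "\<And>s. s \<in> I \<times> {..<N'} \<Longrightarrow> (\<Sum>t\<in>I \<times> {..<N'}. blow M V' s t * v' t) = 0"
  obtains w where
    "\<And>s. s \<in> I \<times> {..<N + N'} \<Longrightarrow> (\<Sum>t\<in>I \<times> {..<N + N'}. blow M (tri N V Y V') s t * w t) = 0"
    "\<And>s. s \<in> I \<times> {..<N} \<Longrightarrow> (\<Sum>t\<in>I \<times> {..<N}. blow M V s t * w t) = - (\<Sum>t\<in>I \<times> {..<N'}. blow M Y s t * v' t)"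
proof -
  let ?Z = "blow M (tri N V Y V')"
  let ?f = "\<lambda>(i, p). (i, p - N)"
  have v0: "(\<Sum>t\<in>I \<times> {N..<N + N'}. ?Z s t * v' (?f t)) = 0" if s: "s \<in> I \<times> {N..<N + N'}" for s
  proof -
    have "(\<Sum>t\<in>I \<times> {N..<N + N'}. ?Z s t * v' (?f t)) = (\<Sum>t\<in>I \<times> {N..<N + N'}. blow M V' (?f s) (?f t) * v' (?f t))"
      by (intro sum.cong refl) (use s in \<open>auto simp: blow_tri\<close>)
    also have "\<dots> = (\<Sum>t\<in>I \<times> {..<N'}. blow M V' (?f s) t * v' t)"
      by (rule sum.reindex_bij_betw[OF bij_shift])
    also have "\<dots> = 0" by (rule v') (use s in auto)
    finally show ?thesis .
  qed
  have fins: "finite (I \<times> {..<N})" "finite (I \<times> {N..<N + N'})" using fin by auto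
  have disj: "I \<times> {..<N} \<inter> I \<times> {N..<N + N'} = {}" by auto
  have Z0: "?Z s t = 0" if "s \<in> I \<times> {N..<N + N'}" "t \<in> I \<times> {..<N}" for s t
    using that by (auto simp: blow_tri)
  show ?thesis
  proof (rule triangular_kernel_lift[OF fins disj Z0 tri_blocks[OF r] max[unfolded split_index] v0])
  fix w
  assume w: "\<And>s. s \<in> I \<times> {..<N} \<union> I \<times> {N..<N + N'} \<Longrightarrow>
        (\<Sum>t\<in>I \<times> {..<N} \<union> I \<times> {N..<N + N'}. ?Z s t * w t) = 0"
      "\<And>t. t \<in> I \<times> {N..<N + N'} \<Longrightarrow> w t = v' (?f t)"
  show ?thesis
  proof (rule that[of w])
    show "(\<Sum>t\<in>I \<times> {..<N + N'}. ?Z s t * w t) = 0" if "s \<in> I \<times> {..<N + N'}" for s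
      using w(1) that unfolding split_index .
    fix s assume s: "s \<in> I \<times> {..<N}"
    have "0 = (\<Sum>t\<in>I \<times> {..<N} \<union> I \<times> {N..<N + N'}. ?Z s t * w t)"
      using w(1)[of s] s by simp
    also have "\<dots> = (\<Sum>t\<in>I \<times> {..<N}. ?Z s t * w t) + (\<Sum>t\<in>I \<times> {N..<N + N'}. ?Z s t * w t)"
      by (rule sum.union_disjoint[OF fins disj])
    also have "(\<Sum>t\<in>I \<times> {..<N}. ?Z s t * w t) = (\<Sum>t\<in>I \<times> {..<N}. blow M V s t * w t)"
      by (intro sum.cong refl) (use s in \<open>auto simp: blow_tri\<close>)
    also have "(\<Sum>t\<in>I \<times> {N..<N + N'}. ?Z s t * w t) = (\<Sum>t\<in>I \<times> {N..<N + N'}. blow M Y s (?f t) * v' (?f t))"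
      by (intro sum.cong refl) (use s w(2) in \<open>auto simp: blow_tri\<close>)
    also have "\<dots> = (\<Sum>t\<in>I \<times> {..<N'}. blow M Y s t * v' t)"
      by (rule sum.reindex_bij_betw[OF bij_shift])
    finally show "(\<Sum>t\<in>I \<times> {..<N}. blow M V s t * w t) = - (\<Sum>t\<in>I \<times> {..<N'}. blow M Y s t * v' t)"
      by (simp add: eq_neg_iff_add_eq_0)
  qed
  qed
qed

text \<open>The subspace is the span of all components of kernel vectors at all points of maximal
  rank. The blow-up at \<open>V0\<close> maps vectors with components in this span onto all vectors
  with components in its image under the pencil, and it has a nonzero kernel there; counting
  dimensions, the image is strictly smaller.\<close>

theorem shrunk_subspace:
  fixes M :: "'x :: finite \<Rightarrow> 'i \<Rightarrow> 'i \<Rightarrow> 'k :: field"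
  assumes fin: "finite I"
    and bound: "\<And>N V r. rank_ge (I \<times> {..<N}) (blow M V) r \<Longrightarrow> r \<le> h * N"
    and N0: "N0 > 0" and V0: "rank_ge (I \<times> {..<N0}) (blow M V0) (h * N0)" and h: "h < card I"
  obtains S :: "'i \<Rightarrow> nat \<Rightarrow> 'k" and S' u R A where "0 < u" "u \<le> card I"
    "\<And>i i'. i \<in> I \<Longrightarrow> i' \<in> I \<Longrightarrow> (\<Sum>a<card I. S i a * S' a i') = (if i = i' then 1 else 0)"
    "\<And>x i a. i \<in> I \<Longrightarrow> a < u \<Longrightarrow> (\<Sum>j\<in>I. M x i j * S j a) = (\<Sum>l<u - 1. R i l * A x l a)"
proof -
  define crit where "crit = (\<lambda>N V. rank_ge (I \<times> {..<N}) (blow M V) (h * N))"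
  define ker where "ker = (\<lambda>N V v. \<forall>s\<in>I \<times> {..<N}. (\<Sum>t\<in>I \<times> {..<N}. blow M V s t * v t) = 0)"
  \<comment> \<open>All sizes \<open>N\<close> are needed: lifting a kernel vector enlarges the
    size, and the components of the lift must belong to \<open>G\<close> again.\<close>
  define G where "G = {(\<lambda>i. v (i, q)) | N V v q. q < N \<and> crit N V \<and> ker N V v}"
  have notmore: "\<not> rank_ge (I \<times> {..<N}) (blow M V) (Suc (h * N))" for N V
    using bound[of N V "Suc (h * N)"] by auto
  have crit_tri: "crit (N + N') (tri N V Y V')" if "crit N V" "crit N' V'" for N N' V Y V'
    using rank_ge_tri[OF fin that[unfolded crit_def]] by (simp add: crit_def algebra_simps)
  \<comment> \<open>\<open>reach p f\<close>: the vector with component \<open>f\<close> at \<open>p\<close> has a preimage under the critical point \<open>V0\<close>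
    whose components lie in the span of \<open>G\<close>.\<close>
  define reach where "reach = (\<lambda>p f. \<exists>y. (\<forall>q<N0. (\<lambda>i. y (i, q)) \<in> lspan G) \<and>
      (\<forall>i\<in>I. \<forall>p'<N0. (\<Sum>t\<in>I \<times> {..<N0}. blow M V0 (i, p') t * y t) = (if p' = p then f i else 0)))"
  have reach_0: "reach p (\<lambda>i. 0)" for p
    unfolding reach_def by (intro exI[of _ "\<lambda>_. 0"]) (simp add: lspan.zero)
  have reach_comb: "reach p (\<lambda>i. f i + c * g i)" if fg: "reach p f" "reach p g" for p f g c
  proof -
    obtain y where y: "\<forall>q<N0. (\<lambda>i. y (i, q)) \<in> lspan G"
      "\<forall>i\<in>I. \<forall>p'<N0. (\<Sum>t\<in>I \<times> {..<N0}. blow M V0 (i, p') t * y t) = (if p' = p then f i else 0)"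
      using fg(1) unfolding reach_def by blast
    obtain z where z: "\<forall>q<N0. (\<lambda>i. z (i, q)) \<in> lspan G"
      "\<forall>i\<in>I. \<forall>p'<N0. (\<Sum>t\<in>I \<times> {..<N0}. blow M V0 (i, p') t * z t) = (if p' = p then g i else 0)"
      using fg(2) unfolding reach_def by blast
    have "(\<Sum>t\<in>I \<times> {..<N0}. blow M V0 s t * (y t + c * z t)) =
       (\<Sum>t\<in>I \<times> {..<N0}. blow M V0 s t * y t) + c * (\<Sum>t\<in>I \<times> {..<N0}. blow M V0 s t * z t)" for s
      by (simp add: algebra_simps sum.distrib sum_distrib_left)
    hence "\<forall>i\<in>I. \<forall>p'<N0. (\<Sum>t\<in>I \<times> {..<N0}. blow M V0 (i, p') t * (y t + c * z t)) =
        (if p' = p then f i + c * g i else 0)"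
      using y(2) z(2) by simp
    moreover have "\<forall>q<N0. (\<lambda>i. y (i, q) + c * z (i, q)) \<in> lspan G"
      using y(1) z(1) by (intro allI impI lspan.comb) auto
    ultimately show ?thesis unfolding reach_def by (intro exI[of _ "\<lambda>t. y t + c * z t"] conjI)
  qed
  have reach_G: "reach p (\<lambda>i. \<Sum>j\<in>I. M x i j * g j)" if g: "g \<in> G" and p: "p < N0" for g x p
  proof -
    obtain N' V' v' q where v': "g = (\<lambda>i. v' (i, q))" "q < N'" "crit N' V'" "ker N' V' v'"
      using g unfolding G_def by blast
    \<comment> \<open>The matrix unit at \<open>(p, q)\<close> in the variable \<open>x\<close>: it
      sends \<open>v'\<close> to the vector whose component at \<open>p\<close> is the coefficient
      matrix of \<open>x\<close> applied to \<open>g\<close>.\<close>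
    define Y where "Y = (\<lambda>x' p' q'. if x' = x \<and> p' = p \<and> q' = q then 1 else 0 :: 'k)"
    let ?Z = "tri N0 V0 Y V'"
    obtain w where w: "\<And>s. s \<in> I \<times> {..<N0 + N'} \<Longrightarrow> (\<Sum>t\<in>I \<times> {..<N0 + N'}. blow M ?Z s t * w t) = 0"
      "\<And>s. s \<in> I \<times> {..<N0} \<Longrightarrow> (\<Sum>t\<in>I \<times> {..<N0}. blow M V0 s t * w t) = - (\<Sum>t\<in>I \<times> {..<N'}. blow M Y s t * v' t)"
    proof (rule kernel_tri_lift[OF fin V0 v'(3)[unfolded crit_def]])
      show "\<not> rank_ge (I \<times> {..<N0 + N'}) (blow M ?Z) (Suc (h * N0 + h * N'))"
        using notmore[of "N0 + N'"] by (simp add: algebra_simps)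
    qed (use v'(4) in \<open>auto simp: ker_def\<close>)
    have wG: "(\<lambda>i. w (i, q')) \<in> G" if "q' < N0" for q'
    proof -
      have "crit (N0 + N') ?Z" by (rule crit_tri) (use V0 v'(3) in \<open>auto simp: crit_def\<close>)
      moreover have "ker (N0 + N') ?Z w" using w(1) unfolding ker_def by blast
      moreover have "q' < N0 + N'" using that by simp
      ultimately show ?thesis unfolding G_def by blast
    qed
    have Yv: "(\<Sum>t\<in>I \<times> {..<N'}. blow M Y (i, p') t * v' t) = (if p' = p then \<Sum>j\<in>I. M x i j * g j else 0)" for i p'
    proof -
      have "(\<Sum>x'\<in>UNIV. Y x' p' q' * (\<Sum>j\<in>I. M x' i j * v' (j, q'))) =
          (if q' = q then if p' = p then \<Sum>j\<in>I. M x i j * v' (j, q) else 0 else 0)" for q'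
      proof -
        have "Y x' p' q' * (\<Sum>j\<in>I. M x' i j * v' (j, q')) =
          (if x' = x then if p' = p \<and> q' = q then \<Sum>j\<in>I. M x i j * v' (j, q) else 0 else 0)" for x'
          by (auto simp: Y_def)
        thus ?thesis by simp
      qed
      thus ?thesis unfolding blow_apply using v'(1,2) by simp
    qed
    show ?thesis unfolding reach_def
    proof (intro exI[of _ "\<lambda>t. - w t"] conjI allI impI ballI)
      show "(\<lambda>i. - w (i, q')) \<in> lspan G" if "q' < N0" for q'
        using lspan.comb[OF lspan.zero lspan.gen[OF wG[OF that]], of "-1"] by simp
      show "(\<Sum>t\<in>I \<times> {..<N0}. blow M V0 (i, p') t * - w t) = (if p' = p then \<Sum>j\<in>I. M x i j * g j else 0)"
        if "i \<in> I" "p' < N0" for i p'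
        using w(2)[of "(i, p')"] that Yv by (simp add: sum_negf)
    qed
  qed
  have reach_span: "reach p (\<lambda>i. \<Sum>j\<in>I. M x i j * g j)" if g: "g \<in> lspan G" and p: "p < N0" for g x p
    using g
  proof induction
    case zero
    thus ?case using reach_0 by simp
  next
    case (gen g)
    thus ?case using reach_G p by blast
  next
    case (comb v w c)
    have "(\<lambda>i. \<Sum>j\<in>I. M x i j * (v j + c * w j)) = (\<lambda>i. (\<Sum>j\<in>I. M x i j * v j) + c * (\<Sum>j\<in>I. M x i j * w j))"
      by (simp add: fun_eq_iff algebra_simps sum.distrib sum_distrib_left)
    thus ?case using reach_comb[OF comb.IH] by simp
  qed
  show ?thesis
  proof (rule adapted_basis[OF fin, of G])
  fix S S' u
  assume S: "u \<le> card I"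
    "\<And>i i'. i \<in> I \<Longrightarrow> i' \<in> I \<Longrightarrow> (\<Sum>a<card I. S i a * S' a i') = (if i = i' then 1 else 0)"
    "\<And>a. a < u \<Longrightarrow> (\<lambda>i. S i a) \<in> lspan G"
    "\<And>v i. v \<in> lspan G \<Longrightarrow> i \<in> I \<Longrightarrow> v i = (\<Sum>a<u. S i a * (\<Sum>j\<in>I. S' a j * v j))"
  define MS where "MS = (\<lambda>x i a. \<Sum>j\<in>I. M x i j * S j a)"
  \<comment> \<open>The images of the first \<open>u\<close> basis vectors under all coefficient
    matrices; \<open>w\<close> will be the dimension of their span.\<close>
  define W where "W = {(\<lambda>i. MS x i a) | x a. a < u}"
  show ?thesis
  proof (rule adapted_basis[OF fin, of W])
  fix R R' w
  assume R: "w \<le> card I"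
    "\<And>a b. a < card I \<Longrightarrow> b < card I \<Longrightarrow> (\<Sum>i\<in>I. R' a i * R i b) = (if a = b then 1 else 0)"
    "\<And>a. a < w \<Longrightarrow> (\<lambda>i. R i a) \<in> lspan W"
    "\<And>v i. v \<in> lspan W \<Longrightarrow> i \<in> I \<Longrightarrow> v i = (\<Sum>a<w. R i a * (\<Sum>j\<in>I. R' a j * v j))"
  define A where "A = (\<lambda>x l a. \<Sum>i\<in>I. R' l i * MS x i a)"
  have MS: "MS x i a = (\<Sum>l<w. R i l * A x l a)" if "i \<in> I" "a < u" for x i a
    using R(4)[OF lspan.gen, of "\<lambda>i. MS x i a" i] that by (auto simp: A_def W_def)
  have reach_W: "reach p f" if "f \<in> lspan W" "p < N0" for f p
    using that(1)
  proof induction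
    case (gen f)
    thus ?case using reach_span[OF S(3) that(2)] unfolding W_def MS_def by blast
  qed (auto intro: reach_0 reach_comb)
  \<comment> \<open>The blow-up at \<open>V0\<close> in adapted coordinates, from
    \<open>u * N0\<close> to \<open>w * N0\<close> dimensions: it takes the
    \<open>S'\<close>-coordinates of a vector with components in the span of \<open>G\<close> to the
    \<open>R'\<close>-coordinates of its image.\<close>
  define AA where "AA = (\<lambda>(l, p) (a, q). \<Sum>x\<in>UNIV. A x l a * V0 x p q)"
  have star: "(\<Sum>i\<in>I. R' l i * (\<Sum>t\<in>I \<times> {..<N0}. blow M V0 (i, p) t * y t)) =
     (\<Sum>t\<in>{..<u} \<times> {..<N0}. AA (l, p) t * (\<Sum>j\<in>I. S' (fst t) j * y (j, snd t)))"
    if y: "\<And>q. q < N0 \<Longrightarrow> (\<lambda>i. y (i, q)) \<in> lspan G" for l p y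
  proof -
    define c where "c = (\<lambda>a q. \<Sum>j\<in>I. S' a j * y (j, q))"
    have My: "(\<Sum>j\<in>I. M x i j * y (j, q)) = (\<Sum>a<u. MS x i a * c a q)" if "q < N0" for x i q
    proof -
      have "(\<Sum>j\<in>I. M x i j * y (j, q)) = (\<Sum>j\<in>I. M x i j * (\<Sum>a<u. S j a * c a q))"
        using S(4)[OF y[OF that]] by (intro sum.cong) (auto simp: c_def)
      also have "\<dots> = (\<Sum>a<u. MS x i a * c a q)"
        unfolding MS_def sum_distrib_left sum_distrib_right mult.assoc by (rule sum.swap)
      finally show ?thesis .
    qed
    have "(\<Sum>i\<in>I. R' l i * (\<Sum>t\<in>I \<times> {..<N0}. blow M V0 (i, p) t * y t)) =
        (\<Sum>i\<in>I. \<Sum>q<N0. R' l i * (\<Sum>x\<in>UNIV. V0 x p q * (\<Sum>a<u. MS x i a * c a q)))"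
      unfolding blow_apply
      by (rule sum.cong[OF refl], subst sum_distrib_left, rule sum.cong[OF refl]) (simp add: My)
    also have "\<dots> = (\<Sum>q<N0. \<Sum>x\<in>UNIV. \<Sum>i\<in>I. R' l i * (V0 x p q * (\<Sum>a<u. MS x i a * c a q)))"
      unfolding sum_distrib_left by (subst sum.swap) (intro sum.cong refl sum.swap)
    also have "\<dots> = (\<Sum>q<N0. \<Sum>x\<in>UNIV. \<Sum>a<u. A x l a * V0 x p q * c a q)"
    proof (intro sum.cong refl)
      fix q x
      have "(\<Sum>i\<in>I. R' l i * (V0 x p q * (\<Sum>a<u. MS x i a * c a q))) =
          (\<Sum>i\<in>I. \<Sum>a<u. R' l i * MS x i a * V0 x p q * c a q)"
        by (simp add: sum_distrib_left mult_ac)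
      also have "\<dots> = (\<Sum>a<u. A x l a * V0 x p q * c a q)"
        by (subst sum.swap) (simp add: A_def sum_distrib_right)
      finally show "(\<Sum>i\<in>I. R' l i * (V0 x p q * (\<Sum>a<u. MS x i a * c a q))) = (\<Sum>a<u. A x l a * V0 x p q * c a q)" .
    qed
    also have "\<dots> = (\<Sum>q<N0. \<Sum>a<u. AA (l, p) (a, q) * c a q)"
      by (simp add: AA_def sum_distrib_right) (intro sum.cong refl sum.swap)
    also have "\<dots> = (\<Sum>a<u. \<Sum>q<N0. AA (l, p) (a, q) * c a q)" by (rule sum.swap)
    also have "\<dots> = (\<Sum>t\<in>{..<u} \<times> {..<N0}. AA (l, p) t * c (fst t) (snd t))"
      by (simp add: sum.cartesian_product case_prod_beta)
    finally show ?thesis by (simp add: c_def)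
  qed
  define hits where "hits = (\<lambda>l p y. (\<forall>q<N0. (\<lambda>i. y (i, q)) \<in> lspan G) \<and>
      (\<forall>i\<in>I. \<forall>p'<N0. (\<Sum>t\<in>I \<times> {..<N0}. blow M V0 (i, p') t * y t) = (if p' = p then R i l else 0)))"
  define y where "y = (\<lambda>l p. SOME y. hits l p y)"
  have hits: "hits l p (y l p)" if "l < w" "p < N0" for l p
  proof -
    have "reach p (\<lambda>i. R i l)" by (rule reach_W[OF R(3)[OF that(1)] that(2)])
    hence "\<exists>y. hits l p y" unfolding reach_def hits_def .
    thus ?thesis unfolding y_def by (rule someI_ex)
  qed
  have y: "\<And>l p q. l < w \<Longrightarrow> p < N0 \<Longrightarrow> q < N0 \<Longrightarrow> (\<lambda>i. y l p (i, q)) \<in> lspan G"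
    "\<And>l p p' i. l < w \<Longrightarrow> p < N0 \<Longrightarrow> p' < N0 \<Longrightarrow> i \<in> I \<Longrightarrow>
       (\<Sum>t\<in>I \<times> {..<N0}. blow M V0 (i, p') t * y l p t) = (if p' = p then R i l else 0)"
    using hits unfolding hits_def by blast+
  define C where "C = (\<lambda>t s. \<Sum>j\<in>I. S' (fst t) j * y (fst s) (snd s) (j, snd t))"
  have AC: "(\<Sum>t\<in>{..<u} \<times> {..<N0}. AA s t * C t s') = (if s = s' then 1 else 0)"
    if ss: "s \<in> {..<w} \<times> {..<N0}" "s' \<in> {..<w} \<times> {..<N0}" for s s'
  proof -
    obtain l p where s1: "s = (l, p)" "l < w" "p < N0" using ss(1) by (cases s) auto
    obtain l' p' where s2: "s' = (l', p')" "l' < w" "p' < N0" using ss(2) by (cases s') auto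
    note s = s1(1) s2(1) s1(2,3) s2(2,3)
    have "(\<Sum>t\<in>{..<u} \<times> {..<N0}. AA s t * C t s') =
        (\<Sum>i\<in>I. R' l i * (\<Sum>t\<in>I \<times> {..<N0}. blow M V0 (i, p) t * y l' p' t))"
      unfolding C_def s(1,2) fst_conv snd_conv by (rule star[symmetric]) (use y s in auto)
    also have "\<dots> = (\<Sum>i\<in>I. R' l i * (if p = p' then R i l' else 0))"
      by (intro sum.cong refl) (use y s in auto)
    also have "\<dots> = (if s = s' then 1 else 0)" using R(2)[of l l'] R(1) s by (cases "p = p'") auto
    finally show ?thesis .
  qed
  \<comment> \<open>Every basis vector of the image is reached at every position, so
    \<open>AA\<close> has the right inverse \<open>C\<close>.\<close>
  have "card ({..<w} \<times> {..<N0}) \<le> card ({..<u} \<times> {..<N0})"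
    by (rule card_le_of_right_inverse[where A = AA and B = C]) (use AC in auto)
  hence wu: "w \<le> u" using N0 by (simp add: card_cartesian_product)
  \<comment> \<open>For \<open>w = u\<close> the matrix \<open>AA\<close> would be invertible. But
    \<open>h < card I\<close> gives the blow-up at \<open>V0\<close> a nonzero kernel vector, and
    its components lie in \<open>G\<close>.\<close>
  have "w \<noteq> u"
  proof
    assume wu: "w = u"
    have CA: "(\<Sum>t\<in>{..<w} \<times> {..<N0}. C s t * AA t s') = (if s = s' then 1 else 0)"
      if "s \<in> {..<u} \<times> {..<N0}" "s' \<in> {..<u} \<times> {..<N0}" for s s'
      by (rule stably_finite_index[OF field_stably_finite _ _ _ AC that]) (auto simp: wu)
    have "h * N0 < card (I \<times> {..<N0})" using h N0 by (simp add: card_cartesian_product)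
    then obtain v t0 where v: "\<And>s. s \<in> I \<times> {..<N0} \<Longrightarrow> (\<Sum>t\<in>I \<times> {..<N0}. blow M V0 s t * v t) = 0"
        "t0 \<in> I \<times> {..<N0}" "v t0 \<noteq> 0"
      using kernel_nonzero[OF _ V0 notmore] fin by auto
    have vG: "(\<lambda>i. v (i, q)) \<in> lspan G" if "q < N0" for q
    proof (rule lspan.gen)
      have "crit N0 V0" using V0 by (simp add: crit_def)
      moreover have "ker N0 V0 v" using v(1) unfolding ker_def by blast
      ultimately show "(\<lambda>i. v (i, q)) \<in> G" using that unfolding G_def by blast
    qed
    define c where "c = (\<lambda>t. \<Sum>j\<in>I. S' (fst t) j * v (j, snd t))"
    have Ac: "(\<Sum>t\<in>{..<u} \<times> {..<N0}. AA s t * c t) = 0" if ss: "s \<in> {..<w} \<times> {..<N0}" for s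
    proof -
      obtain l p where s: "s = (l, p)" "p < N0" using ss by (cases s) auto
      show ?thesis unfolding c_def s(1) by (subst star[symmetric]) (use vG v(1) s(2) in auto)
    qed
    have c0: "c s = 0" if s: "s \<in> {..<u} \<times> {..<N0}" for s
    proof -
      have "c s = (\<Sum>s'\<in>{..<u} \<times> {..<N0}. (if s = s' then 1 else 0) * c s')"
        using s by (simp add: if_distrib[of "\<lambda>x. x * _"] cong: if_cong)
      also have "\<dots> = (\<Sum>s'\<in>{..<u} \<times> {..<N0}. (\<Sum>t\<in>{..<w} \<times> {..<N0}. C s t * AA t s') * c s')"
        by (rule sum.cong[OF refl]) (simp add: CA s)
      also have "\<dots> = (\<Sum>t\<in>{..<w} \<times> {..<N0}. C s t * (\<Sum>s'\<in>{..<u} \<times> {..<N0}. AA t s' * c s'))"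
        unfolding sum_distrib_left sum_distrib_right mult.assoc by (rule sum.swap)
      also have "\<dots> = 0" using Ac by (intro sum.neutral) auto
      finally show ?thesis .
    qed
    have "v (i, q) = 0" if "i \<in> I" "q < N0" for i q
      using S(4)[OF vG[OF that(2)] that(1)] c0[of "(_, q)"] that(2) by (auto simp: c_def)
    with v(2,3) show False by auto
  qed
  with wu have wu: "w < u" by simp
  show ?thesis
  \<comment> \<open>Only \<open>w < u\<close> rows of \<open>A\<close> matter; zero rows fill it up
    to the number \<open>u - 1\<close> of the claim.\<close>
  proof (rule that[of u S S' R "\<lambda>x l a. if l < w then A x l a else 0"])
    show "(\<Sum>j\<in>I. M x i j * S j a) = (\<Sum>l<u - 1. R i l * (if l < w then A x l a else 0))"
      if "i \<in> I" "a < u" for x i a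
    proof -
      have "(\<Sum>l<u - 1. R i l * (if l < w then A x l a else 0)) = (\<Sum>l<w. R i l * A x l a)"
        using wu by (intro sum.mono_neutral_cong_right) auto
      thus ?thesis using MS[OF that] by (simp add: MS_def)
    qed
  qed (use wu S in auto)
  qed
  qed
qed

section \<open>Block matrices over a division ring of matrices\<close>

text \<open>A division ring of matrices of size \<open>N\<close>, given as a predicate on functions;
  \<open>D_cong\<close> makes entries beyond \<open>N\<close> irrelevant. A left inverse is required
  because the elimination below normalizes a pivot block from the left.\<close>

locale division_blocks =
  fixes N :: nat and D :: "(nat \<Rightarrow> nat \<Rightarrow> 'f :: field) \<Rightarrow> bool"
  assumes N: "N > 0"
    and D_cong: "\<And>a b. D a \<Longrightarrow> (\<And>p q. p < N \<Longrightarrow> q < N \<Longrightarrow> a p q = b p q) \<Longrightarrow> D b"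
    and D_diff: "\<And>a b. D a \<Longrightarrow> D b \<Longrightarrow> D (\<lambda>p q. a p q - b p q)"
    and D_mult: "\<And>a b. D a \<Longrightarrow> D b \<Longrightarrow> D (\<lambda>p q. \<Sum>k<N. a p k * b k q)"
    and D_one: "D (\<lambda>p q. if p = q then 1 else 0)"
    and D_inverse: "\<And>a p q. D a \<Longrightarrow> p < N \<Longrightarrow> q < N \<Longrightarrow> a p q \<noteq> 0 \<Longrightarrow>
      \<exists>b. D b \<and> (\<forall>p<N. \<forall>q<N. (\<Sum>k<N. b p k * a k q) = (if p = q then 1 else 0))"
begin

lemma D_zero: "D (\<lambda>p q. 0)"
  using D_diff[OF D_one D_one] by simp

lemma D_add: "D a \<Longrightarrow> D b \<Longrightarrow> D (\<lambda>p q. a p q + b p q)"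
  using D_diff[OF _ D_diff[OF D_zero], of a b] by simp

lemma D_sum:
  assumes "\<And>j. j \<in> J \<Longrightarrow> D (a j)"
  shows "D (\<lambda>p q. \<Sum>j\<in>J. a j p q)"
  using assms by (induction J rule: infinite_finite_induct) (simp_all add: D_zero D_add)

lemma D_prod:
  assumes "\<And>j. j \<in> J \<Longrightarrow> D (\<lambda>p k. a p (j, k))" "\<And>j. j \<in> J \<Longrightarrow> D (\<lambda>k q. b (j, k) q)"
  shows "D (\<lambda>p q. \<Sum>t\<in>J \<times> {..<N}. a p t * b t q)"
proof -
  have "D (\<lambda>p q. \<Sum>j\<in>J. \<Sum>k<N. a p (j, k) * b (j, k) q)"
    by (intro D_sum D_mult[of "\<lambda>p k. a p (_, k)" "\<lambda>k q. b (_, k) q"] assms)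
  thus ?thesis by (simp add: sum.cartesian_product)
qed

text \<open>Gaussian elimination by blocks. Dual families whose blocks lie in \<open>D\<close> are
  chosen maximal; the defect then has blocks in \<open>D\<close>, and a nonzero block is invertible
  and would provide \<open>N\<close> further pairs. So the defect vanishes and the rank is a whole
  number of blocks.\<close>

lemma block_rank:
  fixes Z :: "'i \<times> nat \<Rightarrow> 'i \<times> nat \<Rightarrow> 'f"
  assumes fin: "finite I" and Z: "\<And>i j. D (\<lambda>p q. Z (i, p) (j, q))"
  obtains h where "rank_ge (I \<times> {..<N}) Z (h * N)"
    "\<And>r. rank_ge (I \<times> {..<N}) Z r \<Longrightarrow> r \<le> h * N"
proof -
  let ?T = "I \<times> {..<N}"
  have finT: "finite ?T" using fin by simp
  define dual where "dual = (\<lambda>(h::nat) P Q. \<forall>a\<in>{..<h} \<times> {..<N}. \<forall>b\<in>{..<h} \<times> {..<N}.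
      bil ?T Z (P a) (Q b) = (if a = b then 1 else 0))"
  \<comment> \<open>In \<open>(c, p)\<close> the first entry numbers a block and the second a
    position inside it. \<open>Q\<close> is a family of columns, hence the opposite order of
    \<open>p\<close> and \<open>q\<close>.\<close>
  define blocks where "blocks = (\<lambda>P Q. (\<forall>c i. D (\<lambda>p q. P (c :: nat, p) (i :: 'i, q))) \<and>
      (\<forall>c j. D (\<lambda>p q. Q (c :: nat, q) (j :: 'i, p))))"
  define ok where "ok = (\<lambda>h. \<exists>P Q. dual h P Q \<and> blocks P Q)"
  have rank: "rank_ge ?T Z (h * N)" if "ok h" for h
  proof -
    obtain P Q where PQ: "dual h P Q" using \<open>ok h\<close> unfolding ok_def by blast
    have "rank_ge ?T Z (card ({..<h} \<times> {..<N}))"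
    proof (rule rank_geI)
      show "bil ?T Z (P a) (Q b) = (if a = b then 1 else 0)"
        if "a \<in> {..<h} \<times> {..<N}" "b \<in> {..<h} \<times> {..<N}" for a b
        using PQ that unfolding dual_def by blast
    qed simp
    thus ?thesis by (simp add: card_cartesian_product)
  qed
  have bound: "h \<le> card I" if "ok h" for h
    using rank_ge_le_card[OF finT rank[OF that]] N by (simp add: card_cartesian_product)
  have "finite {h. ok h}" by (rule finite_subset[of _ "{..card I}"]) (use bound in auto)
  moreover have "ok 0"
    unfolding ok_def dual_def blocks_def
    by (intro exI[of _ "\<lambda>_ _. 0"]) (simp add: D_zero)
  ultimately have "ok (Max {h. ok h})" "\<And>h. ok h \<Longrightarrow> h \<le> Max {h. ok h}"
    using Max_in[of "{h. ok h}"] Max_ge[of "{h. ok h}"] by auto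
  then obtain h where h: "ok h" "\<not> ok (Suc h)" by (meson Suc_n_not_le_n)
  obtain P Q where PQ: "dual h P Q" "blocks P Q" using h(1) unfolding ok_def by blast
  have DP: "D (\<lambda>p q. P (c, p) (i, q))" and DQ: "D (\<lambda>p q. Q (c, q) (j, p))" for c i j
    using PQ(2) unfolding blocks_def by blast+
  let ?R = "{..<h} \<times> {..<N}"
  define E :: "'i \<times> nat \<Rightarrow> 'i \<times> nat \<Rightarrow> 'f" where "E = (\<lambda>s s'. if s' = s then 1 else 0)"
  have bilE: "bil ?T Z (E s) g = (\<Sum>t\<in>?T. Z s t * g t)" if "s \<in> ?T" for s g
    unfolding E_def by (rule bil_unit_left[OF finT that])
  have bilE': "bil ?T Z f (E t) = (\<Sum>s\<in>?T. f s * Z s t)" if "t \<in> ?T" for t f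
    unfolding E_def by (subst bil_swap, subst bil_unit_left[OF finT that]) (simp add: mult.commute)
  have DZQ: "D (\<lambda>p q. bil ?T Z (E (i, p)) (Q (c, q)))" if "i \<in> I" for i c
  proof (rule D_cong)
    show "D (\<lambda>p q. \<Sum>t\<in>?T. Z (i, p) t * Q (c, q) t)" by (rule D_prod) (use Z DQ in auto)
  qed (use that bilE in auto)
  have DPZ: "D (\<lambda>p q. bil ?T Z (P (c, p)) (E (j, q)))" if "j \<in> I" for j c
  proof (rule D_cong)
    show "D (\<lambda>p q. \<Sum>s\<in>?T. P (c, p) s * Z s (j, q))" by (rule D_prod) (use Z DP in auto)
  qed (use that bilE' in auto)
  define d where "d = (\<lambda>s t. Z s t - (\<Sum>c\<in>?R. bil ?T Z (E s) (Q c) * bil ?T Z (P c) (E t)))"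
  have Dd: "D (\<lambda>p q. d (i, p) (j, q))" if "i \<in> I" "j \<in> I" for i j
    unfolding d_def by (intro D_diff Z D_prod DZQ DPZ that)
  have d0: "d s t = 0" if st: "s \<in> ?T" "t \<in> ?T" for s t
  proof (rule ccontr)
    assume nz: "d s t \<noteq> 0"
    obtain i p0 where s: "s = (i, p0)" "i \<in> I" "p0 < N" using st(1) by (cases s) auto
    obtain j q0 where t: "t = (j, q0)" "j \<in> I" "q0 < N" using st(2) by (cases t) auto
    obtain b where b: "D b" "\<forall>p<N. \<forall>q<N. (\<Sum>k<N. b p k * d (i, k) (j, q)) = (if p = q then 1 else 0)"
      using D_inverse[OF Dd[OF s(2) t(2)] s(3) t(3)] nz s(1) t(1) by blast
    \<comment> \<open>Block row \<open>i\<close> multiplied by \<open>b\<close> from the left,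
      paired with the unit columns of block column \<open>j\<close>: the Schur complement is
      \<open>b\<close> times the defect block, the identity.\<close>
    define e where "e = (\<lambda>c :: nat \<times> nat. \<lambda>s. \<Sum>k<N. b (snd c) k * E (i, k) s)"
    define v where "v = (\<lambda>c :: nat \<times> nat. E (j, snd c))"
    have bile: "bil ?T Z (e c) g = (\<Sum>k<N. b (snd c) k * bil ?T Z (E (i, k)) g)" for c g
      unfolding e_def by (rule bil_sum_left)
    define P' where "P' = (\<lambda>a. if a \<in> ?R then P a else (\<lambda>s. e a s - (\<Sum>c\<in>?R. bil ?T Z (e a) (Q c) * P c s)))"
    define Q' where "Q' = (\<lambda>b. if b \<in> ?R then Q b else (\<lambda>t. v b t - (\<Sum>c\<in>?R. bil ?T Z (P c) (v b) * Q c t)))"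
    have ev: "bil ?T Z (e a) (v a') - (\<Sum>c\<in>?R. bil ?T Z (e a) (Q c) * bil ?T Z (P c) (v a')) = (if a = a' then 1 else 0)"
      if aa: "a \<in> {h} \<times> {..<N}" "a' \<in> {h} \<times> {..<N}" for a a'
    proof -
      have EE: "bil ?T Z (E (i, k)) (E (j, q)) = Z (i, k) (j, q)" if "k < N" "q < N" for k q
        unfolding E_def by (rule bil_unit[OF finT]) (use that s t in auto)
      have "bil ?T Z (e a) (v a') - (\<Sum>c\<in>?R. bil ?T Z (e a) (Q c) * bil ?T Z (P c) (v a')) =
          (\<Sum>k<N. b (snd a) k * bil ?T Z (E (i, k)) (v a')) -
          (\<Sum>k<N. \<Sum>c\<in>?R. b (snd a) k * (bil ?T Z (E (i, k)) (Q c) * bil ?T Z (P c) (v a')))"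
        unfolding bile by (simp add: sum_distrib_right mult.assoc) (rule sum.swap)
      also have "\<dots> = (\<Sum>k<N. b (snd a) k * d (i, k) (j, snd a'))"
        unfolding d_def v_def
        using aa(2) EE by (simp add: right_diff_distrib sum_subtractf sum_distrib_left mem_Times_iff)
      also have "\<dots> = (if a = a' then 1 else 0)"
        using b(2) aa by (auto simp: mem_Times_iff prod_eq_iff)
      finally show ?thesis .
    qed
    have "dual (Suc h) P' Q'"
      unfolding dual_def P'_def Q'_def
    proof (intro ballI, rule bil_extend[where R' = "{h} \<times> {..<N}"])
      show "bil ?T Z (P a) (Q b) = (if a = b then 1 else 0)" if "a \<in> ?R" "b \<in> ?R" for a b
        using PQ(1) that unfolding dual_def by blast
    qed (use ev in \<open>auto simp: less_Suc_eq\<close>)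
    moreover have "blocks P' Q'" unfolding blocks_def
    proof (intro conjI allI)
      show "D (\<lambda>p q. P' (c, p) (i', q))" for c i'
      proof (cases "c < h")
        case True
        show ?thesis by (rule D_cong[OF DP[of c i']]) (use True in \<open>simp add: P'_def\<close>)
      next
        case False
        have De: "D (\<lambda>p q. e (c, p) (i', q))"
        proof (cases "i' = i")
          case True
          show ?thesis
            by (rule D_cong[OF b(1)]) (simp add: True e_def E_def if_distrib[of "\<lambda>x. _ * x"] cong: if_cong)
        next
          case False
          thus ?thesis by (simp add: e_def E_def D_zero)
        qed
        have DeQ: "D (\<lambda>p q. bil ?T Z (e (c, p)) (Q (c', q)))" for c'
          unfolding bile snd_conv by (rule D_mult[OF b(1) DZQ[OF s(2)]])
        have "D (\<lambda>p q. e (c, p) (i', q) - (\<Sum>c'\<in>?R. bil ?T Z (e (c, p)) (Q c') * P c' (i', q)))"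
          by (intro D_diff De D_prod DeQ DP)
        thus ?thesis using False by (simp add: P'_def)
      qed
      show "D (\<lambda>p q. Q' (c, q) (i', p))" for c i'
      proof (cases "c < h")
        case True
        show ?thesis by (rule D_cong[OF DQ[of c i']]) (use True in \<open>simp add: Q'_def\<close>)
      next
        case False
        have Dv: "D (\<lambda>p q. v (c, q) (i', p))"
        proof (cases "i' = j")
          case True
          show ?thesis by (rule D_cong[OF D_one]) (simp add: True v_def E_def)
        next
          case False
          thus ?thesis by (simp add: v_def E_def D_zero)
        qed
        have DPv: "D (\<lambda>p q. bil ?T Z (P (c', p)) (v (c, q)))" for c'
          unfolding v_def snd_conv by (rule DPZ[OF t(2)])
        have "D (\<lambda>p q. \<Sum>c'\<in>?R. Q c' (i', p) * bil ?T Z (P c') (v (c, q)))"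
          by (rule D_prod[OF DQ DPv])
        hence "D (\<lambda>p q. v (c, q) (i', p) - (\<Sum>c'\<in>?R. Q c' (i', p) * bil ?T Z (P c') (v (c, q))))"
          by (rule D_diff[OF Dv])
        thus ?thesis using False by (simp add: Q'_def mult.commute)
      qed
    qed
    ultimately have "ok (Suc h)" unfolding ok_def by blast
    with h(2) show False by simp
  qed
  \<comment> \<open>Without defect, \<open>Z\<close> factors through \<open>h * N\<close>
    coordinates, which bounds every rank from above.\<close>
  have fact: "bil ?T Z f g = (\<Sum>c\<in>?R. bil ?T Z f (Q c) * bil ?T Z (P c) g)" for f g
  proof -
    have fE: "bil ?T Z f (Q c) = (\<Sum>s\<in>?T. f s * bil ?T Z (E s) (Q c))" for c
      using bilE by (simp add: bil_def sum_distrib_left mult.assoc)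
    have gE: "bil ?T Z (P c) g = (\<Sum>t\<in>?T. bil ?T Z (P c) (E t) * g t)" for c
    proof -
      have "bil ?T Z (P c) g = (\<Sum>t\<in>?T. (\<Sum>s\<in>?T. P c s * Z s t) * g t)"
        unfolding bil_def by (subst sum.swap) (simp add: sum_distrib_right)
      thus ?thesis using bilE' by simp
    qed
    have "bil ?T Z f g = (\<Sum>s\<in>?T. \<Sum>t\<in>?T. f s * (\<Sum>c\<in>?R. bil ?T Z (E s) (Q c) * bil ?T Z (P c) (E t)) * g t)"
      unfolding bil_def
    proof (intro sum.cong refl)
      fix s t assume "s \<in> ?T" "t \<in> ?T"
      from d0[OF this] show "f s * Z s t * g t =
        f s * (\<Sum>c\<in>?R. (\<Sum>s'\<in>?T. \<Sum>t'\<in>?T. E s s' * Z s' t' * Q c t') * (\<Sum>s'\<in>?T. \<Sum>t'\<in>?T. P c s' * Z s' t' * E t t')) * g t"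
        unfolding d_def bil_def by simp
    qed
    also have "\<dots> = (\<Sum>s\<in>?T. \<Sum>t\<in>?T. \<Sum>c\<in>?R. (f s * bil ?T Z (E s) (Q c)) * (bil ?T Z (P c) (E t) * g t))"
      by (simp add: sum_distrib_left sum_distrib_right mult.assoc)
    also have "\<dots> = (\<Sum>s\<in>?T. \<Sum>c\<in>?R. \<Sum>t\<in>?T. (f s * bil ?T Z (E s) (Q c)) * (bil ?T Z (P c) (E t) * g t))"
      by (rule sum.cong[OF refl]) (rule sum.swap)
    also have "\<dots> = (\<Sum>c\<in>?R. \<Sum>s\<in>?T. \<Sum>t\<in>?T. (f s * bil ?T Z (E s) (Q c)) * (bil ?T Z (P c) (E t) * g t))"
      by (rule sum.swap)
    also have "\<dots> = (\<Sum>c\<in>?R. bil ?T Z f (Q c) * bil ?T Z (P c) g)"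
      unfolding fE gE by (simp only: sum_product)
    finally show ?thesis .
  qed
  show ?thesis
  proof (rule that[OF rank[OF h(1)]])
    show "r \<le> h * N" if "rank_ge ?T Z r" for r
      using rank_ge_factor[OF _ fact that] by (simp add: card_cartesian_product)
  qed
qed

end

section \<open>Twisted Laurent series\<close>

text \<open>Lower bounds on the supports may replace the subdegrees, as the additional terms vanish.
  A common bound can then serve a whole family of series, including zero ones.\<close>

lemma fls_times_nth_bounds:
  fixes f g :: "'a :: comm_ring_1 fls"
  assumes f: "\<And>i. i < a \<Longrightarrow> fls_nth f i = 0" and g: "\<And>i. i < b \<Longrightarrow> fls_nth g i = 0"
  shows "fls_nth (f * g) n = (\<Sum>i=a..n - b. fls_nth f i * fls_nth g (n - i))"
proof (cases "f = 0 \<or> g = 0")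
  case True
  thus ?thesis by auto
next
  case False
  have le: "a \<le> fls_subdegree f" "b \<le> fls_subdegree g"
    using False f g by (auto intro!: fls_subdegree_geI)
  have "fls_nth (f * g) n = (\<Sum>i=fls_subdegree f..n - fls_subdegree g. fls_nth f i * fls_nth g (n - i))"
    by (rule fls_times_nth(2))
  also have "\<dots> = (\<Sum>i=a..n - b. fls_nth f i * fls_nth g (n - i))"
  proof (rule sum.mono_neutral_left)
    show "\<forall>i\<in>{a..n - b} - {fls_subdegree f..n - fls_subdegree g}. fls_nth f i * fls_nth g (n - i) = 0"
    proof
      fix i assume i: "i \<in> {a..n - b} - {fls_subdegree f..n - fls_subdegree g}"
      hence "i < fls_subdegree f \<or> n - i < fls_subdegree g" by auto
      thus "fls_nth f i * fls_nth g (n - i) = 0" by auto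
    qed
  qed (use le in auto)
  finally show ?thesis .
qed

lemma fls_times_nth_lowest:
  fixes f g :: "'a :: comm_ring_1 fls"
  assumes f: "\<And>i. i < a \<Longrightarrow> fls_nth f i = 0" and g: "\<And>i. i < b \<Longrightarrow> fls_nth g i = 0"
  shows "fls_nth (f * g) (a + b) = fls_nth f a * fls_nth g b"
  by (subst fls_times_nth_bounds[OF f g]) auto

lemma fls_lower_bound: "\<exists>a. \<forall>i<a. fls_nth f i = 0"
  by (rule exI[of _ "fls_subdegree f"]) simp

text \<open>The semilinear substitution of \<open>u X\<close> for the variable \<open>X\<close>,
  with \<open>s\<close> applied to the coefficients.\<close>

definition fls_twist :: "('a \<Rightarrow> 'a) \<Rightarrow> 'a \<Rightarrow> 'a :: field fls \<Rightarrow> 'a fls" where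
  "fls_twist s u f = Abs_fls (\<lambda>n. u powi n * s (fls_nth f n))"

definition unital_hom :: "('a :: comm_ring_1 \<Rightarrow> 'b :: comm_ring_1) \<Rightarrow> bool" where
  "unital_hom s \<longleftrightarrow> s 0 = 0 \<and> s 1 = 1 \<and> (\<forall>x y. s (x + y) = s x + s y) \<and> (\<forall>x y. s (x * y) = s x * s y)"

lemma unital_hom_simps:
  assumes "unital_hom s"
  shows "s 0 = 0" "s 1 = 1" "s (x + y) = s x + s y" "s (x * y) = s x * s y"
  using assms by (auto simp: unital_hom_def)

lemma unital_hom_diff:
  assumes "unital_hom s"
  shows "s (x - y) = s x - s y"
proof -
  have "s ((x - y) + y) = s (x - y) + s y" by (rule unital_hom_simps(3)[OF assms])
  thus ?thesis by simp
qed

lemma unital_hom_sum: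
  assumes "unital_hom s"
  shows "s (\<Sum>j\<in>J. f j) = (\<Sum>j\<in>J. s (f j))"
  by (induction J rule: infinite_finite_induct) (simp_all add: unital_hom_simps[OF assms])

lemma unital_hom_power:
  assumes "unital_hom s"
  shows "s (x ^ n) = s x ^ n"
  by (induction n) (simp_all add: unital_hom_simps[OF assms])

lemma unital_hom_eq_0:
  fixes s :: "'a :: field \<Rightarrow> 'b :: field"
  assumes "unital_hom s"
  shows "s x = 0 \<longleftrightarrow> x = 0"
proof
  show "x = 0" if "s x = 0"
  proof (rule ccontr)
    assume "x \<noteq> 0"
    hence "s (x * inverse x) = 1" by (simp add: unital_hom_simps[OF assms])
    thus False using \<open>s x = 0\<close> by (simp add: unital_hom_simps[OF assms])
  qed
qed (simp add: unital_hom_simps[OF assms])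

lemma unital_hom_inj:
  fixes s :: "'a :: field \<Rightarrow> 'b :: field"
  assumes "unital_hom s"
  shows "s x = s y \<longleftrightarrow> x = y"
  using unital_hom_eq_0[OF assms, of "x - y"] by (simp add: unital_hom_diff[OF assms])

lemma unital_hom_id: "unital_hom (\<lambda>x. x)"
  by (simp add: unital_hom_def)

lemma unital_hom_comp: "unital_hom s \<Longrightarrow> unital_hom t \<Longrightarrow> unital_hom (\<lambda>x. s (t x))"
  by (simp add: unital_hom_def)

lemma unital_hom_fls_const: "unital_hom (fls_const :: 'a :: comm_ring_1 \<Rightarrow> 'a fls)"
  by (simp add: unital_hom_def fls_plus_const)

context
  fixes s :: "'a :: field \<Rightarrow> 'a" and u :: 'a
  assumes s: "unital_hom s" and u: "u \<noteq> 0"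
begin

lemma fls_twist_nth: "fls_nth (fls_twist s u f) n = u powi n * s (fls_nth f n)"
  unfolding fls_twist_def
  by (rule nth_Abs_fls_lower_bound[of "fls_subdegree f"]) (simp add: unital_hom_simps[OF s])

lemma unital_hom_fls_twist: "unital_hom (fls_twist s u)"
  unfolding unital_hom_def
proof (intro conjI allI)
  show "fls_twist s u 0 = 0" by (rule fls_eqI) (simp add: fls_twist_nth unital_hom_simps[OF s])
  show "fls_twist s u 1 = 1" by (rule fls_eqI) (simp add: fls_twist_nth unital_hom_simps[OF s])
  show "fls_twist s u (f + g) = fls_twist s u f + fls_twist s u g" for f g
    by (rule fls_eqI) (simp add: fls_twist_nth unital_hom_simps[OF s] algebra_simps)
  show "fls_twist s u (f * g) = fls_twist s u f * fls_twist s u g" for f g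
  proof (rule fls_eqI)
    fix n
    obtain a where a: "\<And>i. i < a \<Longrightarrow> fls_nth f i = 0" using fls_lower_bound by blast
    obtain b where b: "\<And>i. i < b \<Longrightarrow> fls_nth g i = 0" using fls_lower_bound by blast
    have "fls_nth (fls_twist s u f * fls_twist s u g) n =
        (\<Sum>i=a..n - b. fls_nth (fls_twist s u f) i * fls_nth (fls_twist s u g) (n - i))"
      by (rule fls_times_nth_bounds) (simp_all add: fls_twist_nth a b unital_hom_simps[OF s])
    also have "\<dots> = (\<Sum>i=a..n - b. u powi n * s (fls_nth f i * fls_nth g (n - i)))"
    proof (rule sum.cong[OF refl])
      fix i
      have "u powi n = u powi i * u powi (n - i)" using u by (simp flip: power_int_add)
      thus "fls_nth (fls_twist s u f) i * fls_nth (fls_twist s u g) (n - i) = u powi n * s (fls_nth f i * fls_nth g (n - i))"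
        by (simp add: fls_twist_nth unital_hom_simps[OF s])
    qed
    also have "\<dots> = fls_nth (fls_twist s u (f * g)) n"
      by (simp add: fls_twist_nth fls_times_nth_bounds[OF a b] unital_hom_sum[OF s] sum_distrib_left)
    finally show "fls_nth (fls_twist s u (f * g)) n = fls_nth (fls_twist s u f * fls_twist s u g) n" by simp
  qed
qed

lemma fls_twist_const: "fls_twist s u (fls_const c) = fls_const (s c)"
  by (rule fls_eqI) (simp add: fls_twist_nth unital_hom_simps[OF s])

lemma fls_twist_X: "fls_twist s u fls_X = fls_const u * fls_X"
  by (rule fls_eqI) (simp add: fls_twist_nth unital_hom_simps[OF s])

end

lemma mod_add_inj:
  assumes pq: "p < N" "q < N" and eq: "(p + c) mod N = (q + c) mod (N :: nat)"
  shows "p = q"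
proof -
  have aux: "p = q" if "p \<le> q" "q < N" "(q + c) mod N = (p + c) mod N" for p q
  proof -
    have "N dvd (q + c) - (p + c)" using that mod_eq_dvd_iff_nat[of "p + c" "q + c" N] by simp
    hence "N dvd q - p" by simp
    thus ?thesis using that dvd_imp_le[of N "q - p"] by (cases "q - p = 0") auto
  qed
  show ?thesis
  proof (cases "p \<le> q")
    case True
    thus ?thesis using aux[of p q] pq eq by simp
  next
    case False
    thus ?thesis using aux[of q p] pq eq by simp
  qed
qed

lemma bij_mod_add: "bij_betw (\<lambda>p. (p + c) mod N) {..<N} {..<(N :: nat)}"
proof (cases "N = 0")
  case False
  have inj: "inj_on (\<lambda>p. (p + c) mod N) {..<N}"
    by (rule inj_onI, rule mod_add_inj[of _ N _ c]) simp_all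
  have "(\<lambda>p. (p + c) mod N) ` {..<N} \<subseteq> {..<N}" using False by auto
  hence "(\<lambda>p. (p + c) mod N) ` {..<N} = {..<N}" using inj by (rule endo_inj_surj[OF finite_lessThan])
  with inj show ?thesis unfolding bij_betw_def by blast
qed (simp add: bij_betw_def)

section \<open>A division ring of matrices over iterated Laurent series\<close>

locale root_of_unity =
  fixes N :: nat and \<zeta> :: "'k :: field"
  assumes N: "N > 0" and zeta_N: "\<zeta> ^ N = 1"
    and zeta_inj: "\<And>p q. p < N \<Longrightarrow> q < N \<Longrightarrow> \<zeta> ^ p = \<zeta> ^ q \<Longrightarrow> p = q"
begin

lemma zeta_nz: "\<zeta> \<noteq> 0"
  using zeta_N N by (metis power_0_left less_numeral_extra(3) zero_neq_one)

text \<open>Nesting the series fields gives two independent variables, one for each of the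
  automorphisms \<open>\<theta>1\<close> and \<open>\<theta>2\<close>; constants are fixed by both.
  The matrices in \<open>D\<close> then form a symbol algebra, generated by two elements that
  commute up to the root of unity.\<close>

definition emb :: "'k \<Rightarrow> 'k fls fls" where "emb c = fls_const (fls_const c)"

abbreviation "z \<equiv> emb \<zeta>"

text \<open>Multiply the outer, respectively the inner, Laurent variable by \<open>\<zeta>\<close>.\<close>

definition \<theta>1 :: "'k fls fls \<Rightarrow> 'k fls fls" where "\<theta>1 = fls_twist (\<lambda>x. x) (fls_const \<zeta>)"
definition \<sigma> :: "'k fls \<Rightarrow> 'k fls" where "\<sigma> = fls_twist (\<lambda>x. x) \<zeta>"
definition \<theta>2 :: "'k fls fls \<Rightarrow> 'k fls fls" where "\<theta>2 = fls_twist \<sigma> 1"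

lemma hom_emb: "unital_hom emb"
proof -
  have "unital_hom (\<lambda>c :: 'k. fls_const (fls_const c))"
    by (rule unital_hom_comp[OF unital_hom_fls_const unital_hom_fls_const])
  thus ?thesis by (simp add: emb_def[abs_def])
qed

lemma hom_sigma: "unital_hom \<sigma>"
  unfolding \<sigma>_def by (rule unital_hom_fls_twist[OF unital_hom_id zeta_nz])

lemma const_zeta_nz: "fls_const \<zeta> \<noteq> 0" using zeta_nz by simp

lemma hom1: "unital_hom \<theta>1"
  unfolding \<theta>1_def by (rule unital_hom_fls_twist[OF unital_hom_id const_zeta_nz])

lemma hom2: "unital_hom \<theta>2"
  unfolding \<theta>2_def by (rule unital_hom_fls_twist[OF hom_sigma]) simp

lemma theta_emb: "\<theta>1 (emb c) = emb c" "\<theta>2 (emb c) = emb c"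
  unfolding \<theta>1_def \<theta>2_def emb_def \<sigma>_def
  by (simp_all add: fls_twist_const unital_hom_id const_zeta_nz zeta_nz hom_sigma[unfolded \<sigma>_def])

lemma z_nz: "z \<noteq> 0" using zeta_nz by (simp add: emb_def)

lemma z_N: "z ^ N = 1" using unital_hom_power[OF hom_emb, of \<zeta> N] zeta_N by (simp add: unital_hom_simps[OF hom_emb])

lemma power_mod:
  fixes y :: "'b :: monoid_mult"
  assumes "y ^ N = 1"
  shows "y ^ (n mod N) = y ^ n"
proof -
  have "y ^ n = y ^ (N * (n div N) + n mod N)" by simp
  also have "\<dots> = y ^ (n mod N)" using assms by (simp only: power_add power_mult power_one mult_1_left)
  finally show ?thesis by simp
qed

text \<open>
  The matrices fixed by two commuting semilinear automorphisms: conjugation by the clock matrix and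
  by the shift matrix, composed with \<open>\<theta>1\<close> and \<open>\<theta>2\<close>.
\<close>

definition D :: "(nat \<Rightarrow> nat \<Rightarrow> 'k fls fls) \<Rightarrow> bool" where
  "D a \<longleftrightarrow> (\<forall>p<N. \<forall>q<N. \<theta>1 (a p q) * z ^ p = z ^ q * a p q \<and>
      \<theta>2 (a p q) = a ((p + 1) mod N) ((q + 1) mod N))"

lemma D_cong:
  assumes "D a" "\<And>p q. p < N \<Longrightarrow> q < N \<Longrightarrow> a p q = b p q"
  shows "D b"
  using assms N by (simp add: D_def)

lemma D_diff: "D a \<Longrightarrow> D b \<Longrightarrow> D (\<lambda>p q. a p q - b p q)"
  by (simp add: D_def unital_hom_diff[OF hom1] unital_hom_diff[OF hom2] algebra_simps)

lemma D_scale: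
  assumes "D a"
  shows "D (\<lambda>p q. emb c * a p q)"
  using assms by (simp add: D_def unital_hom_simps[OF hom1] unital_hom_simps[OF hom2] theta_emb mult_ac)

lemma D_one: "D (\<lambda>p q. if p = q then 1 else 0)"
  unfolding D_def
proof (intro allI impI conjI)
  fix p q assume pq: "p < N" "q < N"
  show "\<theta>1 (if p = q then 1 else 0) * z ^ p = z ^ q * (if p = q then 1 else 0)"
    by (simp add: unital_hom_simps[OF hom1])
  show "\<theta>2 (if p = q then 1 else 0) = (if (p + 1) mod N = (q + 1) mod N then 1 else 0)"
    using mod_add_inj[OF pq, of 1] by (auto simp: unital_hom_simps[OF hom2])
qed

lemma D_mult:
  assumes a: "D a" and b: "D b"
  shows "D (\<lambda>p q. \<Sum>k<N. a p k * b k q)"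
  unfolding D_def
proof (intro allI impI conjI)
  fix p q assume pq: "p < N" "q < N"
  have "\<theta>1 (a p k * b k q) * z ^ p = z ^ q * (a p k * b k q)" if k: "k < N" for k
  proof -
    have "z ^ k * (\<theta>1 (a p k * b k q) * z ^ p) = (\<theta>1 (a p k) * z ^ p) * (\<theta>1 (b k q) * z ^ k)"
      by (simp add: unital_hom_simps[OF hom1] mult_ac)
    also have "\<dots> = z ^ k * (z ^ q * (a p k * b k q))"
      using a b pq k by (simp add: D_def mult_ac)
    finally show ?thesis using z_nz by simp
  qed
  thus "\<theta>1 (\<Sum>k<N. a p k * b k q) * z ^ p = z ^ q * (\<Sum>k<N. a p k * b k q)"
    by (simp add: unital_hom_sum[OF hom1] sum_distrib_left sum_distrib_right)
  have "\<theta>2 (\<Sum>k<N. a p k * b k q) = (\<Sum>k<N. a ((p + 1) mod N) ((k + 1) mod N) * b ((k + 1) mod N) ((q + 1) mod N))"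
    using a b pq by (simp add: unital_hom_sum[OF hom2] unital_hom_simps[OF hom2] D_def)
  also have "\<dots> = (\<Sum>k<N. a ((p + 1) mod N) k * b k ((q + 1) mod N))"
    by (rule sum.reindex_bij_betw[OF bij_mod_add])
  finally show "\<theta>2 (\<Sum>k<N. a p k * b k q) = (\<Sum>k<N. a ((p + 1) mod N) k * b k ((q + 1) mod N))" .
qed

end

section \<open>Ranks under field embeddings\<close>

lemma bil_hom:
  assumes "unital_hom f"
  shows "bil T (\<lambda>s t. f (Z s t)) (\<lambda>s. f (g s)) (\<lambda>s. f (h s)) = f (bil T Z g h)"
  by (simp add: bil_def unital_hom_sum[OF assms] unital_hom_simps[OF assms])

lemma rank_ge_hom:
  assumes f: "unital_hom f" and r: "rank_ge T Z r"
  shows "rank_ge T (\<lambda>s t. f (Z s t)) r"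
proof -
  obtain P Q where "\<forall>a<r. \<forall>b<r. bil T Z (P a) (Q b) = (if a = b then 1 else 0)"
    using r unfolding rank_ge_def by blast
  thus ?thesis unfolding rank_ge_def
    by (intro exI[of _ "\<lambda>a s. f (P a s)"] exI[of _ "\<lambda>a s. f (Q a s)"])
      (simp add: bil_hom[OF f] unital_hom_simps[OF f])
qed

lemma rank_ge_factor_entries:
  fixes Z :: "'t \<Rightarrow> 't \<Rightarrow> 'a :: field"
  assumes fin: "finite R" and Z: "\<And>s t. s \<in> T \<Longrightarrow> t \<in> T \<Longrightarrow> Z s t = (\<Sum>c\<in>R. A s c * B c t)"
    and r: "rank_ge T Z r"
  shows "r \<le> card R"
proof (rule rank_ge_factor[OF fin _ r])
  fix f g
  have "bil T Z f g = (\<Sum>s\<in>T. \<Sum>t\<in>T. \<Sum>c\<in>R. (f s * A s c) * (B c t * g t))"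
    unfolding bil_def by (intro sum.cong refl) (simp add: Z sum_distrib_left sum_distrib_right mult_ac)
  also have "\<dots> = (\<Sum>s\<in>T. \<Sum>c\<in>R. \<Sum>t\<in>T. (f s * A s c) * (B c t * g t))"
    by (rule sum.cong[OF refl]) (rule sum.swap)
  also have "\<dots> = (\<Sum>c\<in>R. \<Sum>s\<in>T. \<Sum>t\<in>T. (f s * A s c) * (B c t * g t))"
    by (rule sum.swap)
  finally show "bil T Z f g = (\<Sum>c\<in>R. (\<Sum>s\<in>T. f s * A s c) * (\<Sum>t\<in>T. B c t * g t))"
    by (simp add: sum_product)
qed

text \<open>A rank factorization of \<open>Z\<close> through its maximal rank \<open>r0\<close> is
  carried by \<open>f\<close> to a factorization of the image, so the image cannot have rank above
  \<open>r0\<close>.\<close>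

lemma rank_ge_hom_reflect:
  fixes Z :: "'t \<Rightarrow> 't \<Rightarrow> 'a :: field" and f :: "'a \<Rightarrow> 'b :: field"
  assumes fin: "finite T" and f: "unital_hom f" and r: "rank_ge T (\<lambda>s t. f (Z s t)) r"
  shows "rank_ge T Z r"
proof (rule rank_ge_max[OF fin, of Z])
  fix r0 assume r0: "rank_ge T Z r0" "\<And>r'. rank_ge T Z r' \<Longrightarrow> r' \<le> r0"
  obtain P Q where PQ: "\<forall>a<r0. \<forall>b<r0. bil T Z (P a) (Q b) = (if a = b then 1 else 0)"
    using r0(1) unfolding rank_ge_def by blast
  define E :: "'t \<Rightarrow> 't \<Rightarrow> 'a" where "E = (\<lambda>s s'. if s' = s then 1 else 0)"
  have notmore: "\<not> rank_ge T Z (Suc r0)" using r0(2)[of "Suc r0"] by auto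
  have Z: "Z s t = (\<Sum>c<r0. bil T Z (E s) (Q c) * bil T Z (P c) (E t))" if "s \<in> T" "t \<in> T" for s t
    using bil_maximal[OF PQ[rule_format] notmore, of "E s" "E t"] bil_unit[OF fin that, of Z]
    by (simp add: E_def)
  have "r \<le> card {..<r0}"
  proof (rule rank_ge_factor_entries[OF _ _ r])
    show "f (Z s t) = (\<Sum>c\<in>{..<r0}. f (bil T Z (E s) (Q c)) * f (bil T Z (P c) (E t)))"
      if "s \<in> T" "t \<in> T" for s t
      by (subst Z[OF that]) (simp add: unital_hom_sum[OF f] unital_hom_simps[OF f])
  qed simp
  thus ?thesis using rank_ge_mono[OF r0(1), of r] by simp
qed

lemma injective_inverse:
  fixes Y :: "nat \<Rightarrow> nat \<Rightarrow> 'f :: field"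
  assumes inj: "\<And>v q. (\<And>p. p < N \<Longrightarrow> (\<Sum>q<N. Y p q * v q) = 0) \<Longrightarrow> q < N \<Longrightarrow> v q = 0"
  obtains b where "\<And>p q. p < N \<Longrightarrow> q < N \<Longrightarrow> (\<Sum>k<N. Y p k * b k q) = (if p = q then 1 else 0)"
    "\<And>p q. p < N \<Longrightarrow> q < N \<Longrightarrow> (\<Sum>k<N. b p k * Y k q) = (if p = q then 1 else 0)"
proof (rule rank_ge_max[of "{..<N}" Y])
  fix r assume r: "rank_ge {..<N} Y r" "\<And>r'. rank_ge {..<N} Y r' \<Longrightarrow> r' \<le> r"
  have notmore: "\<not> rank_ge {..<N} Y (Suc r)" using r(2)[of "Suc r"] by auto
  have "\<not> r < card {..<N}"
  proof
    assume "r < card {..<N}"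
    from kernel_nonzero[OF finite_lessThan r(1) notmore this] show False
      using inj by (metis lessThan_iff)
  qed
  hence "r = card {..<N}" using rank_ge_le_card[OF finite_lessThan r(1)] by simp
  hence full: "rank_ge {..<N} Y (card {..<N})" using r(1) by simp
  show thesis
  proof (rule rank_ge_full_inverse[OF finite_lessThan full])
    fix b
    assume "\<And>s t. s \<in> {..<N} \<Longrightarrow> t \<in> {..<N} \<Longrightarrow> (\<Sum>u<N. Y s u * b u t) = (if s = t then 1 else 0)"
      "\<And>s t. s \<in> {..<N} \<Longrightarrow> t \<in> {..<N} \<Longrightarrow> (\<Sum>u<N. b s u * Y u t) = (if s = t then 1 else 0)"
    thus thesis by (intro that[of b]) simp_all
  qed
qed simp

lemma lowest_coefficient:
  fixes f :: "'j \<Rightarrow> 'a :: comm_ring_1 fls"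
  assumes fin: "finite J" and nz: "j0 \<in> J" "f j0 \<noteq> 0"
  obtains m j where "\<And>j i. j \<in> J \<Longrightarrow> i < m \<Longrightarrow> fls_nth (f j) i = 0" "j \<in> J" "fls_nth (f j) m \<noteq> 0"
proof -
  define K where "K = {j \<in> J. f j \<noteq> 0}"
  have K: "finite K" "K \<noteq> {}" using fin nz by (auto simp: K_def)
  define m where "m = Min ((\<lambda>j. fls_subdegree (f j)) ` K)"
  have low: "fls_nth (f j) i = 0" if "j \<in> J" "i < m" for j i
  proof (cases "f j = 0")
    case False
    hence "m \<le> fls_subdegree (f j)" unfolding m_def using K that(1) by (intro Min_le) (auto simp: K_def)
    thus ?thesis using that(2) by simp
  qed simp
  have "m \<in> (\<lambda>j. fls_subdegree (f j)) ` K" unfolding m_def using K by (intro Min_in) auto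
  then obtain j where "j \<in> K" "m = fls_subdegree (f j)" by blast
  thus ?thesis using that[of m j] low by (auto simp: K_def)
qed

context root_of_unity
begin

text \<open>
  The coefficient matrix of lowest degree in the outer variable is a monomial matrix: the clock
  condition leaves at most one entry per row, the shift condition at least one per column.
\<close>

lemma D_injective:
  assumes a: "D a" and nz: "p' < N" "q' < N" "a p' q' \<noteq> 0"
    and v: "\<And>p. p < N \<Longrightarrow> (\<Sum>q<N. a p q * v q) = 0" and q: "q < N"
  shows "v q = 0"
proof (rule ccontr)
  assume vq: "v q \<noteq> 0"
  obtain m' q1 where v_low: "\<And>j i. j \<in> {..<N} \<Longrightarrow> i < m' \<Longrightarrow> fls_nth (v j) i = 0"
    and q1: "q1 \<in> {..<N}" "fls_nth (v q1) m' \<noteq> 0"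
    by (rule lowest_coefficient[of "{..<N}" q v]) (use vq q in auto)
  obtain m pq0 where a_low: "\<And>j i. j \<in> {..<N} \<times> {..<N} \<Longrightarrow> i < m \<Longrightarrow> fls_nth (a (fst j) (snd j)) i = 0"
    and pq0: "pq0 \<in> {..<N} \<times> {..<N}" "fls_nth (a (fst pq0) (snd pq0)) m \<noteq> 0"
    by (rule lowest_coefficient[of "{..<N} \<times> {..<N}" "(p', q')" "\<lambda>j. a (fst j) (snd j)"]) (use nz in auto)
  define g where "g = (\<lambda>p q. fls_nth (a p q) m)"
  have g_shift: "g ((p + 1) mod N) ((q + 1) mod N) = \<sigma> (g p q)" if "p < N" "q < N" for p q
  proof -
    have "a ((p + 1) mod N) ((q + 1) mod N) = \<theta>2 (a p q)" using a that by (simp add: D_def)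
    thus ?thesis by (simp add: g_def \<theta>2_def fls_twist_nth[OF hom_sigma])
  qed
  have g_unique: "q = q''" if "p < N" "q < N" "q'' < N" "g p q \<noteq> 0" "g p q'' \<noteq> 0" for p q q''
  proof -
    \<comment> \<open>In degree \<open>m\<close> the clock condition expresses the
      \<open>q\<close>-th power of the root of unity by \<open>m\<close> and \<open>p\<close>
      wherever \<open>g p q\<close> is nonzero. As these powers are distinct, \<open>p\<close>
      determines \<open>q\<close>.\<close>
    have eq: "fls_const (\<zeta> ^ q) = fls_const \<zeta> powi m * fls_const (\<zeta> ^ p)" if "q < N" "g p q \<noteq> 0" for q
    proof -
      have "fls_nth (\<theta>1 (a p q) * emb (\<zeta> ^ p)) m = fls_nth (emb (\<zeta> ^ q) * a p q) m"
        using a \<open>p < N\<close> that(1) by (simp add: D_def unital_hom_power[OF hom_emb])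
      hence "fls_const \<zeta> powi m * g p q * fls_const (\<zeta> ^ p) = fls_const (\<zeta> ^ q) * g p q"
        by (simp add: emb_def \<theta>1_def fls_twist_nth[OF unital_hom_id const_zeta_nz] g_def)
      hence "g p q * (fls_const \<zeta> powi m * fls_const (\<zeta> ^ p)) = g p q * fls_const (\<zeta> ^ q)"
        by (simp only: mult_ac)
      thus ?thesis using that(2) by (metis mult_cancel_left)
    qed
    have "fls_const (\<zeta> ^ q) = fls_const (\<zeta> ^ q'')" using eq[OF that(2,4)] eq[OF that(3,5)] by simp
    hence "\<zeta> ^ q = \<zeta> ^ q''" by (simp add: unital_hom_inj[OF unital_hom_fls_const, simplified])
    thus ?thesis using zeta_inj that by blast
  qed
  obtain p0 q0 where pq0': "p0 < N" "q0 < N" "g p0 q0 \<noteq> 0" using pq0 by (auto simp: g_def)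
  have g_nz: "g ((p0 + j) mod N) ((q0 + j) mod N) \<noteq> 0" for j
  proof (induction j)
    case 0
    thus ?case using pq0' by simp
  next
    case (Suc j)
    have "g (((p0 + j) mod N + 1) mod N) (((q0 + j) mod N + 1) mod N) \<noteq> 0"
      using Suc by (subst g_shift) (simp_all add: N unital_hom_eq_0[OF hom_sigma])
    thus ?case by (simp add: mod_Suc_eq)
  qed
  \<comment> \<open>Moving \<open>q1 + N - q0\<close> steps along the cyclic diagonal from
    \<open>(p0, q0)\<close> ends in column \<open>q1\<close>; the added \<open>N\<close> keeps the
    subtraction of natural numbers exact.\<close>
  define p1 where "p1 = (p0 + (q1 + N - q0)) mod N"
  have "(q0 + (q1 + N - q0)) mod N = q1" using pq0'(2) q1(1) by simp
  hence p1: "p1 < N" "g p1 q1 \<noteq> 0" using g_nz[of "q1 + N - q0"] N by (auto simp: p1_def)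
  \<comment> \<open>In degree \<open>m + m'\<close>, row \<open>p1\<close> retains the single term
    at \<open>q1\<close>, a product of two nonzero lowest coefficients.\<close>
  have "0 = fls_nth (\<Sum>q<N. a p1 q * v q) (m + m')" using v p1(1) by simp
  also have "\<dots> = (\<Sum>q<N. g p1 q * fls_nth (v q) m')"
    unfolding g_def fls_nth_sum
    by (intro sum.cong refl fls_times_nth_lowest) (use a_low[of "(p1, _)"] v_low p1(1) in auto)
  also have "\<dots> = (\<Sum>q\<in>{q1}. g p1 q * fls_nth (v q) m')"
    using g_unique[OF p1(1) _ _ _ p1(2)] q1(1) by (intro sum.mono_neutral_right) auto
  finally show False using p1(2) q1(2) by simp
qed

text \<open>Injectivity gives a two-sided inverse \<open>b\<close> over the series field. Both
  twisted automorphisms fix \<open>a\<close>, so they carry \<open>b\<close> to left inverses of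
  \<open>a\<close>. Left inverses coincide, hence \<open>b\<close> is fixed as well.\<close>

lemma D_inverse:
  assumes a: "D a" and nz: "p' < N" "q' < N" "a p' q' \<noteq> 0"
  shows "\<exists>b. D b \<and> (\<forall>p<N. \<forall>q<N. (\<Sum>k<N. b p k * a k q) = (if p = q then 1 else 0))"
proof (rule injective_inverse[of N a])
  show "v q = 0" if "\<And>p. p < N \<Longrightarrow> (\<Sum>q<N. a p q * v q) = 0" "q < N" for v q
    using D_injective[OF a nz, of v q] that by blast
next
  fix b
  assume right: "\<And>p q. p < N \<Longrightarrow> q < N \<Longrightarrow> (\<Sum>k<N. a p k * b k q) = (if p = q then 1 else 0)"
    and left: "\<And>p q. p < N \<Longrightarrow> q < N \<Longrightarrow> (\<Sum>k<N. b p k * a k q) = (if p = q then 1 else 0)"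
  have expand: "c j = (\<Sum>q<N. (\<Sum>k<N. c k * a k q) * b q j)" if "j < N" for c j
  proof -
    have "(\<Sum>q<N. (\<Sum>k<N. c k * a k q) * b q j) = (\<Sum>k<N. c k * (\<Sum>q<N. a k q * b q j))"
      unfolding sum_distrib_left sum_distrib_right mult.assoc by (rule sum.swap)
    also have "\<dots> = (\<Sum>k<N. c k * (if k = j then 1 else 0))" using that by (simp add: right)
    finally show ?thesis using that by (simp add: if_distrib[of "\<lambda>x. _ * x"] cong: if_cong)
  qed
  have cancel: "c j = c' j" if "\<And>q. q < N \<Longrightarrow> (\<Sum>k<N. c k * a k q) = (\<Sum>k<N. c' k * a k q)" "j < N" for c c' j
    using that by (subst (1 2) expand) auto
  have z_unit: "inverse (z ^ k) * z ^ k = 1" for k using z_nz by simp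
  have "D b" unfolding D_def
  proof (intro allI impI conjI)
    fix p j assume pj: "p < N" "j < N"
    have "z ^ p * \<theta>1 (b p j) * inverse (z ^ j) = b p j"
    proof (rule cancel[OF _ pj(2), of "\<lambda>k. z ^ p * \<theta>1 (b p k) * inverse (z ^ k)" "b p"])
      fix q assume q: "q < N"
      have "(\<Sum>k<N. z ^ p * \<theta>1 (b p k) * inverse (z ^ k) * a k q) = (\<Sum>k<N. z ^ p * inverse (z ^ q) * \<theta>1 (b p k * a k q))"
      proof (rule sum.cong[OF refl])
        fix k assume "k \<in> {..<N}"
        hence "\<theta>1 (a k q) * z ^ k = z ^ q * a k q" using a q by (simp add: D_def)
        hence "inverse (z ^ q) * (\<theta>1 (a k q) * z ^ k) * inverse (z ^ k) = inverse (z ^ q) * (z ^ q * a k q) * inverse (z ^ k)"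
          by simp
        hence "inverse (z ^ q) * \<theta>1 (a k q) = inverse (z ^ k) * a k q"
          using z_nz by (simp add: field_simps)
        thus "z ^ p * \<theta>1 (b p k) * inverse (z ^ k) * a k q = z ^ p * inverse (z ^ q) * \<theta>1 (b p k * a k q)"
          by (simp add: unital_hom_simps[OF hom1] mult_ac)
      qed
      also have "\<dots> = z ^ p * inverse (z ^ q) * \<theta>1 (\<Sum>k<N. b p k * a k q)"
        by (simp add: unital_hom_sum[OF hom1] sum_distrib_left)
      also have "\<dots> = (\<Sum>k<N. b p k * a k q)"
        using left[OF pj(1) q] z_nz by (simp add: unital_hom_simps[OF hom1])
      finally show "(\<Sum>k<N. z ^ p * \<theta>1 (b p k) * inverse (z ^ k) * a k q) = (\<Sum>k<N. b p k * a k q)" .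
    qed
    hence "(z ^ p * \<theta>1 (b p j) * inverse (z ^ j)) * z ^ j = b p j * z ^ j" by (rule arg_cong)
    moreover have "(z ^ p * \<theta>1 (b p j) * inverse (z ^ j)) * z ^ j = z ^ p * \<theta>1 (b p j)"
      unfolding mult.assoc z_unit by simp
    ultimately show "\<theta>1 (b p j) * z ^ p = z ^ j * b p j" by (simp only: mult.commute)
  next
    fix p j assume pj: "p < N" "j < N"
    \<comment> \<open>The cyclic predecessor: adding \<open>N - 1\<close> modulo \<open>N\<close>
      undoes adding 1.\<close>
    define pred where "pred = (\<lambda>k. (k + (N - 1)) mod N)"
    have pred: "pred ((k + 1) mod N) = k" if "k < N" for k
    proof -
      have "pred ((k + 1) mod N) = (k + 1 + (N - 1)) mod N" by (simp only: pred_def mod_add_left_eq)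
      also have "\<dots> = k" using that N by simp
      finally show ?thesis .
    qed
    have "\<theta>2 (b p (pred ((j + 1) mod N))) = b ((p + 1) mod N) ((j + 1) mod N)"
    proof (rule cancel[of "\<lambda>k. \<theta>2 (b p (pred k))" "b ((p + 1) mod N)" "(j + 1) mod N"])
      fix q' assume "q' < N"
      then obtain q where q: "q < N" "q' = (q + 1) mod N"
        using bij_mod_add[of 1 N] unfolding bij_betw_def by blast
      have "(\<Sum>k<N. \<theta>2 (b p (pred k)) * a k q') = (\<Sum>k<N. \<theta>2 (b p (pred ((k + 1) mod N))) * a ((k + 1) mod N) q')"
        by (rule sum.reindex_bij_betw[OF bij_mod_add, symmetric])
      also have "\<dots> = (\<Sum>k<N. \<theta>2 (b p k * a k q))"
        using a q pred by (intro sum.cong refl) (simp add: D_def unital_hom_simps[OF hom2])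
      also have "\<dots> = \<theta>2 (if p = q then 1 else 0)"
        using left[OF pj(1) q(1)] by (simp flip: unital_hom_sum[OF hom2])
      also have "\<dots> = (if (p + 1) mod N = q' then 1 else 0)"
        using mod_add_inj[OF pj(1) q(1), of 1] q(2) by (auto simp: unital_hom_simps[OF hom2])
      also have "\<dots> = (\<Sum>k<N. b ((p + 1) mod N) k * a k q')"
        using left[of "(p + 1) mod N" q'] N \<open>q' < N\<close> by simp
      finally show "(\<Sum>k<N. \<theta>2 (b p (pred k)) * a k q') = (\<Sum>k<N. b ((p + 1) mod N) k * a k q')" .
    qed (simp add: N)
    thus "\<theta>2 (b p j) = b ((p + 1) mod N) ((j + 1) mod N)" using pred[OF pj(2)] by simp
  qed
  thus ?thesis using left by blast
qed

sublocale division_blocks N D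
proof (unfold_locales, goal_cases)
  case 1
  show ?case by (rule N)
next
  case (2 a b)
  show ?case by (rule D_cong[OF 2(1)]) (rule 2(2))
next
  case (3 a b)
  thus ?case by (rule D_diff)
next
  case (4 a b)
  thus ?case by (rule D_mult)
next
  case 5
  show ?case by (rule D_one)
next
  case (6 a p q)
  thus ?case by (rule D_inverse)
qed

text \<open>
  A basis of the matrix algebra, and scalars that move its members into \<open>D\<close>. The
  free exponent \<open>e\<close> provides infinitely many of them, as generic specialization requires.
\<close>

definition clock_shift :: "nat \<Rightarrow> nat \<Rightarrow> nat \<Rightarrow> nat \<Rightarrow> 'k" where
  "clock_shift a b p q = (if q = (p + b) mod N then \<zeta> ^ (a * p) else 0)"

definition laurent_mono :: "nat \<Rightarrow> nat \<Rightarrow> nat \<Rightarrow> 'k fls fls" where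
  "laurent_mono a b e = fls_const (fls_X ^ (a + N * e)) * fls_X ^ b"

lemma inj_laurent_mono: "inj (laurent_mono a b)"
proof (rule injI)
  fix e e' assume "laurent_mono a b e = laurent_mono a b e'"
  hence "fls_const (fls_X ^ (a + N * e)) = (fls_const (fls_X ^ (a + N * e')) :: 'k fls fls)"
    by (simp add: laurent_mono_def)
  hence "fls_X ^ (a + N * e) = (fls_X ^ (a + N * e') :: 'k fls)"
    by (simp only: unital_hom_inj[OF unital_hom_fls_const])
  hence "fls_nth (fls_X ^ (a + N * e)) (int (a + N * e)) = fls_nth (fls_X ^ (a + N * e') :: 'k fls) (int (a + N * e))"
    by simp
  hence "int (a + N * e) = int (a + N * e')" by (simp del: of_nat_add of_nat_mult split: if_splits)
  thus "e = e'" using N by simp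
qed

lemma theta1_laurent_mono: "\<theta>1 (laurent_mono a b e) = z ^ b * laurent_mono a b e"
proof -
  have "\<theta>1 fls_X = z * fls_X"
    unfolding \<theta>1_def emb_def by (rule fls_twist_X[OF unital_hom_id const_zeta_nz])
  moreover have "\<theta>1 (fls_const c) = fls_const c" for c
    unfolding \<theta>1_def by (rule fls_twist_const[OF unital_hom_id const_zeta_nz])
  ultimately show ?thesis
    by (simp add: laurent_mono_def unital_hom_simps[OF hom1] unital_hom_power[OF hom1] power_mult_distrib mult_ac)
qed

lemma theta2_laurent_mono: "\<theta>2 (laurent_mono a b e) = z ^ a * laurent_mono a b e"
proof -
  have X: "\<theta>2 fls_X = fls_X"
    unfolding \<theta>2_def by (simp add: fls_twist_X hom_sigma)
  have s: "\<sigma> (fls_X ^ n) = fls_const \<zeta> ^ n * fls_X ^ n" for n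
    unfolding \<sigma>_def
    by (simp add: unital_hom_power[OF unital_hom_fls_twist[OF unital_hom_id zeta_nz]] fls_twist_X
        unital_hom_id zeta_nz power_mult_distrib)
  have c: "\<theta>2 (fls_const (fls_X ^ n)) = z ^ n * fls_const (fls_X ^ n)" for n
  proof -
    have "\<theta>2 (fls_const (fls_X ^ n)) = fls_const (\<sigma> (fls_X ^ n))"
      unfolding \<theta>2_def by (rule fls_twist_const[OF hom_sigma one_neq_zero])
    thus ?thesis
      by (simp only: s emb_def unital_hom_simps(4)[OF unital_hom_fls_const] unital_hom_power[OF unital_hom_fls_const])
  qed
  have "z ^ (a + N * e) = z ^ a" using z_N by (simp add: power_add power_mult)
  thus ?thesis
    by (simp add: laurent_mono_def unital_hom_simps[OF hom2] unital_hom_power[OF hom2] X c mult_ac)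
qed

lemma D_laurent_mono: "D (\<lambda>p q. laurent_mono a b e * emb (clock_shift a b p q))"
  unfolding D_def
proof (intro allI impI conjI)
  fix p q assume pq: "p < N" "q < N"
  show "\<theta>1 (laurent_mono a b e * emb (clock_shift a b p q)) * z ^ p = z ^ q * (laurent_mono a b e * emb (clock_shift a b p q))"
  proof (cases "q = (p + b) mod N")
    case True
    have "z ^ q = z ^ p * z ^ b" using power_mod[OF z_N, of "p + b"] True by (simp add: power_add)
    thus ?thesis by (simp add: unital_hom_simps[OF hom1] theta_emb theta1_laurent_mono mult_ac)
  next
    case False
    thus ?thesis by (simp add: clock_shift_def unital_hom_simps[OF hom1] unital_hom_simps[OF hom_emb])
  qed
  have pos: "(q + 1) mod N = ((p + 1) mod N + b) mod N \<longleftrightarrow> q = (p + b) mod N"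
  proof -
    have "((p + 1) mod N + b) mod N = ((p + b) mod N + 1) mod N" by (simp add: mod_simps ac_simps)
    thus ?thesis using mod_add_inj[of q N "(p + b) mod N" 1] pq(2) N by auto
  qed
  have "\<zeta> ^ (a * ((p + 1) mod N)) = \<zeta> ^ (a * (p + 1))"
  proof -
    have "(\<zeta> ^ a) ^ N = 1" using zeta_N by (metis mult.commute power_mult power_one)
    thus ?thesis unfolding power_mult by (rule power_mod)
  qed
  hence "emb (clock_shift a b ((p + 1) mod N) ((q + 1) mod N)) = z ^ a * emb (clock_shift a b p q)"
    using pos by (simp add: clock_shift_def unital_hom_simps[OF hom_emb] unital_hom_power[OF hom_emb] power_add)
  thus "\<theta>2 (laurent_mono a b e * emb (clock_shift a b p q)) =
      laurent_mono a b e * emb (clock_shift a b ((p + 1) mod N) ((q + 1) mod N))"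
    by (simp add: unital_hom_simps[OF hom2] theta_emb theta2_laurent_mono mult_ac)
qed

text \<open>The positions with \<open>q - p\<close> congruent to \<open>b\<close> modulo
  \<open>N\<close> form a cyclic diagonal, on which the clock matrices restrict to the characters of
  a cyclic group. The coefficients come from Fourier inversion, which divides by
  \<open>N\<close>.\<close>

lemma clock_shift_spans:
  assumes char: "of_nat N \<noteq> (0 :: 'k)"
  obtains c where "\<And>p q. p < N \<Longrightarrow> q < N \<Longrightarrow> V p q = (\<Sum>a<N. \<Sum>b<N. c a b * clock_shift a b p q)"
proof (rule that)
  fix p q assume pq: "p < N" "q < N"
  define c where "c = (\<lambda>a b. (1 / of_nat N) * (\<Sum>p'<N. inverse \<zeta> ^ (a * p') * V p' ((p' + b) mod N)))"
  define b0 where "b0 = (q + N - p) mod N"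
  have b0: "b0 < N" "q = (p + b0) mod N" using pq N by (auto simp: b0_def mod_simps)
  have "(\<Sum>b<N. c a b * clock_shift a b p q) = c a b0 * \<zeta> ^ (a * p)" for a
  proof -
    have "(\<Sum>b<N. c a b * clock_shift a b p q) = (\<Sum>b\<in>{b0}. c a b * clock_shift a b p q)"
    proof (rule sum.mono_neutral_right)
      show "\<forall>b\<in>{..<N} - {b0}. c a b * clock_shift a b p q = 0"
      proof
        fix b assume b: "b \<in> {..<N} - {b0}"
        have "q \<noteq> (p + b) mod N"
        proof
          assume "q = (p + b) mod N"
          hence "(b + p) mod N = (b0 + p) mod N" using b0(2) by (simp add: add.commute)
          from mod_add_inj[OF _ b0(1) this] b show False by simp
        qed
        thus "c a b * clock_shift a b p q = 0" by (simp add: clock_shift_def)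
      qed
    qed (use b0 in auto)
    thus ?thesis using b0 by (simp add: clock_shift_def)
  qed
  hence "(\<Sum>a<N. \<Sum>b<N. c a b * clock_shift a b p q) = (\<Sum>a<N. c a b0 * \<zeta> ^ (a * p))" by simp
  also have "\<dots> = (\<Sum>a<N. \<Sum>p'<N. (1 / of_nat N) * V p' ((p' + b0) mod N) * (inverse \<zeta> ^ p' * \<zeta> ^ p) ^ a)"
    unfolding c_def
    by (simp add: sum_distrib_left sum_distrib_right power_mult_distrib mult_ac flip: power_mult)
  also have "\<dots> = (\<Sum>p'<N. (1 / of_nat N) * V p' ((p' + b0) mod N) * (\<Sum>a<N. (inverse \<zeta> ^ p' * \<zeta> ^ p) ^ a))"
    by (subst sum.swap) (simp add: sum_distrib_left)
  also have "\<dots> = (\<Sum>p'<N. (1 / of_nat N) * V p' ((p' + b0) mod N) * (if p' = p then of_nat N else 0))"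
  proof (rule sum.cong[OF refl])
    fix p' assume p': "p' \<in> {..<N}"
    \<comment> \<open>Orthogonality of characters: the powers of an \<open>N\<close>-th root of
      unity other than 1 sum to zero.\<close>
    have "(\<Sum>a<N. (inverse \<zeta> ^ p' * \<zeta> ^ p) ^ a) = (if p' = p then of_nat N else 0)"
    proof (cases "p' = p")
      case True
      thus ?thesis using zeta_nz by (simp flip: power_mult_distrib)
    next
      case False
      define y where "y = inverse \<zeta> ^ p' * \<zeta> ^ p"
      have "y ^ N = 1"
      proof -
        have "y ^ N = inverse (\<zeta> ^ N) ^ p' * (\<zeta> ^ N) ^ p"
          by (simp add: y_def power_mult_distrib power_inverse mult.commute flip: power_mult)
        thus ?thesis by (simp add: zeta_N)
      qed
      moreover have "y \<noteq> 1"
      proof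
        assume "y = 1"
        hence "\<zeta> ^ p = \<zeta> ^ p'" using zeta_nz by (simp add: y_def power_inverse field_simps)
        with zeta_inj[of p p'] pq(1) p' False show False by simp
      qed
      ultimately show ?thesis using False geometric_sum[of y N] by (simp add: y_def)
    qed
    thus "(1 / of_nat N) * V p' ((p' + b0) mod N) * (\<Sum>a<N. (inverse \<zeta> ^ p' * \<zeta> ^ p) ^ a) =
        (1 / of_nat N) * V p' ((p' + b0) mod N) * (if p' = p then of_nat N else 0)" by simp
  qed
  also have "\<dots> = V p q"
    using char pq b0(2) by (simp add: if_distrib[of "\<lambda>x. _ * x"] cong: if_cong)
  finally show "V p q = (\<Sum>a<N. \<Sum>b<N. (1 / of_nat N) * (\<Sum>p'<N. inverse \<zeta> ^ (a * p') * V p' ((p' + b) mod N)) * clock_shift a b p q)"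
    by (simp add: c_def)
qed

end

section \<open>Maximal ranks of blow-ups\<close>

lemma blow_hom:
  assumes "unital_hom f"
  shows "f (blow M V s t) = blow (\<lambda>x i j. f (M x i j)) (\<lambda>x p q. f (V x p q)) s t"
  by (simp add: blow_def unital_hom_sum[OF assms] unital_hom_simps[OF assms])

lemma sum_triple:
  "(\<Sum>j\<in>A \<times> B \<times> C. f j) = (\<Sum>x\<in>A. \<Sum>y\<in>B. \<Sum>w\<in>C. f (x, y, w))"
  by (simp add: sum.cartesian_product case_prod_beta)

lemma blow_units:
  assumes "p < N" "q < N"
  shows "(\<Sum>j\<in>UNIV \<times> {..<N} \<times> {..<N}. c j * (M (fst j) i i' * (if p = fst (snd j) \<and> q = snd (snd j) then 1 else 0)))
    = blow M (\<lambda>x p q. c (x, p, q)) (i, p) (i', q)"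
proof -
  have "(\<Sum>p'<N. \<Sum>q'<N. c (x, p', q') * (M x i i' * (if p = p' \<and> q = q' then 1 else 0))) = M x i i' * c (x, p, q)" for x
  proof -
    have "c (x, p', q') * (M x i i' * (if p = p' \<and> q = q' then 1 else 0)) =
        (if q = q' then (if p = p' then M x i i' * c (x, p, q) else 0) else 0)" for p' q'
      by auto
    thus ?thesis using assms by simp
  qed
  thus ?thesis by (simp add: blow_def sum_triple)
qed

context root_of_unity
begin

text \<open>The maximal rank \<open>r\<close> is compared with a rank over the series field in both
  directions. A generic point with blocks in \<open>D\<close> has rank at least \<open>r\<close> and
  a multiple of \<open>N\<close>; specializing its entries back to the base field keeps that rank,
  so by maximality it equals \<open>r\<close>.\<close>

theorem max_rank_multiple:
  fixes M :: "'x :: finite \<Rightarrow> 'i \<Rightarrow> 'i \<Rightarrow> 'k"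
  assumes fin: "finite I" and char: "of_nat N \<noteq> (0 :: 'k)" and inf: "infinite (UNIV :: 'k set)"
  obtains h V where "rank_ge (I \<times> {..<N}) (blow M V) (h * N)"
    "\<And>V r. rank_ge (I \<times> {..<N}) (blow M V) r \<Longrightarrow> r \<le> h * N"
proof -
  let ?T = "I \<times> {..<N}"
  have finT: "finite ?T" using fin by simp
  define rs where "rs = {r. \<exists>V. rank_ge ?T (blow M V) r}"
  have "finite rs" by (rule finite_subset[of _ "{..card ?T}"]) (use rank_ge_le_card[OF finT] in \<open>auto simp: rs_def\<close>)
  moreover have "0 \<in> rs" using rank_ge_0 by (auto simp: rs_def)
  ultimately have "Max rs \<in> rs" and rs_le: "\<And>r. r \<in> rs \<Longrightarrow> r \<le> Max rs" using Max_in[of rs] Max_ge[of rs] by blast+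
  define r where "r = Max rs"
  obtain V where V: "rank_ge ?T (blow M V) r" using \<open>Max rs \<in> rs\<close> by (auto simp: rs_def r_def)
  have max: "r' \<le> r" if "rank_ge ?T (blow M V') r'" for V' r' using rs_le that by (auto simp: rs_def r_def)
  define MF where "MF = (\<lambda>x i j. emb (M x i j))"
  define J where "J = (UNIV :: 'x set) \<times> {..<N} \<times> {..<N}"
  have finJ: "finite J" by (simp add: J_def)
  have "\<forall>x. \<exists>c. \<forall>p<N. \<forall>q<N. V x p q = (\<Sum>a<N. \<Sum>b<N. c a b * clock_shift a b p q)"
  proof
    fix x
    show "\<exists>c. \<forall>p<N. \<forall>q<N. V x p q = (\<Sum>a<N. \<Sum>b<N. c a b * clock_shift a b p q)"
    proof (rule clock_shift_spans[OF char, of "V x"])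
      fix c assume "\<And>p q. p < N \<Longrightarrow> q < N \<Longrightarrow> V x p q = (\<Sum>a<N. \<Sum>b<N. c a b * clock_shift a b p q)"
      hence "\<forall>p<N. \<forall>q<N. V x p q = (\<Sum>a<N. \<Sum>b<N. c a b * clock_shift a b p q)" by simp
      thus ?thesis by (rule exI[of _ c])
    qed
  qed
  from choice[OF this] obtain C where C: "\<And>x p q. p < N \<Longrightarrow> q < N \<Longrightarrow>
      V x p q = (\<Sum>a<N. \<Sum>b<N. C x a b * clock_shift a b p q)" by blast
  define B where "B = (\<lambda>(j :: 'x \<times> nat \<times> nat) s t. MF (fst j) (fst s) (fst t) *
      emb (clock_shift (fst (snd j)) (snd (snd j)) (snd s) (snd t)))"
  have sumB: "(\<Sum>j\<in>J. c j * B j s t) =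
      blow MF (\<lambda>x p q. \<Sum>a<N. \<Sum>b<N. c (x, a, b) * emb (clock_shift a b p q)) s t" for c s t
    unfolding J_def sum_triple by (simp add: B_def blow_def sum_distrib_left mult_ac)
  define c0 where "c0 = (\<lambda>j :: 'x \<times> nat \<times> nat. emb (C (fst j) (fst (snd j)) (snd (snd j))))"
  have c0: "rank_ge ?T (\<lambda>s t. \<Sum>j\<in>J. c0 j * B j s t) r"
  proof (rule rank_ge_cong[THEN iffD1, OF _ rank_ge_hom[OF hom_emb V]])
    fix s t assume "s \<in> ?T" "t \<in> ?T"
    hence st: "snd s < N" "snd t < N" by auto
    show "emb (blow M V s t) = (\<Sum>j\<in>J. c0 j * B j s t)"
      unfolding sumB c0_def blow_hom[OF hom_emb] MF_def
      using C[OF st] by (simp add: blow_def unital_hom_sum[OF hom_emb] unital_hom_simps[OF hom_emb])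
  qed
  \<comment> \<open>The coefficients of the clock and shift terms become Laurent monomials, each of
    which moves its term into \<open>D\<close>; there are infinitely many choices per term.\<close>
  have "\<exists>c'. (\<forall>j\<in>J. c' j \<in> range (laurent_mono (fst (snd j)) (snd (snd j)))) \<and>
      rank_ge ?T (\<lambda>s t. \<Sum>j\<in>J. c' j * B j s t) r"
    by (rule rank_ge_generic[OF finJ _ c0]) (rule range_inj_infinite[OF inj_laurent_mono])
  then obtain c' where c': "\<forall>j\<in>J. c' j \<in> range (laurent_mono (fst (snd j)) (snd (snd j)))"
      "rank_ge ?T (\<lambda>s t. \<Sum>j\<in>J. c' j * B j s t) r" by blast
  define Z where "Z = (\<lambda>s t. \<Sum>j\<in>J. c' j * B j s t)"
  have DZ: "D (\<lambda>p q. Z (i, p) (j, q))" for i j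
    unfolding Z_def
  proof (rule D_sum)
    fix k assume "k \<in> J"
    then obtain e where e: "c' k = laurent_mono (fst (snd k)) (snd (snd k)) e" using c'(1) by blast
    have "D (\<lambda>p q. emb (M (fst k) i j) * (laurent_mono (fst (snd k)) (snd (snd k)) e * emb (clock_shift (fst (snd k)) (snd (snd k)) p q)))"
      by (rule D_scale[OF D_laurent_mono])
    thus "D (\<lambda>p q. c' k * B k (i, p) (j, q))" by (simp add: B_def MF_def e mult_ac)
  qed
  show ?thesis
  proof (rule block_rank[OF fin, of Z])
    show "D (\<lambda>p q. Z (i, p) (j, q))" for i j by (rule DZ)
    fix h assume h: "rank_ge ?T Z (h * N)" "\<And>r. rank_ge ?T Z r \<Longrightarrow> r \<le> h * N"
    have rh: "r \<le> h * N" using h(2) c'(2) by (simp add: Z_def)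
    define Y where "Y = (\<lambda>x p q. \<Sum>a<N. \<Sum>b<N. c' (x, a, b) * emb (clock_shift a b p q))"
    \<comment> \<open>The same blow-up expanded in matrix units, so that the free coefficients are
      the entries of the point and may be taken from the base field.\<close>
    define B' where "B' = (\<lambda>(j :: 'x \<times> nat \<times> nat) (s :: 'i \<times> nat) (t :: 'i \<times> nat). MF (fst j) (fst s) (fst t) *
        (if snd s = fst (snd j) \<and> snd t = snd (snd j) then 1 else 0))"
    have sumB': "(\<Sum>j\<in>J. c j * B' j s t) = blow MF (\<lambda>x p q. c (x, p, q)) s t" if st: "s \<in> ?T" "t \<in> ?T" for c s t
    proof -
      obtain i p i' q where "s = (i, p)" "t = (i', q)" "p < N" "q < N" using st by (cases s; cases t) auto
      thus ?thesis unfolding B'_def J_def by (simp add: blow_units)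
    qed
    have c1: "rank_ge ?T (\<lambda>s t. \<Sum>j\<in>J. Y (fst j) (fst (snd j)) (snd (snd j)) * B' j s t) (h * N)"
    proof (rule rank_ge_cong[THEN iffD1, OF _ h(1)])
      fix s t assume st: "s \<in> ?T" "t \<in> ?T"
      show "Z s t = (\<Sum>j\<in>J. Y (fst j) (fst (snd j)) (snd (snd j)) * B' j s t)"
        unfolding sumB'[OF st] Z_def sumB by (simp add: Y_def)
    qed
    have "inj emb" by (rule injI) (simp add: unital_hom_inj[OF hom_emb])
    hence inf_emb: "infinite (range emb)" using inf finite_imageD by blast
    have "\<exists>c''. (\<forall>j\<in>J. c'' j \<in> range emb) \<and> rank_ge ?T (\<lambda>s t. \<Sum>j\<in>J. c'' j * B' j s t) (h * N)"
      by (rule rank_ge_generic[OF finJ inf_emb c1])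
    then obtain c'' where c'': "\<forall>j\<in>J. c'' j \<in> range emb"
        "rank_ge ?T (\<lambda>s t. \<Sum>j\<in>J. c'' j * B' j s t) (h * N)" by blast
    define W where "W = (\<lambda>x p q. SOME y. c'' (x, p, q) = emb y)"
    have W: "c'' (x, p, q) = emb (W x p q)" if "p < N" "q < N" for x p q
    proof -
      have "c'' (x, p, q) \<in> range emb" using c''(1) that by (simp add: J_def)
      hence "\<exists>y. c'' (x, p, q) = emb y" by (simp add: image_iff)
      thus ?thesis unfolding W_def by (rule someI_ex)
    qed
    have "rank_ge ?T (\<lambda>s t. emb (blow M W s t)) (h * N)"
    proof (rule rank_ge_cong[THEN iffD1, OF _ c''(2)])
      fix s t assume st: "s \<in> ?T" "t \<in> ?T"
      have "snd s < N" "snd t < N" using st by auto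
      thus "(\<Sum>j\<in>J. c'' j * B' j s t) = emb (blow M W s t)"
        unfolding sumB'[OF st] blow_hom[OF hom_emb] by (simp add: blow_def MF_def W)
    qed
    hence W_rank: "rank_ge ?T (blow M W) (h * N)" by (rule rank_ge_hom_reflect[OF finT hom_emb])
    hence "r = h * N" using max rh by (simp add: le_antisym)
    thus ?thesis using that[OF W_rank] max by blast
  qed
qed

end

section \<open>One ratio for all sizes\<close>

lemma rank_ge_blow_mult:
  fixes M :: "'x :: finite \<Rightarrow> 'i \<Rightarrow> 'i \<Rightarrow> 'k :: field"
  assumes fin: "finite I" and r: "rank_ge (I \<times> {..<N}) (blow M V) r"
  shows "\<exists>V'. rank_ge (I \<times> {..<a * N + b}) (blow M V') (a * r)"
proof (induction a)
  case 0
  show ?case by (simp add: rank_ge_0)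
next
  case (Suc a)
  then obtain V' where "rank_ge (I \<times> {..<a * N + b}) (blow M V') (a * r)" by blast
  from rank_ge_tri[OF fin r this, of V] show ?case by (auto simp: add.assoc)
qed

text \<open>The ratios at the sizes \<open>l ^ m\<close> are integers bounded by
  \<open>card I\<close>, so a largest one \<open>h\<close> exists. A point of any size
  \<open>N\<close> with rank above \<open>h * N\<close> would, repeated along the diagonal in a
  large size \<open>l ^ m\<close>, exceed the bound there: the surplus grows with the number of
  copies, the loss from the remainder does not.\<close>

lemma max_rank_ratio:
  fixes M :: "'x :: finite \<Rightarrow> 'i \<Rightarrow> 'i \<Rightarrow> 'k :: field"
  assumes fin: "finite I" and l: "l \<ge> 2"
    and mult: "\<And>m. \<exists>h V. rank_ge (I \<times> {..<l ^ m}) (blow M V) (h * l ^ m) \<and>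
      (\<forall>V r. rank_ge (I \<times> {..<l ^ m}) (blow M V) r \<longrightarrow> r \<le> h * l ^ m)"
  obtains h N V where "N > 0" "rank_ge (I \<times> {..<N}) (blow M V) (h * N)"
    "\<And>N V r. rank_ge (I \<times> {..<N}) (blow M V) r \<Longrightarrow> r \<le> h * N"
proof -
  obtain H where H: "\<And>m. \<exists>V. rank_ge (I \<times> {..<l ^ m}) (blow M V) (H m * l ^ m)"
    "\<And>m V r. rank_ge (I \<times> {..<l ^ m}) (blow M V) r \<Longrightarrow> r \<le> H m * l ^ m"
    using choice[of "\<lambda>m h. (\<exists>V. rank_ge (I \<times> {..<l ^ m}) (blow M V) (h * l ^ m)) \<and>
      (\<forall>V r. rank_ge (I \<times> {..<l ^ m}) (blow M V) r \<longrightarrow> r \<le> h * l ^ m)"] mult by blast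
  have H_le: "H m \<le> card I" for m
  proof -
    obtain V where "rank_ge (I \<times> {..<l ^ m}) (blow M V) (H m * l ^ m)" using H(1) by blast
    hence "H m * l ^ m \<le> card (I \<times> {..<l ^ m})" by (rule rank_ge_le_card[rotated]) (simp add: fin)
    thus ?thesis using l by (simp add: card_cartesian_product)
  qed
  have "finite (range H)" by (rule finite_subset[of _ "{..card I}"]) (use H_le in auto)
  hence "Max (range H) \<in> range H" and Hmax: "\<And>m. H m \<le> Max (range H)" by simp_all
  then obtain m0 where m0: "H m0 = Max (range H)" by (metis (no_types, lifting) imageE)
  define h where "h = H m0"
  obtain V where V: "rank_ge (I \<times> {..<l ^ m0}) (blow M V) (h * l ^ m0)" using H(1) by (auto simp: h_def)
  have bound: "r \<le> h * N" if r: "rank_ge (I \<times> {..<N}) (blow M V) r" for N V r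
  proof (rule ccontr)
    assume "\<not> ?thesis"
    hence r1: "r \<ge> h * N + 1" by simp
    have N: "N > 0"
    proof (rule ccontr)
      assume "\<not> N > 0"
      hence "r \<le> card (I \<times> {..<N})" using rank_ge_le_card[OF _ r] fin by simp
      thus False using \<open>\<not> N > 0\<close> r1 by simp
    qed
    \<comment> \<open>Large enough that the quotient \<open>a\<close> of \<open>l ^ m\<close> by
      \<open>N\<close> is at least \<open>h * N + 1\<close>, beating the loss \<open>h * b\<close>
      of the remainder.\<close>
    define m where "m = (h * N + 1) * N"
    have "m < 2 ^ m" by (rule less_exp)
    also have "(2 :: nat) ^ m \<le> l ^ m" using l by (rule power_mono) simp
    finally have big: "m \<le> l ^ m" by simp
    define a where "a = l ^ m div N"
    define b where "b = l ^ m mod N"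
    have ab: "l ^ m = a * N + b" "b < N" using N by (simp_all add: a_def b_def)
    have a: "a \<ge> h * N + 1" unfolding a_def using div_le_mono[OF big, of N] N by (simp add: m_def)
    obtain V' where "rank_ge (I \<times> {..<l ^ m}) (blow M V') (a * r)"
      using rank_ge_blow_mult[OF fin r, of a b] ab(1) by auto
    hence "a * r \<le> H m * l ^ m" by (rule H(2))
    also have "\<dots> \<le> h * (a * N + b)" unfolding ab(1)[symmetric] using Hmax[of m] m0 by (simp add: h_def)
    finally have "a * r \<le> h * a * N + h * b" by (simp add: algebra_simps)
    moreover have "a * (h * N + 1) \<le> a * r" using r1 by (rule mult_le_mono2)
    ultimately have "a \<le> h * b" by (simp add: algebra_simps)
    moreover have "h * b \<le> h * N" using ab(2) by simp
    ultimately show False using a by simp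
  qed
  show ?thesis by (rule that[of "l ^ m0" V h]) (use V bound l in auto)
qed

section \<open>Roots of unity of prime power order\<close>

lemma root_of_unity_prime_power:
  fixes \<omega> :: "'k :: alg_closed_field"
  assumes l: "Factorial_Ring.prime l" and omega: "\<omega> ^ l = 1" "\<omega> \<noteq> 1"
  shows "\<exists>\<zeta> :: 'k. root_of_unity (l ^ m) \<zeta>"
proof (cases m)
  case 0
  have "root_of_unity (l ^ m) (1 :: 'k)" by unfold_locales (simp_all add: 0)
  thus ?thesis by blast
next
  case (Suc k)
  have l0: "l > 0" using l by (rule prime_gt_0_nat)
  obtain \<zeta> where zeta: "\<zeta> ^ (l ^ k) = \<omega>" using nth_root_exists[of "l ^ k" \<omega>] l0 by auto
  have zN: "\<zeta> ^ (l ^ m) = 1"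
    using omega(1) by (simp add: Suc power_mult mult.commute[of l] zeta)
  have z0: "\<zeta> \<noteq> 0" using zN l0 by (metis power_0_left zero_neq_one zero_less_power less_numeral_extra(3))
  have no: "\<zeta> ^ d \<noteq> 1" if d: "0 < d" "d < l ^ m" for d
  proof
    assume zd: "\<zeta> ^ d = 1"
    \<comment> \<open>By Bezout, the power of \<zeta> with exponent \<open>gcd d (l ^ m)\<close> is
      1. This exponent is \<open>l ^ i\<close> with \<open>i \<le> k\<close>, so the
      \<open>l ^ k\<close>-th power of \<zeta>, which is \<omega>, would be 1.\<close>
    obtain u v where uv: "d * u = l ^ m * v + gcd d (l ^ m)" using bezout_nat[of d "l ^ m"] d by auto
    have "\<zeta> ^ (d * u) = \<zeta> ^ (l ^ m * v) * \<zeta> ^ gcd d (l ^ m)" by (simp add: uv power_add)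
    hence zg: "\<zeta> ^ gcd d (l ^ m) = 1" by (simp add: power_mult zd zN)
    obtain i where i: "i \<le> m" "gcd d (l ^ m) = l ^ i"
      using divides_primepow_nat[OF l, of "gcd d (l ^ m)" m] by auto
    have "i \<noteq> m" using i(2) d gcd_le1_nat[of d "l ^ m"] by auto
    hence "i \<le> k" using i(1) Suc by simp
    hence "l ^ k = l ^ i * l ^ (k - i)" by (simp flip: power_add)
    hence "\<omega> = (\<zeta> ^ (l ^ i)) ^ (l ^ (k - i))" using zeta by (simp add: power_mult)
    thus False using zg i(2) omega(2) by simp
  qed
  have inj: "p = q" if "p < l ^ m" "q < l ^ m" "\<zeta> ^ p = \<zeta> ^ q" for p q
  proof -
    have aux: "\<not> p < q" if "q < l ^ m" "\<zeta> ^ p = \<zeta> ^ q" for p q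
    proof
      assume "p < q"
      hence "\<zeta> ^ q = \<zeta> ^ p * \<zeta> ^ (q - p)" by (simp flip: power_add)
      hence "\<zeta> ^ (q - p) = 1" using that(2) z0 by simp
      thus False using no[of "q - p"] that(1) \<open>p < q\<close> by simp
    qed
    show ?thesis using aux[of q p] aux[of p q] that by simp
  qed
  have "root_of_unity (l ^ m) \<zeta>" by unfold_locales (use l0 zN inj in auto)
  thus ?thesis by blast
qed

text \<open>The prime must be nonzero in the field. Outside characteristic 2 it is 2, starting from
  -1; in characteristic 2 it is 3, starting from a root of the third cyclotomic polynomial.\<close>

lemma ex_roots_of_unity:
  obtains l where "l \<ge> 2" "\<And>m. \<exists>\<zeta> :: 'k :: alg_closed_field. root_of_unity (l ^ m) \<zeta>"
    "\<And>m. of_nat (l ^ m) \<noteq> (0 :: 'k)"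
proof (cases "(2 :: 'k) = 0")
  case False
  have "(-1 :: 'k) \<noteq> 1"
  proof
    assume "(-1 :: 'k) = 1"
    hence "(1 :: 'k) + 1 = 0" by (metis add.right_inverse)
    thus False using False by simp
  qed
  hence "\<exists>\<zeta> :: 'k. root_of_unity (2 ^ m) \<zeta>" for m
    by (intro root_of_unity_prime_power[of 2 "-1"]) (auto simp: two_is_prime_nat)
  thus ?thesis using False by (intro that[of 2]) auto
next
  case True
  have three: "(3 :: 'k) = 1"
  proof -
    have "(3 :: 'k) = 2 + 1" by simp
    thus ?thesis by (simp only: True add_0)
  qed
  obtain \<omega> :: 'k where "poly [:1, 1, 1:] \<omega> = 0" using alg_closed_imp_poly_has_root[of "[:1, 1, 1 :: 'k:]"] by auto
  hence w: "\<omega> * \<omega> + \<omega> + 1 = 0" by (simp add: algebra_simps)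
  have "\<omega> ^ 3 - 1 = (\<omega> - 1) * (\<omega> * \<omega> + \<omega> + 1)" by (simp add: algebra_simps power3_eq_cube)
  hence "\<omega> ^ 3 = 1" using w by simp
  moreover have "\<omega> \<noteq> 1"
  proof
    assume "\<omega> = 1"
    hence "(3 :: 'k) = 0" using w by simp
    thus False using three by simp
  qed
  ultimately have "\<exists>\<zeta> :: 'k. root_of_unity (3 ^ m) \<zeta>" for m
    by (intro root_of_unity_prime_power[of 3 \<omega>]) auto
  thus ?thesis using three by (intro that[of 3]) auto
qed

lemma infinite_alg_closed: "infinite (UNIV :: 'k :: alg_closed_field set)"
proof
  assume fin: "finite (UNIV :: 'k set)"
  define p where "p = (\<Prod>a\<in>(UNIV :: 'k set). [:-a, 1:]) + 1"
  have p1: "poly p x = 1" for x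
  proof -
    have "(\<Prod>a\<in>(UNIV :: 'k set). x - a) = 0" using fin by (intro prod_zero) (auto intro: bexI[of _ x])
    thus ?thesis by (simp add: p_def poly_prod)
  qed
  have "Polynomial.degree (\<Prod>a\<in>(UNIV :: 'k set). [:-a, 1:]) = card (UNIV :: 'k set)"
    by (subst degree_prod_eq_sum_degree) auto
  moreover have "card (UNIV :: 'k set) > 0" using fin by (simp add: card_gt_0_iff)
  ultimately have "Polynomial.degree p > 0" unfolding p_def by (simp add: degree_add_eq_left)
  from alg_closed_imp_poly_has_root[OF this] p1 show False by simp
qed

theorem max_rank_ratio_alg_closed:
  fixes M :: "'x :: finite \<Rightarrow> 'i \<Rightarrow> 'i \<Rightarrow> 'k :: alg_closed_field"
  assumes fin: "finite I"
  obtains h N V where "N > 0" "rank_ge (I \<times> {..<N}) (blow M V) (h * N)"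
    "\<And>N V r. rank_ge (I \<times> {..<N}) (blow M V) r \<Longrightarrow> r \<le> h * N"
proof (rule ex_roots_of_unity[where 'k = 'k])
  fix l assume l: "l \<ge> 2" "\<And>m. \<exists>\<zeta> :: 'k. root_of_unity (l ^ m) \<zeta>"
    "\<And>m. of_nat (l ^ m) \<noteq> (0 :: 'k)"
  have "\<exists>h V. rank_ge (I \<times> {..<l ^ m}) (blow M V) (h * l ^ m) \<and>
      (\<forall>V r. rank_ge (I \<times> {..<l ^ m}) (blow M V) r \<longrightarrow> r \<le> h * l ^ m)" for m
  proof -
    obtain \<zeta> :: 'k where z: "root_of_unity (l ^ m) \<zeta>" using l(2) by blast
    show ?thesis by (rule root_of_unity.max_rank_multiple[OF z fin l(3) infinite_alg_closed]) blast
  qed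
  thus thesis by (rule max_rank_ratio[OF fin l(1)]) (rule that)
qed

section \<open>Descent from the algebraic closure\<close>

lemma unital_hom_to_ac: "unital_hom (to_ac :: 'k :: field \<Rightarrow> 'k alg_closure)"
  by (simp add: unital_hom_def)

interpretation ac: vector_space "\<lambda>(c :: 'k :: field) x. to_ac c * x"
  by unfold_locales (simp_all add: algebra_simps)

lemma ac_span_mult:
  fixes S T :: "'k :: field alg_closure set"
  assumes "\<And>s. s \<in> S \<Longrightarrow> z * s \<in> ac.span T" and x: "x \<in> ac.span S"
  shows "z * x \<in> ac.span T"
  using x
proof (induction rule: ac.span_induct_alt)
  case base
  show ?case by (simp add: ac.span_zero)
next
  case (step c x y)
  have "z * (to_ac c * x + y) = to_ac c * (z * x) + z * y" by (simp add: algebra_simps)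
  thus ?case using step assms(1) ac.span_add ac.span_scale by metis
qed

text \<open>Algebraic elements are adjoined one at a time: the products of \<open>S\<close> with the
  powers of \<open>z\<close> below the degree of a polynomial killing \<open>z\<close> span a space
  stable under \<open>z\<close>, and by commutativity under the earlier elements too. The nonzero
  member keeps the space from being trivial.\<close>

lemma finite_stable_set:
  fixes A :: "'k :: field alg_closure set"
  assumes "finite A"
  shows "\<exists>S. finite S \<and> (\<exists>s\<in>S. s \<noteq> 0) \<and> (\<forall>z\<in>A. \<forall>s\<in>S. z * s \<in> ac.span S)"
  using assms
proof (induction A rule: finite_induct)
  case empty
  show ?case by (intro exI[of _ "{1}"]) simp
next
  case (insert z A)
  then obtain S where S: "finite S" "\<exists>s\<in>S. s \<noteq> 0" "\<forall>z\<in>A. \<forall>s\<in>S. z * s \<in> ac.span S" by blast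
  obtain p :: "'k poly" where p: "p \<noteq> 0" "poly (map_poly to_ac p) z = 0" by (rule alg_closure_algebraic)
  define d where "d = Polynomial.degree p"
  define c where "c = (\<lambda>i. to_ac (Polynomial.coeff p i))"
  have cd: "Polynomial.coeff p d \<noteq> 0" using p(1) by (simp add: d_def)
  have "poly (map_poly to_ac p) z = (\<Sum>i\<le>Polynomial.degree (map_poly to_ac p). Polynomial.coeff (map_poly to_ac p) i * z ^ i)"
    by (rule poly_altdef)
  also have "Polynomial.degree (map_poly to_ac p) = d" unfolding d_def by (rule degree_map_poly) simp
  also have "(\<Sum>i\<le>d. Polynomial.coeff (map_poly to_ac p) i * z ^ i) = (\<Sum>i\<le>d. c i * z ^ i)"
    by (simp add: c_def coeff_map_poly)
  finally have root: "(\<Sum>i\<le>d. c i * z ^ i) = 0" using p(2) by simp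
  have d0: "d > 0"
  proof (rule ccontr)
    assume "\<not> d > 0"
    thus False using root cd by (simp add: c_def)
  qed
  define S' where "S' = (\<lambda>(i, s). z ^ i * s) ` ({..<d} \<times> S)"
  have S'I: "z ^ i * s \<in> S'" if "i < d" "s \<in> S" for i s using that by (force simp: S'_def)
  have zd: "z ^ d * s \<in> ac.span S'" if s: "s \<in> S" for s
  proof -
    have "c d * z ^ d = - (\<Sum>i<d. c i * z ^ i)"
      using root by (simp add: lessThan_Suc_atMost[symmetric] eq_neg_iff_add_eq_0 add.commute)
    hence "z ^ d = - inverse (c d) * (\<Sum>i<d. c i * z ^ i)"
      using cd by (simp add: c_def field_simps)
    also have "\<dots> = (\<Sum>i<d. to_ac (- inverse (Polynomial.coeff p d) * Polynomial.coeff p i) * z ^ i)"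
      by (simp add: c_def sum_distrib_left sum_negf mult.assoc)
    finally have "z ^ d * s = (\<Sum>i<d. to_ac (- inverse (Polynomial.coeff p d) * Polynomial.coeff p i) * (z ^ i * s))"
      by (simp add: sum_distrib_right mult.assoc)
    thus ?thesis by (simp only:) (intro ac.span_sum ac.span_scale ac.span_base, use S'I s in simp)
  qed
  have "\<forall>y\<in>insert z A. \<forall>x\<in>S'. y * x \<in> ac.span S'"
  proof (intro ballI)
    fix y x assume y: "y \<in> insert z A" and x: "x \<in> S'"
    obtain i s where xs: "i < d" "s \<in> S" "x = z ^ i * s" using x by (auto simp: S'_def)
    show "y * x \<in> ac.span S'"
    proof (cases "y = z")
      case True
      hence yx: "y * x = z ^ Suc i * s" using xs(3) by (simp add: mult.assoc)
      show ?thesis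
      proof (cases "Suc i < d")
        case True
        thus ?thesis unfolding yx by (intro ac.span_base S'I xs(2))
      next
        case False
        hence "Suc i = d" using xs(1) by simp
        thus ?thesis unfolding yx using zd[OF xs(2)] by simp
      qed
    next
      case False
      hence "y * s \<in> ac.span S" using y S(3) xs(2) by blast
      hence "z ^ i * (y * s) \<in> ac.span S'"
        by (rule ac_span_mult[rotated]) (intro ac.span_base S'I xs(1))
      moreover have "z ^ i * (y * s) = y * x" unfolding xs(3) by (rule mult.left_commute)
      ultimately show ?thesis by simp
    qed
  qed
  moreover have "finite S'" using S(1) by (simp add: S'_def)
  moreover have "\<exists>s\<in>S'. s \<noteq> 0" using S(2) S'I[OF d0] by fastforce
  ultimately show ?case by blast
qed

text \<open>A unital homomorphism into matrices of size \<open>e\<close> over the base field,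
  required on a subring \<open>R\<close> only: multiplication by an element is a finite matrix just
  when it preserves the chosen finite-dimensional space.\<close>

definition matrix_rep :: "'k :: field alg_closure set \<Rightarrow> nat \<Rightarrow> ('k alg_closure \<Rightarrow> nat \<Rightarrow> nat \<Rightarrow> 'k) \<Rightarrow> bool" where
  "matrix_rep R e \<rho> \<longleftrightarrow>
     (\<forall>c. to_ac c \<in> R) \<and>
     (\<forall>z\<in>R. \<forall>w\<in>R. z + w \<in> R \<and> z * w \<in> R) \<and>
     (\<forall>c. \<forall>\<kappa><e. \<forall>\<mu><e. \<rho> (to_ac c) \<kappa> \<mu> = (if \<kappa> = \<mu> then c else 0)) \<and>
     (\<forall>z\<in>R. \<forall>w\<in>R. \<forall>\<kappa><e. \<forall>\<mu><e. \<rho> (z + w) \<kappa> \<mu> = \<rho> z \<kappa> \<mu> + \<rho> w \<kappa> \<mu>) \<and>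
     (\<forall>z\<in>R. \<forall>w\<in>R. \<forall>\<kappa><e. \<forall>\<mu><e. \<rho> (z * w) \<kappa> \<mu> = (\<Sum>\<nu><e. \<rho> z \<kappa> \<nu> * \<rho> w \<nu> \<mu>))"

text \<open>\<open>R\<close> is the set of multipliers preserving the span of a finite stable set,
  and \<open>\<rho>\<close> gives the matrix of such a multiplication in a basis of that
  span.\<close>

lemma regular_representation:
  fixes A :: "'k :: field alg_closure set"
  assumes "finite A"
  shows "\<exists>e>0. \<exists>\<rho> R. A \<subseteq> R \<and> matrix_rep R e \<rho>"
proof -
  obtain S where S: "finite S" "\<exists>s\<in>S. s \<noteq> 0" "\<forall>z\<in>A. \<forall>s\<in>S. z * s \<in> ac.span S"
    using finite_stable_set[OF assms] by blast
  obtain B where B: "B \<subseteq> S" "ac.independent B" "S \<subseteq> ac.span B"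
    using ac.maximal_independent_subset[of S] by blast
  have spanB: "ac.span B = ac.span S" 
    by (rule subset_antisym[OF ac.span_mono[OF B(1)] ac.span_minimal[OF B(3) ac.subspace_span]])
  have finB: "finite B" using B(1) S(1) by (rule finite_subset)
  define e where "e = card B"
  have "B \<noteq> {}" using S(2) B(3) by auto
  hence e0: "e > 0" using finB by (simp add: e_def card_gt_0_iff)
  obtain \<beta> where beta: "bij_betw \<beta> {..<e} B"
    using ex_bij_betw_nat_finite[OF finB] by (auto simp: e_def atLeast0LessThan)
  define \<rho> where "\<rho> = (\<lambda>z \<kappa> \<mu>. ac.representation B (z * \<beta> \<mu>) (\<beta> \<kappa>))"
  define R where "R = {z. \<forall>x\<in>ac.span B. z * x \<in> ac.span B}"
  have betaB: "\<beta> \<mu> \<in> B" if "\<mu> < e" for \<mu> using beta that by (auto simp: bij_betw_def)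
  have beta_inj: "\<beta> \<mu> = \<beta> \<kappa> \<longleftrightarrow> \<mu> = \<kappa>" if "\<mu> < e" "\<kappa> < e" for \<mu> \<kappa>
    using beta that by (auto simp: bij_betw_def inj_on_def)
  have beta_span: "\<beta> \<mu> \<in> ac.span B" if "\<mu> < e" for \<mu> using betaB[OF that] by (rule ac.span_base)
  have rep: "(\<Sum>\<kappa><e. to_ac (ac.representation B x (\<beta> \<kappa>)) * \<beta> \<kappa>) = x" if x: "x \<in> ac.span B" for x
  proof -
    have "(\<Sum>\<kappa><e. to_ac (ac.representation B x (\<beta> \<kappa>)) * \<beta> \<kappa>) = (\<Sum>b\<in>B. to_ac (ac.representation B x b) * b)"
      by (rule sum.reindex_bij_betw[OF beta])
    also have "\<dots> = x" by (rule ac.sum_representation_eq[OF B(2) x finB]) simp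
    finally show ?thesis .
  qed
  have "A \<subseteq> R"
  proof
    fix z assume "z \<in> A"
    hence "z * x \<in> ac.span S" if "x \<in> ac.span S" for x using S(3) that by (intro ac_span_mult[OF _ that]) blast
    thus "z \<in> R" by (simp add: R_def spanB)
  qed
  moreover have "to_ac c \<in> R" for c by (simp add: R_def ac.span_scale)
  moreover have "z + w \<in> R \<and> z * w \<in> R" if "z \<in> R" "w \<in> R" for z w
    using that by (simp add: R_def distrib_right mult.assoc ac.span_add)
  moreover have "\<rho> (to_ac c) \<kappa> \<mu> = (if \<kappa> = \<mu> then c else 0)" if "\<kappa> < e" "\<mu> < e" for c \<kappa> \<mu>
    using that beta_inj[OF that]
    by (simp add: \<rho>_def ac.representation_scale[OF B(2) beta_span] ac.representation_basis[OF B(2) betaB] eq_commute)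
  moreover have "\<rho> (z + w) \<kappa> \<mu> = \<rho> z \<kappa> \<mu> + \<rho> w \<kappa> \<mu>" if "z \<in> R" "w \<in> R" "\<kappa> < e" "\<mu> < e" for z w \<kappa> \<mu>
  proof -
    have "z * \<beta> \<mu> \<in> ac.span B" "w * \<beta> \<mu> \<in> ac.span B" using that beta_span by (auto simp: R_def)
    thus ?thesis by (simp add: \<rho>_def distrib_right ac.representation_add[OF B(2)])
  qed
  moreover have "\<rho> (z * w) \<kappa> \<mu> = (\<Sum>\<nu><e. \<rho> z \<kappa> \<nu> * \<rho> w \<nu> \<mu>)" if zw: "z \<in> R" "w \<in> R" "\<kappa> < e" "\<mu> < e" for z w \<kappa> \<mu>
  proof -
    have w: "w * \<beta> \<mu> \<in> ac.span B" using zw beta_span by (auto simp: R_def)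
    have zb: "z * \<beta> \<nu> \<in> ac.span B" if "\<nu> < e" for \<nu> using zw(1) beta_span[OF that] by (auto simp: R_def)
    have "z * w * \<beta> \<mu> = z * (\<Sum>\<nu><e. to_ac (\<rho> w \<nu> \<mu>) * \<beta> \<nu>)"
      using rep[OF w] by (simp add: \<rho>_def mult.assoc)
    also have "\<dots> = (\<Sum>\<nu><e. to_ac (\<rho> w \<nu> \<mu>) * (z * \<beta> \<nu>))" by (simp add: sum_distrib_left mult_ac)
    finally have "\<rho> (z * w) \<kappa> \<mu> = ac.representation B (\<Sum>\<nu><e. to_ac (\<rho> w \<nu> \<mu>) * (z * \<beta> \<nu>)) (\<beta> \<kappa>)"
      by (simp add: \<rho>_def)
    also have "\<dots> = (\<Sum>\<nu><e. ac.representation B (to_ac (\<rho> w \<nu> \<mu>) * (z * \<beta> \<nu>)) (\<beta> \<kappa>))"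
      by (subst ac.representation_sum[OF B(2)]) (use zb ac.span_scale in auto)
    also have "\<dots> = (\<Sum>\<nu><e. \<rho> w \<nu> \<mu> * \<rho> z \<kappa> \<nu>)"
      by (intro sum.cong refl) (simp add: ac.representation_scale[OF B(2) zb] \<rho>_def)
    finally show ?thesis by (simp add: mult.commute)
  qed
  ultimately have "A \<subseteq> R \<and> matrix_rep R e \<rho>" unfolding matrix_rep_def by blast
  thus ?thesis using e0 by blast
qed

lemma matrix_repD:
  assumes "matrix_rep R e \<rho>"
  shows "to_ac c \<in> R"
    "z \<in> R \<Longrightarrow> w \<in> R \<Longrightarrow> z + w \<in> R"
    "z \<in> R \<Longrightarrow> w \<in> R \<Longrightarrow> z * w \<in> R"
    "\<kappa> < e \<Longrightarrow> \<mu> < e \<Longrightarrow> \<rho> (to_ac c) \<kappa> \<mu> = (if \<kappa> = \<mu> then c else 0)"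
    "z \<in> R \<Longrightarrow> w \<in> R \<Longrightarrow> \<kappa> < e \<Longrightarrow> \<mu> < e \<Longrightarrow> \<rho> (z + w) \<kappa> \<mu> = \<rho> z \<kappa> \<mu> + \<rho> w \<kappa> \<mu>"
    "z \<in> R \<Longrightarrow> w \<in> R \<Longrightarrow> \<kappa> < e \<Longrightarrow> \<mu> < e \<Longrightarrow> \<rho> (z * w) \<kappa> \<mu> = (\<Sum>\<nu><e. \<rho> z \<kappa> \<nu> * \<rho> w \<nu> \<mu>)"
  using assms unfolding matrix_rep_def by blast+

lemma matrix_rep_sum:
  assumes rho: "matrix_rep R e \<rho>" and f: "\<And>j. j \<in> J \<Longrightarrow> f j \<in> R"
  shows "(\<Sum>j\<in>J. f j) \<in> R"
    and "\<kappa> < e \<Longrightarrow> \<mu> < e \<Longrightarrow> \<rho> (\<Sum>j\<in>J. f j) \<kappa> \<mu> = (\<Sum>j\<in>J. \<rho> (f j) \<kappa> \<mu>)"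
proof -
  have zero: "0 \<in> R" "\<kappa> < e \<Longrightarrow> \<mu> < e \<Longrightarrow> \<rho> 0 \<kappa> \<mu> = 0" for \<kappa> \<mu>
    using matrix_repD(1)[OF rho, of 0] matrix_repD(4)[OF rho, of \<kappa> \<mu> 0] by auto
  have "(\<Sum>j\<in>J. f j) \<in> R \<and> (\<kappa> < e \<longrightarrow> \<mu> < e \<longrightarrow> \<rho> (\<Sum>j\<in>J. f j) \<kappa> \<mu> = (\<Sum>j\<in>J. \<rho> (f j) \<kappa> \<mu>))"
    using f
  proof (induction J rule: infinite_finite_induct)
    case (insert j J)
    hence "f j \<in> R" "(\<Sum>j\<in>J. f j) \<in> R"
      "\<kappa> < e \<longrightarrow> \<mu> < e \<longrightarrow> \<rho> (\<Sum>j\<in>J. f j) \<kappa> \<mu> = (\<Sum>j\<in>J. \<rho> (f j) \<kappa> \<mu>)" by auto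
    thus ?case using insert.hyps by (simp add: matrix_repD(2,5)[OF rho])
  qed (simp_all add: zero)
  thus "(\<Sum>j\<in>J. f j) \<in> R"
    and "\<kappa> < e \<Longrightarrow> \<mu> < e \<Longrightarrow> \<rho> (\<Sum>j\<in>J. f j) \<kappa> \<mu> = (\<Sum>j\<in>J. \<rho> (f j) \<kappa> \<mu>)" by blast+
qed

lemma sum_split_blocks:
  fixes F :: "'i \<times> nat \<Rightarrow> 'a :: comm_monoid_add"
  shows "(\<Sum>u\<in>I \<times> {..<N * e}. F u) = (\<Sum>s\<in>I \<times> {..<N}. \<Sum>\<kappa><e. F (fst s, snd s * e + \<kappa>))"
proof -
  have "(\<Sum>p'<N * e. f p') = (\<Sum>p<N. \<Sum>\<kappa><e. f (p * e + \<kappa>))" for f :: "nat \<Rightarrow> 'a"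
  proof -
    have "(\<Sum>p'<N * e. f p') = (\<Sum>p<N. sum f {p * e..<p * e + e})" by (rule sum.nat_group[symmetric])
    also have "\<dots> = (\<Sum>p<N. \<Sum>\<kappa><e. f (p * e + \<kappa>))"
    proof (rule sum.cong[OF refl])
      fix p
      show "sum f {p * e..<p * e + e} = (\<Sum>\<kappa><e. f (p * e + \<kappa>))"
        using sum.shift_bounds_nat_ivl[of f 0 "p * e" e]
        unfolding atLeast0LessThan add_0 by (simp only: add.commute)
    qed
    finally show ?thesis .
  qed
  hence "(\<Sum>i\<in>I. \<Sum>p'<N * e. F (i, p')) = (\<Sum>i\<in>I. \<Sum>p<N. \<Sum>\<kappa><e. F (i, p * e + \<kappa>))" by simp
  moreover have "(\<Sum>s\<in>I \<times> B. g s) = (\<Sum>i\<in>I. \<Sum>p\<in>B. g (i, p))" for B :: "nat set" and g :: "'i \<times> nat \<Rightarrow> 'a"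
    by (simp add: sum.cartesian_product)
  ultimately show ?thesis by (simp only: fst_conv snd_conv)
qed

text \<open>The entries of the point and of the dual families are replaced by their
  \<open>e \<times> e\<close> matrices over the base field. Coefficients of \<open>M\<close> become
  scalar matrices, so the result is a blow-up of \<open>M\<close> again, and each dual pair turns
  into \<open>e\<close> pairs.\<close>

lemma rank_descent:
  fixes M :: "'x :: finite \<Rightarrow> 'i \<Rightarrow> 'i \<Rightarrow> 'k :: field"
  assumes fin: "finite I" and r: "rank_ge (I \<times> {..<N}) (blow (\<lambda>x i j. to_ac (M x i j)) V) r"
  obtains e V' where "e > 0" "rank_ge (I \<times> {..<N * e}) (blow M V') (r * e)"
proof -
  let ?T = "I \<times> {..<N}" and ?M = "\<lambda>x i j. to_ac (M x i j)"
  obtain P Q where PQ: "\<forall>a<r. \<forall>b<r. bil ?T (blow ?M V) (P a) (Q b) = (if a = b then 1 else 0)"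
    using r unfolding rank_ge_def by blast
  \<comment> \<open>The finitely many elements of the closure that occur in the rank
    statement.\<close>
  define A where "A = (\<lambda>(a, s). P a s) ` ({..<r} \<times> ?T) \<union> (\<lambda>(a, s). Q a s) ` ({..<r} \<times> ?T) \<union>
      (\<lambda>(x, p, q). V x p q) ` (UNIV \<times> {..<N} \<times> {..<N})"
  have "finite A" using fin by (simp add: A_def)
  from regular_representation[OF this] obtain e \<rho> R
    where e: "e > 0" and AR: "A \<subseteq> R" and rho: "matrix_rep R e \<rho>"
    by (elim exE conjE)
  have PR: "P a s \<in> R" and QR: "Q a s \<in> R" if "a < r" "s \<in> ?T" for a s
  proof -
    have "P a s \<in> A" "Q a s \<in> A"
      unfolding A_def using that by (auto intro!: image_eqI[where x = "(a, s)"])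
    thus "P a s \<in> R" "Q a s \<in> R" using AR by auto
  qed
  have VR: "V x p q \<in> R" if "p < N" "q < N" for x p q
  proof -
    have "V x p q \<in> A" unfolding A_def using that by (auto intro!: image_eqI[where x = "(x, p, q)"])
    thus ?thesis using AR by auto
  qed
  define V' where "V' = (\<lambda>x p q. \<rho> (V x (p div e) (q div e)) (p mod e) (q mod e))"
  define P' where "P' = (\<lambda>(a, \<kappa>) (i, p). \<rho> (P a (i, p div e)) \<kappa> (p mod e))"
  define Q' where "Q' = (\<lambda>(b, \<mu>) (j, q). \<rho> (Q b (j, q div e)) (q mod e) \<mu>)"
  have BR: "blow ?M V s t \<in> R" if "s \<in> ?T" "t \<in> ?T" for s t
    unfolding blow_def by (rule matrix_rep_sum[OF rho]) (use that VR matrix_repD[OF rho] in auto)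
  have blow': "blow M V' (fst s, snd s * e + \<kappa>) (fst t, snd t * e + \<mu>) = \<rho> (blow ?M V s t) \<kappa> \<mu>"
    if st: "s \<in> ?T" "t \<in> ?T" and km: "\<kappa> < e" "\<mu> < e" for s t \<kappa> \<mu>
  proof -
    have "\<rho> (blow ?M V s t) \<kappa> \<mu> = (\<Sum>x\<in>UNIV. \<rho> (to_ac (M x (fst s) (fst t)) * V x (snd s) (snd t)) \<kappa> \<mu>)"
      unfolding blow_def by (rule matrix_rep_sum(2)[OF rho _ km]) (use st VR matrix_repD[OF rho] in auto)
    also have "\<dots> = (\<Sum>x\<in>UNIV. M x (fst s) (fst t) * \<rho> (V x (snd s) (snd t)) \<kappa> \<mu>)"
    proof (rule sum.cong[OF refl])
      fix x
      have "\<rho> (to_ac (M x (fst s) (fst t)) * V x (snd s) (snd t)) \<kappa> \<mu> =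
          (\<Sum>\<nu><e. (if \<kappa> = \<nu> then M x (fst s) (fst t) else 0) * \<rho> (V x (snd s) (snd t)) \<nu> \<mu>)"
        using km VR st by (subst matrix_repD(6)[OF rho]) (auto simp: matrix_repD(1,4)[OF rho] intro!: sum.cong)
      thus "\<rho> (to_ac (M x (fst s) (fst t)) * V x (snd s) (snd t)) \<kappa> \<mu> = M x (fst s) (fst t) * \<rho> (V x (snd s) (snd t)) \<kappa> \<mu>"
        using km by (simp add: if_distrib[of "\<lambda>x. x * _"] cong: if_cong)
    qed
    also have "\<dots> = blow M V' (fst s, snd s * e + \<kappa>) (fst t, snd t * e + \<mu>)"
      using km by (simp add: blow_def V'_def)
    finally show ?thesis by simp
  qed
  have "bil (I \<times> {..<N * e}) (blow M V') (P' a) (Q' b) = (if a = b then 1 else 0)"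
    if ab: "a \<in> {..<r} \<times> {..<e}" "b \<in> {..<r} \<times> {..<e}" for a b
  proof -
    obtain a0 \<kappa> where a: "a = (a0, \<kappa>)" "a0 < r" "\<kappa> < e" using ab(1) by (cases a) auto
    obtain b0 \<mu> where b: "b = (b0, \<mu>)" "b0 < r" "\<mu> < e" using ab(2) by (cases b) auto
    have "bil (I \<times> {..<N * e}) (blow M V') (P' a) (Q' b) = (\<Sum>s\<in>?T. \<Sum>\<kappa>'<e. \<Sum>t\<in>?T. \<Sum>\<mu>'<e.
        \<rho> (P a0 s) \<kappa> \<kappa>' * \<rho> (blow ?M V s t) \<kappa>' \<mu>' * \<rho> (Q b0 t) \<mu>' \<mu>)"
      unfolding bil_def sum_split_blocks
      by (intro sum.cong refl) (simp add: P'_def Q'_def a(1) b(1) blow')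
    also have "\<dots> = (\<Sum>s\<in>?T. \<Sum>t\<in>?T. \<Sum>\<kappa>'<e. \<Sum>\<mu>'<e.
        \<rho> (P a0 s) \<kappa> \<kappa>' * \<rho> (blow ?M V s t) \<kappa>' \<mu>' * \<rho> (Q b0 t) \<mu>' \<mu>)"
      by (rule sum.cong[OF refl]) (rule sum.swap)
    also have "\<dots> = (\<Sum>s\<in>?T. \<Sum>t\<in>?T. \<rho> (P a0 s * (blow ?M V s t * Q b0 t)) \<kappa> \<mu>)"
    proof (intro sum.cong refl)
      fix s t assume st: "s \<in> ?T" "t \<in> ?T"
      note mem = PR[OF a(2) st(1)] QR[OF b(2) st(2)] BR[OF st]
      show "(\<Sum>\<kappa>'<e. \<Sum>\<mu>'<e. \<rho> (P a0 s) \<kappa> \<kappa>' * \<rho> (blow ?M V s t) \<kappa>' \<mu>' * \<rho> (Q b0 t) \<mu>' \<mu>) =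
          \<rho> (P a0 s * (blow ?M V s t * Q b0 t)) \<kappa> \<mu>"
        using mem a(3) b(3) matrix_repD(3)[OF rho mem(3,2)]
        by (simp add: matrix_repD(6)[OF rho] sum_distrib_left mult.assoc)
    qed
    also have "\<dots> = (\<Sum>s\<in>?T. \<rho> (\<Sum>t\<in>?T. P a0 s * (blow ?M V s t * Q b0 t)) \<kappa> \<mu>)"
      using PR[OF a(2)] QR[OF b(2)] BR
      by (intro sum.cong refl matrix_rep_sum(2)[OF rho _ a(3) b(3), symmetric] matrix_repD(3)[OF rho]) auto
    also have "\<dots> = \<rho> (\<Sum>s\<in>?T. \<Sum>t\<in>?T. P a0 s * (blow ?M V s t * Q b0 t)) \<kappa> \<mu>"
      using PR[OF a(2)] QR[OF b(2)] BR
      by (intro matrix_rep_sum(2)[OF rho _ a(3) b(3), symmetric] matrix_rep_sum(1)[OF rho] matrix_repD(3)[OF rho]) auto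
    also have "(\<Sum>s\<in>?T. \<Sum>t\<in>?T. P a0 s * (blow ?M V s t * Q b0 t)) = to_ac (if a0 = b0 then 1 else 0)"
      using PQ a(2) b(2) by (simp add: bil_def mult.assoc)
    also have "\<rho> (to_ac (if a0 = b0 then 1 else 0)) \<kappa> \<mu> = (if a = b then 1 else 0)"
      using matrix_repD(4)[OF rho a(3) b(3)] a(1) b(1) by simp
    finally show ?thesis .
  qed
  hence "rank_ge (I \<times> {..<N * e}) (blow M V') (card ({..<r} \<times> {..<e}))"
    by (intro rank_geI[where P = P' and Q = Q']) simp_all
  thus ?thesis using that[of e V'] e by (simp add: card_cartesian_product)
qed

text \<open>The ratio \<open>h\<close> of the closure is kept. The upper bound holds because a point
  over the field is a point over the closure, and descent multiplies size and rank by the same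
  \<open>e\<close>.\<close>

theorem max_rank_ratio_field:
  fixes M :: "'x :: finite \<Rightarrow> 'i \<Rightarrow> 'i \<Rightarrow> 'k :: field"
  assumes fin: "finite I"
  obtains h N V where "N > 0" "rank_ge (I \<times> {..<N}) (blow M V) (h * N)"
    "\<And>N V r. rank_ge (I \<times> {..<N}) (blow M V) r \<Longrightarrow> r \<le> h * N"
proof (rule max_rank_ratio_alg_closed[OF fin, of "\<lambda>x i j. to_ac (M x i j)"])
  fix h N V
  assume N: "N > 0" "rank_ge (I \<times> {..<N}) (blow (\<lambda>x i j. to_ac (M x i j)) V) (h * N)"
    and bound: "\<And>N V r. rank_ge (I \<times> {..<N}) (blow (\<lambda>x i j. to_ac (M x i j)) V) r \<Longrightarrow> r \<le> h * N"
  have bound': "r \<le> h * N'" if "rank_ge (I \<times> {..<N'}) (blow M V') r" for N' V' r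
    using rank_ge_hom[OF unital_hom_to_ac that] bound unfolding blow_hom[OF unital_hom_to_ac] by blast
  show thesis
  proof (rule rank_descent[OF fin N(2)])
    fix e V' assume "e > 0" "rank_ge (I \<times> {..<N * e}) (blow M V') (h * N * e)"
    thus thesis using that[of "N * e" V' h] N(1) bound' by (simp add: mult.assoc)
  qed
qed

section \<open>Linearization\<close>

text \<open>The leaves are affine forms, \<open>None\<close> indexing the constant term. Polynomials
  are written as sums and products of leaves, so that every system is linear in the
  variables.\<close>

datatype ('k, 'd) rexp =
    Lin "'d option \<Rightarrow> 'k"
  | RAdd "('k, 'd) rexp" "('k, 'd) rexp"
  | RMult "('k, 'd) rexp" "('k, 'd) rexp"
  | RInv "('k, 'd) rexp"

primrec subs :: "('k, 'd) rexp \<Rightarrow> ('k, 'd) rexp set" where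
  "subs (Lin l) = {Lin l}"
| "subs (RAdd r s) = insert (RAdd r s) (subs r \<union> subs s)"
| "subs (RMult r s) = insert (RMult r s) (subs r \<union> subs s)"
| "subs (RInv r) = insert (RInv r) (subs r)"

text \<open>
  The pencil of \<open>r\<close> has rows and columns \<open>inner r\<close> together with \<open>[]\<close>. It describes a linear system:
  if the rows in \<open>inner r\<close> vanish on a vector with entry \<open>y\<close> at \<open>[]\<close>, then row \<open>[]\<close> yields
  \<open>r\<close> applied to \<open>y\<close>.
\<close>

primrec inner :: "('k, 'd) rexp \<Rightarrow> nat list set" where
  "inner (Lin l) = {}"
| "inner (RAdd r s) = (#) 0 ` inner r \<union> (#) 1 ` inner s"
| "inner (RMult r s) = insert [2] ((#) 0 ` inner r \<union> (#) 1 ` inner s)"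
| "inner (RInv r) = insert [2] ((#) 0 ` inner r)"

text \<open>Part \<open>k\<close> of a composite system is embedded by prefixing its indices with
  \<open>k\<close>, except that its index \<open>[]\<close> is glued to the outer index
  \<open>io\<close>. This is the partial inverse of that embedding.\<close>

definition place :: "nat \<Rightarrow> nat list \<Rightarrow> nat list \<Rightarrow> nat list option" where
  "place k io i = (if i = io then Some [] else if i \<noteq> [] \<and> hd i = k \<and> tl i \<noteq> [] then Some (tl i) else None)"

definition lift :: "(nat list \<Rightarrow> nat list \<Rightarrow> 'b :: zero) \<Rightarrow> nat \<Rightarrow> nat list \<Rightarrow> nat list \<Rightarrow> nat list \<Rightarrow> nat list \<Rightarrow> 'b" where
  "lift Q k rio cio i j =
     (case place k rio i of None \<Rightarrow> 0 | Some i' \<Rightarrow> (case place k cio j of None \<Rightarrow> 0 | Some j' \<Rightarrow> Q i' j'))"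

definition single :: "'b :: zero \<Rightarrow> nat list \<Rightarrow> nat list \<Rightarrow> nat list \<Rightarrow> nat list \<Rightarrow> 'b" where
  "single c i0 j0 i j = (if i = i0 \<and> j = j0 then c else 0)"

definition scalar :: "'k :: zero \<Rightarrow> 'd option \<Rightarrow> 'k" where
  "scalar c x = (if x = None then c else 0)"

text \<open>Index \<open>[2]\<close> carries an intermediate value: for a product, the output of
  \<open>s\<close> that is fed into \<open>r\<close>; for an inverse, the unknown on which
  \<open>r\<close> must produce the input, and which is itself the output. The constants 1 and -1
  are attached to \<open>None\<close>, so the pencil is homogeneous.\<close>

primrec pencil :: "('k :: comm_ring_1, 'd) rexp \<Rightarrow> 'd option \<Rightarrow> nat list \<Rightarrow> nat list \<Rightarrow> 'k" where
  "pencil (Lin l) x i j = l x"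
| "pencil (RAdd r s) x i j = lift (pencil r x) 0 [] [] i j + lift (pencil s x) 1 [] [] i j"
| "pencil (RMult r s) x i j = lift (pencil r x) 0 [] [2] i j + lift (pencil s x) 1 [2] [] i j
     + single (scalar (-1) x) [2] [2] i j"
| "pencil (RInv r) x i j = lift (pencil r x) 0 [2] [2] i j
     + single (scalar (-1) x) [2] [] i j + single (scalar 1 x) [] [2] i j"

lemma finite_inner: "finite (inner r)"
  by (induction r) auto

lemma Nil_notin_inner: "[] \<notin> inner r"
  by (induction r) auto

lemma finite_subs: "finite (subs r)"
  by (induction r) auto

text \<open>
  \<open>sel\<close> restricts a vector of a composite system to one of its parts, and \<open>mk\<close> glues vectors of the
  parts, with entry \<open>y\<close> at \<open>[]\<close> and \<open>z\<close> at \<open>[2]\<close>.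
\<close>

definition sel :: "nat \<Rightarrow> nat list \<Rightarrow> (nat list \<Rightarrow> 'b) \<Rightarrow> nat list \<Rightarrow> 'b" where
  "sel k io w j = w (if j = [] then io else k # j)"

definition mk :: "'b \<Rightarrow> 'b \<Rightarrow> (nat list \<Rightarrow> 'b) \<Rightarrow> (nat list \<Rightarrow> 'b) \<Rightarrow> nat list \<Rightarrow> 'b" where
  "mk y z w0 w1 l = (if l = [] then y else if tl l = [] then z else if hd l = 0 then w0 (tl l) else w1 (tl l))"

lemma sel_inner: "i \<in> inner r \<Longrightarrow> sel k io w i = w (k # i)"
  using Nil_notin_inner[of r] by (auto simp: sel_def)

lemma sel_mk:
  "w0 [] = y \<Longrightarrow> sel 0 [] (mk y z w0 w1) = w0"
  "w1 [] = y \<Longrightarrow> sel 1 [] (mk y z w0 w1) = w1"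
  "w0 [] = z \<Longrightarrow> sel 0 [2] (mk y z w0 w1) = w0"
  by (auto simp: sel_def mk_def fun_eq_iff)

lemma sum_lift:
  fixes Q :: "nat list \<Rightarrow> nat list \<Rightarrow> 'b :: ring"
  assumes fin: "finite S" and J: "[] \<notin> J" "finite J" "\<And>j. j \<in> J \<Longrightarrow> k # j \<in> S" "cio \<in> S"
    and S: "\<And>j. k # j \<in> S \<Longrightarrow> j \<noteq> [] \<Longrightarrow> j \<in> J" and cio: "cio = [] \<or> tl cio = []"
  shows "(\<Sum>j\<in>S. lift Q k rio cio i j * w j) =
    (case place k rio i of None \<Rightarrow> 0 | Some i' \<Rightarrow> (\<Sum>j\<in>insert [] J. Q i' j * sel k cio w j))"
proof (cases "place k rio i")
  case None
  thus ?thesis by (simp add: lift_def)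
next
  case (Some i')
  define f where "f = (\<lambda>j. if j = [] then cio else k # j)"
  have inj: "inj_on f (insert [] J)"
    by (rule inj_onI) (use J(1) cio in \<open>auto simp: f_def split: if_splits\<close>)
  have sub: "f ` insert [] J \<subseteq> S" using J by (auto simp: f_def)
  have pf: "place k cio (f j) = Some j" if "j \<in> insert [] J" for j
    using that J(1) cio by (auto simp: f_def place_def)
  have out: "place k cio j = None" if j: "j \<in> S" "j \<notin> f ` insert [] J" for j
  proof (rule ccontr)
    assume "place k cio j \<noteq> None"
    hence "j = cio \<or> (j \<noteq> [] \<and> hd j = k \<and> tl j \<noteq> [])" by (auto simp: place_def split: if_splits)
    moreover have "j \<noteq> cio" using j(2) by (auto simp: f_def)
    ultimately have "j = k # tl j" "tl j \<noteq> []" by auto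
    moreover from this have "tl j \<in> J" using S[of "tl j"] j(1) by simp
    ultimately have "j \<in> f ` insert [] J" by (intro image_eqI[of _ _ "tl j"]) (auto simp: f_def)
    thus False using j(2) by simp
  qed
  have "(\<Sum>j\<in>S. lift Q k rio cio i j * w j) = (\<Sum>j\<in>f ` insert [] J. lift Q k rio cio i j * w j)"
    by (rule sum.mono_neutral_right[OF fin sub]) (use out in \<open>auto simp: lift_def Some\<close>)
  also have "\<dots> = (\<Sum>j\<in>insert [] J. lift Q k rio cio i (f j) * w (f j))"
    by (rule sum.reindex[OF inj, unfolded o_def])
  also have "\<dots> = (\<Sum>j\<in>insert [] J. Q i' j * sel k cio w j)"
    by (intro sum.cong refl) (simp add: lift_def Some pf, simp add: sel_def f_def)
  finally show ?thesis using Some by simp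
qed

lemma sum_single:
  fixes c :: "'b :: ring"
  assumes "finite S" "j0 \<in> S"
  shows "(\<Sum>j\<in>S. single c i0 j0 i j * w j) = (if i = i0 then c * w j0 else 0)"
proof (cases "i = i0")
  case True
  have "(\<Sum>j\<in>S. single c i0 j0 i j * w j) = (\<Sum>j\<in>S. if j = j0 then c * w j0 else 0)"
    by (intro sum.cong refl) (simp add: single_def True)
  thus ?thesis using assms True by simp
qed (simp add: single_def)

section \<open>Values of expressions and solvability of their systems\<close>

context unital_algebra
begin

definition lin_eval :: "('d :: finite \<Rightarrow> 'a) \<Rightarrow> ('d option \<Rightarrow> 'k) \<Rightarrow> 'a" where
  "lin_eval a l = (\<Sum>x\<in>UNIV. scale (l x) (case_option 1 a x))"

text \<open>A relation instead of a function: having a value expresses that all inversions inside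
  the expression are possible.\<close>

primrec val :: "('d :: finite \<Rightarrow> 'a) \<Rightarrow> ('k, 'd) rexp \<Rightarrow> 'a \<Rightarrow> bool" where
  "val a (Lin l) x \<longleftrightarrow> x = lin_eval a l"
| "val a (RAdd r s) x \<longleftrightarrow> (\<exists>u v. val a r u \<and> val a s v \<and> x = u + v)"
| "val a (RMult r s) x \<longleftrightarrow> (\<exists>u v. val a r u \<and> val a s v \<and> x = u * v)"
| "val a (RInv r) x \<longleftrightarrow> (\<exists>u. val a r u \<and> u * x = 1 \<and> x * u = 1)"

definition entry :: "('d :: finite \<Rightarrow> 'a) \<Rightarrow> ('k, 'd) rexp \<Rightarrow> nat list \<Rightarrow> nat list \<Rightarrow> 'a" where
  "entry a r i j = lin_eval a (\<lambda>x. pencil r x i j)"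

definition row :: "('d :: finite \<Rightarrow> 'a) \<Rightarrow> ('k, 'd) rexp \<Rightarrow> nat list \<Rightarrow> (nat list \<Rightarrow> 'a) \<Rightarrow> 'a" where
  "row a r i w = (\<Sum>j\<in>insert [] (inner r). entry a r i j * w j)"

text \<open>Together with \<open>solv\<close> this says that the square matrix of inner rows and
  columns is bijective on vectors. \<open>io\<close> then states that \<open>x\<close> is the Schur
  complement, the transfer from the entry at \<open>[]\<close> to row \<open>[]\<close>.\<close>

definition uniq :: "('d :: finite \<Rightarrow> 'a) \<Rightarrow> ('k, 'd) rexp \<Rightarrow> bool" where
  "uniq a r \<longleftrightarrow> (\<forall>w. w [] = 0 \<longrightarrow> (\<forall>i\<in>inner r. row a r i w = 0) \<longrightarrow> (\<forall>i\<in>inner r. w i = 0))"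

definition solv :: "('d :: finite \<Rightarrow> 'a) \<Rightarrow> ('k, 'd) rexp \<Rightarrow> bool" where
  "solv a r \<longleftrightarrow> (\<forall>g y. \<exists>w. w [] = y \<and> (\<forall>i\<in>inner r. row a r i w = g i))"

definition io :: "('d :: finite \<Rightarrow> 'a) \<Rightarrow> ('k, 'd) rexp \<Rightarrow> 'a \<Rightarrow> bool" where
  "io a r x \<longleftrightarrow> (\<forall>w. (\<forall>i\<in>inner r. row a r i w = 0) \<longrightarrow> row a r [] w = x * w [])"

lemma lin_eval_add: "lin_eval a (\<lambda>x. l x + l' x) = lin_eval a l + lin_eval a l'"
  by (simp add: lin_eval_def scale_left_distrib sum.distrib)

lemma lin_eval_zero: "lin_eval a (\<lambda>x. 0) = 0"
  by (simp add: lin_eval_def)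

lemma lin_eval_scalar:
  fixes a :: "'d :: finite \<Rightarrow> 'a"
  shows "lin_eval a (scalar c) = scale c 1"
proof -
  have "lin_eval a (scalar c) = (\<Sum>x\<in>(UNIV :: 'd option set). if x = None then scale c 1 else 0)"
    unfolding lin_eval_def by (intro sum.cong refl) (auto simp: scalar_def)
  thus ?thesis by simp
qed

lemma lin_eval_lift: "lin_eval a (\<lambda>x. lift (pencil r x) k rio cio i j) = lift (entry a r) k rio cio i j"
  by (simp add: lift_def entry_def lin_eval_zero split: option.split)

lemma lin_eval_single: "lin_eval a (\<lambda>x. single (scalar c x) i0 j0 i j) = single (scale c 1) i0 j0 i j"
proof (cases "i = i0 \<and> j = j0")
  case True
  have "(\<lambda>x. scalar c x) = scalar c" by (rule ext) simp
  thus ?thesis using True by (simp add: single_def lin_eval_scalar)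
qed (auto simp: single_def lin_eval_zero)

lemma entry_simps:
  "entry a (Lin l) i j = lin_eval a l"
  "entry a (RAdd r s) i j = lift (entry a r) 0 [] [] i j + lift (entry a s) 1 [] [] i j"
  "entry a (RMult r s) i j = lift (entry a r) 0 [] [2] i j + lift (entry a s) 1 [2] [] i j + single (- 1) [2] [2] i j"
  "entry a (RInv r) i j = lift (entry a r) 0 [2] [2] i j + single (- 1) [2] [] i j + single 1 [] [2] i j"
  using lin_eval_single[of a "-1"] lin_eval_single[of a 1]
  by (simp_all add: entry_def[of _ "Lin _"] entry_def[of _ "RAdd _ _"] entry_def[of _ "RMult _ _"] entry_def[of _ "RInv _"]
      lin_eval_add lin_eval_lift)

lemma place_simps:
  "i \<in> inner r \<Longrightarrow> place k [2] (k # i) = Some i"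
  "i \<in> inner r \<Longrightarrow> place k [] (k # i) = Some i"
  "i \<in> inner r \<Longrightarrow> k \<noteq> k' \<Longrightarrow> place k [] (k' # i) = None"
  "i \<in> inner r \<Longrightarrow> k \<noteq> k' \<Longrightarrow> place k [2] (k' # i) = None"
  "place k [] [] = Some []" "place k [2] [2] = Some []" "place k [2] [] = None" "place k [] [2] = None"
  using Nil_notin_inner[of r] by (auto simp: place_def)

lemma sum_lift_entry:
  assumes "\<And>j. j \<in> inner r \<Longrightarrow> k # j \<in> inner R" "\<And>j. k # j \<in> inner R \<Longrightarrow> j \<noteq> [] \<Longrightarrow> j \<in> inner r"
    "cio = [] \<or> cio = [2] \<and> [2] \<in> inner R"
  shows "(\<Sum>j\<in>insert [] (inner R). lift (entry a r) k rio cio i j * w j) =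
    (case place k rio i of None \<Rightarrow> 0 | Some i' \<Rightarrow> row a r i' (sel k cio w))"
  unfolding row_def
  by (rule sum_lift) (use assms finite_inner Nil_notin_inner in auto)

lemma row_RAdd:
  "row a (RAdd r s) i w =
     (case place 0 [] i of None \<Rightarrow> 0 | Some i' \<Rightarrow> row a r i' (sel 0 [] w)) +
     (case place 1 [] i of None \<Rightarrow> 0 | Some i' \<Rightarrow> row a s i' (sel 1 [] w))"
proof -
  have "row a (RAdd r s) i w =
      (\<Sum>j\<in>insert [] (inner (RAdd r s)). lift (entry a r) 0 [] [] i j * w j) +
      (\<Sum>j\<in>insert [] (inner (RAdd r s)). lift (entry a s) 1 [] [] i j * w j)"
    unfolding row_def entry_simps distrib_right sum.distrib ..
  thus ?thesis by (subst (asm) (1 2) sum_lift_entry) auto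
qed

lemma row_RMult:
  "row a (RMult r s) i w =
     (case place 0 [] i of None \<Rightarrow> 0 | Some i' \<Rightarrow> row a r i' (sel 0 [2] w)) +
     (case place 1 [2] i of None \<Rightarrow> 0 | Some i' \<Rightarrow> row a s i' (sel 1 [] w)) +
     (if i = [2] then - w [2] else 0)"
proof -
  have "row a (RMult r s) i w =
      (\<Sum>j\<in>insert [] (inner (RMult r s)). lift (entry a r) 0 [] [2] i j * w j) +
      (\<Sum>j\<in>insert [] (inner (RMult r s)). lift (entry a s) 1 [2] [] i j * w j) +
      (\<Sum>j\<in>insert [] (inner (RMult r s)). single (- 1) [2] [2] i j * w j)"
    unfolding row_def entry_simps distrib_right sum.distrib ..
  also have "(\<Sum>j\<in>insert [] (inner (RMult r s)). single (- 1) [2] [2] i j * w j) = (if i = [2] then - w [2] else 0)"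
    by (subst sum_single) (use finite_inner in auto)
  finally show ?thesis by (subst (asm) (1 2) sum_lift_entry) auto
qed

lemma row_RInv:
  "row a (RInv r) i w =
     (case place 0 [2] i of None \<Rightarrow> 0 | Some i' \<Rightarrow> row a r i' (sel 0 [2] w)) +
     (if i = [2] then - w [] else 0) + (if i = [] then w [2] else 0)"
proof -
  have "row a (RInv r) i w =
      (\<Sum>j\<in>insert [] (inner (RInv r)). lift (entry a r) 0 [2] [2] i j * w j) +
      (\<Sum>j\<in>insert [] (inner (RInv r)). single (- 1) [2] [] i j * w j) +
      (\<Sum>j\<in>insert [] (inner (RInv r)). single 1 [] [2] i j * w j)"
    unfolding row_def entry_simps distrib_right sum.distrib ..
  also have "(\<Sum>j\<in>insert [] (inner (RInv r)). single (- 1) [2] [] i j * w j) = (if i = [2] then - w [] else 0)"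
    by (subst sum_single) (use finite_inner in auto)
  also have "(\<Sum>j\<in>insert [] (inner (RInv r)). single 1 [] [2] i j * w j) = (if i = [] then w [2] else 0)"
    by (subst sum_single) (use finite_inner in auto)
  finally show ?thesis by (subst (asm) sum_lift_entry) auto
qed

lemma row_simps:
  "i \<in> inner r \<Longrightarrow> row a (RAdd r s) (0 # i) w = row a r i (sel 0 [] w)"
  "i \<in> inner s \<Longrightarrow> row a (RAdd r s) (1 # i) w = row a s i (sel 1 [] w)"
  "row a (RAdd r s) [] w = row a r [] (sel 0 [] w) + row a s [] (sel 1 [] w)"
  "i \<in> inner r \<Longrightarrow> row a (RMult r s) (0 # i) w = row a r i (sel 0 [2] w)"
  "i \<in> inner s \<Longrightarrow> row a (RMult r s) (1 # i) w = row a s i (sel 1 [] w)"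
  "row a (RMult r s) [2] w = row a s [] (sel 1 [] w) - w [2]"
  "row a (RMult r s) [] w = row a r [] (sel 0 [2] w)"
  "i \<in> inner r \<Longrightarrow> row a (RInv r) (0 # i) w = row a r i (sel 0 [2] w)"
  "row a (RInv r) [2] w = row a r [] (sel 0 [2] w) - w []"
  "row a (RInv r) [] w = w [2]"
  using Nil_notin_inner[of r] Nil_notin_inner[of s]
  by (auto simp: row_RAdd row_RMult row_RInv place_simps)

lemma row_diff: "row a r i (\<lambda>j. w j - w' j) = row a r i w - row a r i w'"
  unfolding row_def right_diff_distrib by (rule sum_subtractf)

lemma ioD: "io a r x \<Longrightarrow> (\<And>i. i \<in> inner r \<Longrightarrow> row a r i w = 0) \<Longrightarrow> row a r [] w = x * w []"
  unfolding io_def by blast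

lemma uniqD: "uniq a r \<Longrightarrow> w [] = 0 \<Longrightarrow> (\<And>i. i \<in> inner r \<Longrightarrow> row a r i w = 0) \<Longrightarrow> i \<in> inner r \<Longrightarrow> w i = 0"
  unfolding uniq_def by blast

lemma solvD: "solv a r \<Longrightarrow> \<exists>w. w [] = y \<and> (\<forall>i\<in>inner r. row a r i w = g i)"
  unfolding solv_def by blast

text \<open>A composite system is solved part by part. In a product, solving \<open>s\<close> fixes
  the entry at \<open>[2]\<close>, which is the input for \<open>r\<close>; in an inverse, the input
  of \<open>r\<close> is found from the required output with the help of the inverse
  \<open>x\<close>.\<close>

theorem val_imp_system: "val a r x \<Longrightarrow> uniq a r \<and> solv a r \<and> io a r x"
proof (induction r arbitrary: x)
  case (Lin l)
  thus ?case by (auto simp: uniq_def solv_def io_def row_def entry_simps)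
next
  case (RAdd r s)
  then obtain u v where uv: "val a r u" "val a s v" "x = u + v" by auto
  have r: "uniq a r" "solv a r" "io a r u" and s: "uniq a s" "solv a s" "io a s v"
    using RAdd.IH uv by auto
  have "uniq a (RAdd r s)" unfolding uniq_def
  proof (intro allI impI)
    fix w assume w0: "w [] = 0" and rows: "\<forall>i\<in>inner (RAdd r s). row a (RAdd r s) i w = 0"
    have rows0: "row a r i (sel 0 [] w) = 0" if "i \<in> inner r" for i
      using rows that row_simps(1)[OF that, of a s w] by auto
    have 0: "w (0 # i) = 0" if "i \<in> inner r" for i
    proof -
      have "sel 0 [] w i = 0"
        by (rule uniqD[OF r(1) _ rows0 that]) (use w0 in \<open>simp_all add: sel_def\<close>)
      thus ?thesis by (simp add: sel_inner[OF that])
    qed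
    have rows1: "row a s i (sel 1 [] w) = 0" if "i \<in> inner s" for i
      using rows that row_simps(2)[OF that, of a r w] by auto
    have 1: "w (1 # i) = 0" if "i \<in> inner s" for i
    proof -
      have "sel 1 [] w i = 0"
        by (rule uniqD[OF s(1) _ rows1 that]) (use w0 in \<open>simp_all add: sel_def\<close>)
      thus ?thesis by (simp add: sel_inner[OF that])
    qed
    show "\<forall>i\<in>inner (RAdd r s). w i = 0"
      using 0 1 by auto
  qed
  moreover have "solv a (RAdd r s)" unfolding solv_def
  proof (intro allI)
    fix g y
    obtain w0 where w0: "w0 [] = y" "\<forall>i\<in>inner r. row a r i w0 = g (0 # i)"
      using solvD[OF r(2), of y "\<lambda>i. g (0 # i)"] by blast
    obtain w1 where w1: "w1 [] = y" "\<forall>i\<in>inner s. row a s i w1 = g (1 # i)"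
      using solvD[OF s(2), of y "\<lambda>i. g (1 # i)"] by blast
    let ?w = "mk y 0 w0 w1"
    have "row a (RAdd r s) (0 # i) ?w = g (0 # i)" if "i \<in> inner r" for i
      using w0(2) that unfolding row_simps(1)[OF that] sel_mk(1)[of w0, OF w0(1)] by blast
    moreover have "row a (RAdd r s) (1 # i) ?w = g (1 # i)" if "i \<in> inner s" for i
      using w1(2) that unfolding row_simps(2)[OF that] sel_mk(2)[of w1, OF w1(1)] by blast
    moreover have "?w [] = y" by (simp add: mk_def)
    ultimately show "\<exists>w. w [] = y \<and> (\<forall>i\<in>inner (RAdd r s). row a (RAdd r s) i w = g i)"
      by (intro exI[of _ ?w]) auto
  qed
  moreover have "io a (RAdd r s) x" unfolding io_def
  proof (intro allI impI)
    fix w assume rows: "\<forall>i\<in>inner (RAdd r s). row a (RAdd r s) i w = 0"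
    have "row a r [] (sel 0 [] w) = u * sel 0 [] w []"
    proof (rule ioD[OF r(3)])
      show "row a r i (sel 0 [] w) = 0" if "i \<in> inner r" for i
        using rows that row_simps(1)[OF that, of a s w] by auto
    qed
    moreover have "row a s [] (sel 1 [] w) = v * sel 1 [] w []"
    proof (rule ioD[OF s(3)])
      show "row a s i (sel 1 [] w) = 0" if "i \<in> inner s" for i
        using rows that row_simps(2)[OF that, of a r w] by auto
    qed
    ultimately show "row a (RAdd r s) [] w = x * w []"
      by (simp add: row_simps(3) sel_def uv(3) distrib_right)
  qed
  ultimately show ?case by blast
next
  case (RMult r s)
  then obtain u v where uv: "val a r u" "val a s v" "x = u * v" by auto
  have r: "uniq a r" "solv a r" "io a r u" and s: "uniq a s" "solv a s" "io a s v"
    using RMult.IH uv by auto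
  have out_s: "w [2] = v * w []" if "\<forall>i\<in>inner (RMult r s). row a (RMult r s) i w = 0" for w
  proof -
    have "row a s [] (sel 1 [] w) = v * sel 1 [] w []"
    proof (rule ioD[OF s(3)])
      show "row a s i (sel 1 [] w) = 0" if "i \<in> inner s" for i
        using \<open>\<forall>i\<in>inner (RMult r s). _\<close> that row_simps(5)[OF that, of a r w] by auto
    qed
    moreover have "row a (RMult r s) [2] w = 0" using that by simp
    ultimately show ?thesis by (simp add: row_simps(6) sel_def)
  qed
  have "uniq a (RMult r s)" unfolding uniq_def
  proof (intro allI impI)
    fix w assume w0: "w [] = 0" and rows: "\<forall>i\<in>inner (RMult r s). row a (RMult r s) i w = 0"
    have 2: "w [2] = 0" using out_s[OF rows] w0 by simp
    have rows0: "row a r i (sel 0 [2] w) = 0" if "i \<in> inner r" for i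
      using rows that row_simps(4)[OF that, of a s w] by auto
    have 0: "w (0 # i) = 0" if "i \<in> inner r" for i
    proof -
      have "sel 0 [2] w i = 0"
        by (rule uniqD[OF r(1) _ rows0 that]) (use 2 in \<open>simp_all add: sel_def\<close>)
      thus ?thesis by (simp add: sel_inner[OF that])
    qed
    have rows1: "row a s i (sel 1 [] w) = 0" if "i \<in> inner s" for i
      using rows that row_simps(5)[OF that, of a r w] by auto
    have 1: "w (1 # i) = 0" if "i \<in> inner s" for i
    proof -
      have "sel 1 [] w i = 0"
        by (rule uniqD[OF s(1) _ rows1 that]) (use w0 in \<open>simp_all add: sel_def\<close>)
      thus ?thesis by (simp add: sel_inner[OF that])
    qed
    show "\<forall>i\<in>inner (RMult r s). w i = 0"
      using 0 1 2 by auto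
  qed
  moreover have "solv a (RMult r s)" unfolding solv_def
  proof (intro allI)
    fix g y
    obtain w1 where w1: "w1 [] = y" "\<forall>i\<in>inner s. row a s i w1 = g (1 # i)"
      using solvD[OF s(2), of y "\<lambda>i. g (1 # i)"] by blast
    \<comment> \<open>Row \<open>[2]\<close> is the output of \<open>s\<close> minus the entry at
      \<open>[2]\<close>, and must equal \<open>g [2]\<close>.\<close>
    define z where "z = row a s [] w1 - g [2]"
    obtain w0 where w0: "w0 [] = z" "\<forall>i\<in>inner r. row a r i w0 = g (0 # i)"
      using solvD[OF r(2), of z "\<lambda>i. g (0 # i)"] by blast
    let ?w = "mk y z w0 w1"
    have "row a (RMult r s) (0 # i) ?w = g (0 # i)" if "i \<in> inner r" for i
      using w0(2) that unfolding row_simps(4)[OF that] sel_mk(3)[of w0, OF w0(1)] by blast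
    moreover have "row a (RMult r s) (1 # i) ?w = g (1 # i)" if "i \<in> inner s" for i
      using w1(2) that unfolding row_simps(5)[OF that] sel_mk(2)[of w1, OF w1(1)] by blast
    moreover have "row a (RMult r s) [2] ?w = g [2]"
      unfolding row_simps(6) sel_mk(2)[of w1, OF w1(1)] by (simp add: mk_def z_def)
    moreover have "?w [] = y" by (simp add: mk_def)
    ultimately show "\<exists>w. w [] = y \<and> (\<forall>i\<in>inner (RMult r s). row a (RMult r s) i w = g i)"
      by (intro exI[of _ ?w]) auto
  qed
  moreover have "io a (RMult r s) x" unfolding io_def
  proof (intro allI impI)
    fix w assume rows: "\<forall>i\<in>inner (RMult r s). row a (RMult r s) i w = 0"
    have "row a r [] (sel 0 [2] w) = u * sel 0 [2] w []"
    proof (rule ioD[OF r(3)])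
      show "row a r i (sel 0 [2] w) = 0" if "i \<in> inner r" for i
        using rows that row_simps(4)[OF that, of a s w] by auto
    qed
    thus "row a (RMult r s) [] w = x * w []"
      using out_s[OF rows] by (simp add: row_simps(7) sel_def uv(3) mult.assoc)
  qed
  ultimately show ?case by blast
next
  case (RInv r)
  then obtain u where u: "val a r u" "u * x = 1" "x * u = 1" by auto
  have r: "uniq a r" "solv a r" "io a r u" using RInv.IH u by auto
  have out: "w [2] = x * w []" if "\<forall>i\<in>inner (RInv r). row a (RInv r) i w = 0" for w
  proof -
    have "row a r [] (sel 0 [2] w) = u * sel 0 [2] w []"
    proof (rule ioD[OF r(3)])
      show "row a r i (sel 0 [2] w) = 0" if "i \<in> inner r" for i
        using \<open>\<forall>i\<in>inner (RInv r). _\<close> that row_simps(8)[OF that, of a w] by auto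
    qed
    moreover have "row a (RInv r) [2] w = 0" using that by simp
    ultimately have "w [] = u * w [2]" by (simp add: row_simps(9) sel_def)
    thus ?thesis using u(3) by (simp flip: mult.assoc)
  qed
  have "uniq a (RInv r)" unfolding uniq_def
  proof (intro allI impI)
    fix w assume w0: "w [] = 0" and rows: "\<forall>i\<in>inner (RInv r). row a (RInv r) i w = 0"
    have 2: "w [2] = 0" using out[OF rows] w0 by simp
    have rows0: "row a r i (sel 0 [2] w) = 0" if "i \<in> inner r" for i
      using rows that row_simps(8)[OF that, of a w] by auto
    have 0: "w (0 # i) = 0" if "i \<in> inner r" for i
    proof -
      have "sel 0 [2] w i = 0"
        by (rule uniqD[OF r(1) _ rows0 that]) (use 2 in \<open>simp_all add: sel_def\<close>)
      thus ?thesis by (simp add: sel_inner[OF that])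
    qed
    show "\<forall>i\<in>inner (RInv r). w i = 0"
      using 0 2 by auto
  qed
  moreover have "solv a (RInv r)" unfolding solv_def
  proof (intro allI)
    fix g y
    obtain wa where wa: "wa [] = 0" "\<forall>i\<in>inner r. row a r i wa = g (0 # i)"
      using solvD[OF r(2), of 0 "\<lambda>i. g (0 # i)"] by blast
    \<comment> \<open>\<open>wa\<close> is the response to input 0. With input \<open>z\<close> the
      output of \<open>r\<close> grows by \<open>u * z\<close>, and row \<open>[2]\<close> requires
      it to be \<open>g [2] + y\<close>; solving for \<open>z\<close> uses \<open>x\<close> as right
      inverse of \<open>u\<close>.\<close>
    define z where "z = x * (g [2] + y - row a r [] wa)"
    obtain wb where wb: "wb [] = z" "\<forall>i\<in>inner r. row a r i wb = g (0 # i)"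
      using solvD[OF r(2), of z "\<lambda>i. g (0 # i)"] by blast
    have "row a r [] (\<lambda>j. wb j - wa j) = u * (wb [] - wa [])"
      by (rule ioD[OF r(3)]) (use wa wb in \<open>simp add: row_diff\<close>)
    hence "row a r [] wb - row a r [] wa = u * x * (g [2] + y - row a r [] wa)"
      using wa wb by (simp add: row_diff z_def mult.assoc)
    hence "row a r [] wb - y = g [2]" using u(2) by (simp add: algebra_simps)
    moreover have y: "mk y z wb wb [] = y" by (simp add: mk_def)
    ultimately have "row a (RInv r) [2] (mk y z wb wb) = g [2]"
      unfolding row_simps(9) sel_mk(3)[of wb, OF wb(1)] by simp
    moreover have "row a (RInv r) (0 # i) (mk y z wb wb) = g (0 # i)" if "i \<in> inner r" for i
      using wb(2) that unfolding row_simps(8)[OF that] sel_mk(3)[of wb, OF wb(1)] by blast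
    ultimately show "\<exists>w. w [] = y \<and> (\<forall>i\<in>inner (RInv r). row a (RInv r) i w = g i)"
      using y by (intro exI[of _ "mk y z wb wb"]) auto
  qed
  moreover have "io a (RInv r) x"
    unfolding io_def using out by (simp add: row_simps(10))
  ultimately show ?case by blast
qed

lemma val_subs:
  "val a r x \<Longrightarrow> r' \<in> subs r \<Longrightarrow> \<exists>x'. val a r' x'"
proof (induction r arbitrary: x)
  case (RAdd r s)
  show ?case
  proof (cases "r' = RAdd r s")
    case False
    thus ?thesis using RAdd by auto
  qed (use RAdd.prems in blast)
next
  case (RMult r s)
  show ?case
  proof (cases "r' = RMult r s")
    case False
    thus ?thesis using RMult by auto
  qed (use RMult.prems in blast)
next
  case (RInv r)
  show ?case
  proof (cases "r' = RInv r")
    case False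
    thus ?thesis using RInv by auto
  qed (use RInv.prems in blast)
qed auto

text \<open>Solving with right-hand side 1 at \<open>[2]\<close> yields \<open>z\<close> with
  \<open>u * z = 1\<close>. Then \<open>u\<close> annihilates \<open>t = z * u - 1\<close>, so
  feeding \<open>t\<close> into \<open>r\<close> gives a solution of the homogeneous system, and
  uniqueness forces \<open>t = 0\<close>.\<close>

lemma system_unit:
  assumes r: "val a r u" and R: "uniq a (RInv r)" "solv a (RInv r)"
  shows "\<exists>x. val a (RInv r) x"
proof -
  have sys: "uniq a r" "solv a r" "io a r u" using val_imp_system[OF r] by auto
  obtain w where w: "w [] = 0" "\<forall>i\<in>inner (RInv r). row a (RInv r) i w = (if i = [2] then 1 else 0)"
    using solvD[OF R(2), of 0 "\<lambda>i. if i = [2] then 1 else 0"] by blast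
  define z where "z = w [2]"
  have "row a r [] (sel 0 [2] w) = u * sel 0 [2] w []"
  proof (rule ioD[OF sys(3)])
    show "row a r i (sel 0 [2] w) = 0" if "i \<in> inner r" for i
      using w that row_simps(8)[OF that, of a w] by auto
  qed
  moreover have "row a (RInv r) [2] w = 1" using w(2) by simp
  ultimately have uz: "u * z = 1" using w(1) by (simp add: row_simps(9) sel_def z_def)
  define t where "t = z * u - 1"
  have ut: "u * t = 0" using uz by (simp add: t_def right_diff_distrib flip: mult.assoc)
  obtain w0 where w0: "w0 [] = t" "\<forall>i\<in>inner r. row a r i w0 = 0"
    using solvD[OF sys(2), of t "\<lambda>_. 0"] by blast
  have "row a r [] w0 = 0" using ioD[OF sys(3), of w0] w0 ut by simp
  hence "row a (RInv r) [2] (mk 0 t w0 w0) = 0"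
    unfolding row_simps(9) sel_mk(3)[of w0, OF w0(1)] by (simp add: mk_def)
  moreover have "row a (RInv r) (0 # i) (mk 0 t w0 w0) = 0" if "i \<in> inner r" for i
    using w0(2) that unfolding row_simps(8)[OF that] sel_mk(3)[of w0, OF w0(1)] by blast
  ultimately have rows: "row a (RInv r) i (mk 0 t w0 w0) = 0" if "i \<in> inner (RInv r)" for i
    using that by auto
  have "mk 0 t w0 w0 [2] = 0"
    by (rule uniqD[OF R(1) _ rows]) (simp_all add: mk_def)
  hence "z * u = 1" by (simp add: mk_def t_def)
  thus ?thesis using r uz by auto
qed

text \<open>By induction every part receives a value; only at an inversion does the system of the
  expression itself have to supply the invertibility. Hence the assumption on all
  subexpressions.\<close>

theorem system_imp_val:
  "(\<And>r'. r' \<in> subs r \<Longrightarrow> uniq a r' \<and> solv a r') \<Longrightarrow> \<exists>x. val a r x"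
proof (induction r)
  case (RInv r)
  have "\<exists>u. val a r u" by (rule RInv.IH) (rule RInv.prems, simp)
  then obtain u where u: "val a r u" ..
  have "uniq a (RInv r) \<and> solv a (RInv r)" by (rule RInv.prems) simp
  thus ?case using system_unit[OF u] by blast
next
  case (RAdd r s)
  have "\<exists>u. val a r u" by (rule RAdd.IH(1)) (rule RAdd.prems, simp)
  moreover have "\<exists>u. val a s u" by (rule RAdd.IH(2)) (rule RAdd.prems, simp)
  ultimately show ?case by auto
next
  case (RMult r s)
  have "\<exists>u. val a r u" by (rule RMult.IH(1)) (rule RMult.prems, simp)
  moreover have "\<exists>u. val a s u" by (rule RMult.IH(2)) (rule RMult.prems, simp)
  ultimately show ?case by auto
next
  case (Lin l)
  have "val a (Lin l) (lin_eval a l)" by simp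
  thus ?case by blast
qed

end

section \<open>Rational expressions as linearizable expressions\<close>

primrec word_rexp :: "'d list \<Rightarrow> ('k :: comm_ring_1, 'd) rexp" where
  "word_rexp [] = Lin (scalar 1)"
| "word_rexp (i # w) = RMult (Lin (\<lambda>x. if x = Some i then 1 else 0)) (word_rexp w)"

primrec words_rexp :: "('k :: comm_ring_1, 'd) nc_poly \<Rightarrow> 'd list list \<Rightarrow> ('k, 'd) rexp" where
  "words_rexp p [] = Lin (\<lambda>x. 0)"
| "words_rexp p (w # ws) =
     RAdd (RMult (Lin (scalar (Poly_Mapping.lookup p w))) (word_rexp w)) (words_rexp p ws)"

primrec rexp_of :: "('k :: comm_ring_1, 'd) nc_rat \<Rightarrow> ('k, 'd) rexp" where
  "rexp_of (nc_rat.Poly p) = words_rexp p (SOME ws. distinct ws \<and> set ws = Poly_Mapping.keys p)"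
| "rexp_of (nc_rat.Add R S) = RAdd (rexp_of R) (rexp_of S)"
| "rexp_of (nc_rat.Mult R S) = RMult (rexp_of R) (rexp_of S)"
| "rexp_of (nc_rat.Inv R) = RInv (rexp_of R)"

lemma algebra_of_simps [simp]:
  "carrier (algebra_of scale) = UNIV" "x \<otimes>\<^bsub>algebra_of scale\<^esub> y = x * y" "\<one>\<^bsub>algebra_of scale\<^esub> = 1"
  "\<zero>\<^bsub>algebra_of scale\<^esub> = 0" "x \<oplus>\<^bsub>algebra_of scale\<^esub> y = x + y" "c \<odot>\<^bsub>algebra_of scale\<^esub> y = scale c y"
  by (simp_all add: algebra_of_def)

lemma abelian_monoid_algebra_of: "abelian_monoid (algebra_of scale)"
  by (rule abelian_monoidI) (simp_all add: add.assoc add.commute)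

lemma finsum_algebra_of:
  assumes "finite A"
  shows "finsum (algebra_of scale) f A = sum f A"
proof -
  interpret abelian_monoid "algebra_of scale" by (rule abelian_monoid_algebra_of)
  show ?thesis using assms by (induction A rule: finite_induct) simp_all
qed

lemma Units_algebra_of: "u \<in> Units (algebra_of scale) \<longleftrightarrow> (\<exists>y. y * u = 1 \<and> u * y = 1)"
  by (simp add: Units_def)

lemma inv_algebra_of:
  assumes "y * u = 1" "u * y = 1"
  shows "inv\<^bsub>algebra_of scale\<^esub> u = y"
  unfolding m_inv_def
proof (rule the_equality)
  show "y' = y" if "y' \<in> carrier (algebra_of scale) \<and> u \<otimes>\<^bsub>algebra_of scale\<^esub> y' = \<one>\<^bsub>algebra_of scale\<^esub> \<and>
      y' \<otimes>\<^bsub>algebra_of scale\<^esub> u = \<one>\<^bsub>algebra_of scale\<^esub>" for y'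
  proof -
    have "y' = y' * (u * y)" using assms by simp
    also have "\<dots> = y" using that by (simp flip: mult.assoc)
    finally show ?thesis .
  qed
qed (use assms in simp)

context unital_algebra
begin

lemma lin_eval_var:
  fixes a :: "'d :: finite \<Rightarrow> 'a"
  shows "lin_eval a (\<lambda>x. if x = Some i then 1 else 0) = a i"
proof -
  have "lin_eval a (\<lambda>x. if x = Some i then 1 else 0) = (\<Sum>x\<in>(UNIV :: 'd option set). if x = Some i then a i else 0)"
    unfolding lin_eval_def by (intro sum.cong refl) auto
  thus ?thesis by simp
qed

lemma val_word: "val a (word_rexp w) x \<longleftrightarrow> x = word_eval (algebra_of scale) a w"
  by (induction w arbitrary: x) (simp_all add: lin_eval_scalar lin_eval_var word_eval_def)

lemma val_words:
  "val a (words_rexp p ws) x \<longleftrightarrow>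
     x = (\<Sum>w\<leftarrow>ws. scale (Poly_Mapping.lookup p w) (word_eval (algebra_of scale) a w))"
  by (induction ws arbitrary: x) (simp_all add: lin_eval_zero lin_eval_scalar val_word scale_mult_left)

theorem val_rexp_of:
  "val a (rexp_of R) x \<longleftrightarrow> a \<in> nc_dom (algebra_of scale) R \<and> nc_eval (algebra_of scale) R a = x"
proof (induction R arbitrary: x)
  case (Poly p)
  define ws where "ws = (SOME ws. distinct ws \<and> set ws = Poly_Mapping.keys p)"
  have ws: "distinct ws" "set ws = Poly_Mapping.keys p"
    unfolding ws_def using someI_ex[of "\<lambda>ws. distinct ws \<and> set ws = Poly_Mapping.keys p"]
      finite_distinct_list[of "Poly_Mapping.keys p"] by auto
  have "(\<Sum>w\<leftarrow>ws. scale (Poly_Mapping.lookup p w) (word_eval (algebra_of scale) a w)) = poly_eval (algebra_of scale) p a"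
    unfolding poly_eval_def using sum_list_distinct_conv_sum_set[OF ws(1)] ws(2)
    by (simp add: finsum_algebra_of)
  thus ?case by (auto simp: val_words simp flip: ws_def)
next
  case (Inv R)
  show ?case
  proof
    assume "val a (rexp_of (nc_rat.Inv R)) x"
    then obtain u where u: "val a (rexp_of R) u" "u * x = 1" "x * u = 1" by auto
    hence "a \<in> nc_dom (algebra_of scale) R" "nc_eval (algebra_of scale) R a = u" using Inv.IH by auto
    thus "a \<in> nc_dom (algebra_of scale) (nc_rat.Inv R) \<and> nc_eval (algebra_of scale) (nc_rat.Inv R) a = x"
      using u inv_algebra_of[OF u(3,2)] by (auto simp: Units_algebra_of)
  next
    assume x: "a \<in> nc_dom (algebra_of scale) (nc_rat.Inv R) \<and> nc_eval (algebra_of scale) (nc_rat.Inv R) a = x"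
    define u where "u = nc_eval (algebra_of scale) R a"
    obtain y where y: "y * u = 1" "u * y = 1" using x by (auto simp: Units_algebra_of u_def)
    have "x = y" using x inv_algebra_of[OF y, of scale] by (simp add: u_def)
    moreover have "val a (rexp_of R) u" using x Inv.IH by (simp add: u_def)
    ultimately show "val a (rexp_of (nc_rat.Inv R)) x" using y by auto
  qed
qed auto

end

section \<open>Matrices as endomorphisms of an infinite-dimensional space\<close>

text \<open>
  The size of a matrix is not a type, so the matrix algebras of all sizes are embedded in one algebra,
  by letting an \<open>N \<times> N\<close> matrix act on each block of \<open>N\<close> consecutive coordinates.
\<close>

typedef (overloaded) ('k :: field) endo =
  "{f :: (nat \<Rightarrow> 'k) \<Rightarrow> nat \<Rightarrow> 'k. (\<forall>v w. f (\<lambda>n. v n + w n) = (\<lambda>n. f v n + f w n)) \<and>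
      (\<forall>c v. f (\<lambda>n. c * v n) = (\<lambda>n. c * f v n))}"
  by (rule exI[of _ "\<lambda>v n. 0"]) simp

lemma Rep_endo_add: "Rep_endo f (\<lambda>n. v n + w n) = (\<lambda>n. Rep_endo f v n + Rep_endo f w n)"
  and Rep_endo_scale: "Rep_endo f (\<lambda>n. c * v n) = (\<lambda>n. c * Rep_endo f v n)"
  using Rep_endo[of f] by blast+

lemma endo_eqI: "(\<And>v n. Rep_endo f v n = Rep_endo g v n) \<Longrightarrow> f = g"
  by (subst Rep_endo_inject[symmetric]) (intro ext)

instantiation endo :: (field) "{ring, monoid_mult}"
begin

definition "0 = Abs_endo (\<lambda>v n. 0)"
definition "1 = Abs_endo (\<lambda>v. v)"
definition "f + g = Abs_endo (\<lambda>v n. Rep_endo f v n + Rep_endo g v n)"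
definition "f - g = Abs_endo (\<lambda>v n. Rep_endo f v n - Rep_endo g v n)"
definition "- f = Abs_endo (\<lambda>v n. - Rep_endo f v n)"
definition "f * g = Abs_endo (\<lambda>v. Rep_endo f (Rep_endo g v))"

lemma Rep_endo_simps:
  "Rep_endo 0 v n = 0" "Rep_endo 1 v = v"
  "Rep_endo (f + g) v n = Rep_endo f v n + Rep_endo g v n"
  "Rep_endo (f - g) v n = Rep_endo f v n - Rep_endo g v n"
  "Rep_endo (- f) v n = - Rep_endo f v n"
  "Rep_endo (f * g) v = Rep_endo f (Rep_endo g v)"
  unfolding zero_endo_def one_endo_def plus_endo_def minus_endo_def uminus_endo_def times_endo_def
  by (subst Abs_endo_inverse; simp add: Rep_endo_add Rep_endo_scale algebra_simps)+

instance
proof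
  fix f g h :: "'a endo"
  show "f + g + h = f + (g + h)" "f + g = g + f" "0 + f = f" "- f + f = 0" "f - g = f + - g"
    "f * g * h = f * (g * h)" "1 * f = f" "f * 1 = f" "(f + g) * h = f * h + g * h"
    by (rule endo_eqI, simp add: Rep_endo_simps)+
  have "Rep_endo (g + h) v = (\<lambda>n. Rep_endo g v n + Rep_endo h v n)" for v
    by (rule ext) (simp add: Rep_endo_simps)
  thus "f * (g + h) = f * g + f * h"
    by (intro endo_eqI) (simp add: Rep_endo_simps Rep_endo_add)
qed

end

definition escale :: "'k :: field \<Rightarrow> 'k endo \<Rightarrow> 'k endo" where
  "escale c f = Abs_endo (\<lambda>v n. c * Rep_endo f v n)"

lemma Rep_endo_escale: "Rep_endo (escale c f) v n = c * Rep_endo f v n"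
  unfolding escale_def
  by (subst Abs_endo_inverse) (simp_all add: Rep_endo_add Rep_endo_scale algebra_simps)

interpretation endo: unital_algebra escale
proof
  fix c d :: "'k :: field" and f g :: "'k endo"
  show "escale c (f + g) = escale c f + escale c g" "escale (c + d) f = escale c f + escale d f"
    "escale c (escale d f) = escale (c * d) f" "escale 1 f = f" "escale c f * g = escale c (f * g)"
    by (rule endo_eqI, simp add: Rep_endo_simps Rep_endo_escale algebra_simps)+
  have "Rep_endo (escale c g) v = (\<lambda>n. c * Rep_endo g v n)" for v
    by (rule ext) (simp add: Rep_endo_escale)
  thus "f * escale c g = escale c (f * g)"
    by (intro endo_eqI) (simp add: Rep_endo_simps Rep_endo_escale Rep_endo_scale)
qed

lemma endo_zero_neq_one: "(0 :: 'k :: field endo) \<noteq> 1"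
proof
  assume "(0 :: 'k endo) = 1"
  hence "Rep_endo (0 :: 'k endo) (\<lambda>n. 1) 0 = Rep_endo 1 (\<lambda>n. 1) 0" by simp
  thus False by (simp add: Rep_endo_simps)
qed

text \<open>Acting on every block of coordinates, and not just on the first, makes the identity
  matrix act as the identity, so that units of matrices are units of the big algebra for each
  \<open>N\<close>.\<close>

definition block_endo :: "nat \<Rightarrow> (nat \<Rightarrow> nat \<Rightarrow> 'k :: field) \<Rightarrow> 'k endo" where
  "block_endo N A = Abs_endo (\<lambda>v n. \<Sum>q<N. A (n mod N) q * v (n div N * N + q))"

lemma Rep_block_endo: "Rep_endo (block_endo N A) v n = (\<Sum>q<N. A (n mod N) q * v (n div N * N + q))"
  unfolding block_endo_def
  by (subst Abs_endo_inverse) (simp_all add: algebra_simps sum.distrib sum_distrib_left)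

context
  fixes N :: nat
  assumes N: "N > 0"
begin

lemma block_endo_cong:
  assumes "\<And>p q. p < N \<Longrightarrow> q < N \<Longrightarrow> A p q = B p q"
  shows "block_endo N A = block_endo N B"
  by (rule endo_eqI) (use assms N in \<open>simp add: Rep_block_endo\<close>)

lemma block_endo_mult: "block_endo N A * block_endo N B = block_endo N (\<lambda>p q. \<Sum>k<N. A p k * B k q)"
proof (rule endo_eqI)
  fix v :: "nat \<Rightarrow> 'a" and n
  have "Rep_endo (block_endo N A * block_endo N B) v n =
      (\<Sum>k<N. \<Sum>q<N. A (n mod N) k * (B k q * v (n div N * N + q)))"
    unfolding Rep_endo_simps Rep_block_endo sum_distrib_left
    by (intro sum.cong refl) simp
  also have "\<dots> = (\<Sum>q<N. \<Sum>k<N. A (n mod N) k * (B k q * v (n div N * N + q)))"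
    by (rule sum.swap)
  finally show "Rep_endo (block_endo N A * block_endo N B) v n =
      Rep_endo (block_endo N (\<lambda>p q. \<Sum>k<N. A p k * B k q)) v n"
    by (simp add: Rep_block_endo sum_distrib_right mult.assoc)
qed

lemma block_endo_one: "block_endo N (\<lambda>p q. if p = q then 1 else 0) = 1"
proof (rule endo_eqI)
  fix v :: "nat \<Rightarrow> 'a" and n
  have "Rep_endo (block_endo N (\<lambda>p q. if p = q then 1 else 0)) v n =
      (\<Sum>q<N. if n mod N = q then v (n div N * N + n mod N) else 0)"
    unfolding Rep_block_endo by (intro sum.cong refl) auto
  thus "Rep_endo (block_endo N (\<lambda>p q. if p = q then 1 else 0)) v n = Rep_endo 1 v n"
    using N by (simp add: Rep_endo_simps)
qed

end

lemma block_endo_zero: "block_endo N (\<lambda>p q. 0) = 0"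
  by (rule endo_eqI) (simp add: Rep_block_endo Rep_endo_simps)

lemma block_endo_add: "block_endo N (\<lambda>p q. A p q + B p q) = block_endo N A + block_endo N B"
  by (rule endo_eqI) (simp add: Rep_block_endo Rep_endo_simps algebra_simps sum.distrib)

lemma block_endo_scale: "block_endo N (\<lambda>p q. c * A p q) = escale c (block_endo N A)"
  by (rule endo_eqI) (simp add: Rep_block_endo Rep_endo_escale sum_distrib_left mult.assoc)

lemma block_endo_sum: "block_endo N (\<lambda>p q. \<Sum>j\<in>J. A j p q) = (\<Sum>j\<in>J. block_endo N (A j))"
  by (induction J rule: infinite_finite_induct) (simp_all add: block_endo_zero block_endo_add)

definition mat_endo :: "nat \<Rightarrow> 'k :: field mat \<Rightarrow> 'k endo" where
  "mat_endo N A = block_endo N (\<lambda>p q. A $$ (p, q))"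

lemma module_mat_simps [simp]:
  "carrier (module_mat ty n m) = carrier_mat n m" "x \<otimes>\<^bsub>module_mat ty n m\<^esub> y = x * y"
  "\<one>\<^bsub>module_mat ty n m\<^esub> = 1\<^sub>m n" "\<zero>\<^bsub>module_mat ty n m\<^esub> = 0\<^sub>m n m"
  "x \<oplus>\<^bsub>module_mat ty n m\<^esub> y = x + y" "c \<odot>\<^bsub>module_mat ty n m\<^esub> y = c \<cdot>\<^sub>m y"
  by (simp_all add: module_mat_def)

lemma abelian_monoid_module_mat: "abelian_monoid (module_mat TYPE('k :: field) n m)"
  by (rule abelian_monoidI) (auto simp: assoc_add_mat comm_add_mat)

context
  fixes N :: nat
  assumes N: "N > 0"
begin

lemma mat_endo_mult:
  assumes "A \<in> carrier_mat N N" "B \<in> carrier_mat N N"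
  shows "mat_endo N (A * B) = mat_endo N A * mat_endo N B"
  unfolding mat_endo_def block_endo_mult[OF N]
  by (rule block_endo_cong[OF N]) (use assms in \<open>simp add: scalar_prod_def atLeast0LessThan\<close>)

lemma mat_endo_one: "mat_endo N (1\<^sub>m N) = 1"
  unfolding mat_endo_def block_endo_one[OF N, symmetric]
  by (rule block_endo_cong[OF N]) simp

lemma mat_endo_zero: "mat_endo N (0\<^sub>m N N) = 0"
  unfolding mat_endo_def block_endo_zero[of N, symmetric]
  by (rule block_endo_cong[OF N]) simp

lemma mat_endo_add:
  assumes "A \<in> carrier_mat N N" "B \<in> carrier_mat N N"
  shows "mat_endo N (A + B) = mat_endo N A + mat_endo N B"
  unfolding mat_endo_def block_endo_add[symmetric]
  by (rule block_endo_cong[OF N]) (use assms in simp)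

lemma mat_endo_scale:
  assumes "A \<in> carrier_mat N N"
  shows "mat_endo N (c \<cdot>\<^sub>m A) = escale c (mat_endo N A)"
  unfolding mat_endo_def block_endo_scale[symmetric]
  by (rule block_endo_cong[OF N]) (use assms in simp)

text \<open>A kernel vector of \<open>A\<close>, placed in the first block of coordinates, would be
  killed by the endomorphism, which has a left inverse. So \<open>A\<close> is injective, hence
  invertible.\<close>

lemma mat_endo_unit:
  assumes A: "A \<in> carrier_mat N N" and y: "y * mat_endo N A = 1"
  obtains B where "B \<in> carrier_mat N N" "B * A = 1\<^sub>m N" "A * B = 1\<^sub>m N"
proof -
  have "det A \<noteq> 0"
  proof
    assume "det A = 0"
    then obtain v where v: "v \<in> carrier_vec N" "v \<noteq> 0\<^sub>v N" "A *\<^sub>v v = 0\<^sub>v N"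
      using det_0_iff_vec_prod_zero_field[OF A] by blast
    define w where "w = (\<lambda>n. if n < N then v $ n else 0)"
    have "Rep_endo (mat_endo N A) w n = 0" for n
    proof (cases "n < N")
      case True
      have "(A *\<^sub>v v) $ n = 0" using v(3) True by simp
      thus ?thesis using True A v(1)
        by (simp add: mat_endo_def Rep_block_endo w_def scalar_prod_def atLeast0LessThan)
    next
      case False
      hence "1 \<le> n div N" using div_le_mono[of N n N] N by simp
      hence "N \<le> n div N * N" using mult_le_mono1[of 1 "n div N" N] by simp
      hence "\<not> n div N * N + q < N" for q by linarith
      hence "w (n div N * N + q) = 0" for q unfolding w_def by (simp only: if_False)
      thus ?thesis by (simp add: mat_endo_def Rep_block_endo)
    qed
    hence "Rep_endo (mat_endo N A) w = (\<lambda>n. 0)" by (simp add: fun_eq_iff)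
    moreover have "Rep_endo y (\<lambda>n. 0) = (\<lambda>n. 0)" using Rep_endo_scale[of y 0 w] by simp
    ultimately have "Rep_endo (y * mat_endo N A) w n = 0" for n by (simp add: Rep_endo_simps)
    hence "w n = 0" for n unfolding y by (simp add: Rep_endo_simps)
    hence "v = 0\<^sub>v N" using v(1) by (intro eq_vecI) (auto simp: w_def split: if_splits, metis)
    thus False using v(2) by simp
  qed
  from det_non_zero_imp_unit[OF A this, of undefined] that show ?thesis
    unfolding Units_def by (auto simp: ring_mat_simps)
qed

lemma word_eval_mat:
  assumes V: "\<And>i. V i \<in> carrier_mat N N"
  shows "word_eval (module_mat TYPE('k :: field) N N) V w \<in> carrier_mat N N \<and>
    mat_endo N (word_eval (module_mat TYPE('k) N N) V w) = word_eval (algebra_of escale) (\<lambda>i. mat_endo N (V i)) w"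
proof (induction w)
  case (Cons i w)
  thus ?case using V[of i] by (auto simp: word_eval_def mat_endo_mult)
qed (simp add: word_eval_def mat_endo_one)

lemma finsum_mat:
  assumes "finite J" "\<And>j. j \<in> J \<Longrightarrow> f j \<in> carrier_mat N N"
  shows "finsum (module_mat TYPE('k :: field) N N) f J \<in> carrier_mat N N \<and>
    mat_endo N (finsum (module_mat TYPE('k) N N) f J) = (\<Sum>j\<in>J. mat_endo N (f j))"
proof -
  interpret M: abelian_monoid "module_mat TYPE('k) N N" by (rule abelian_monoid_module_mat)
  show ?thesis using assms
  proof (induction J rule: finite_induct)
    case empty
    thus ?case using M.finsum_empty by (simp add: mat_endo_zero)
  next
    case (insert j J)
    have "finsum (module_mat TYPE('k) N N) f (insert j J) = f j + finsum (module_mat TYPE('k) N N) f J"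
      using M.finsum_insert[OF insert.hyps, of f] insert.prems by auto
    thus ?case using insert by (simp add: mat_endo_add)
  qed
qed

text \<open>At an inversion the inverse in the big algebra need not come from a matrix a priori;
  \<open>mat_endo_unit\<close> produces the matrix inverse, and uniqueness of inverses identifies
  the two.\<close>

theorem nc_dom_mat:
  fixes V :: "'d \<Rightarrow> 'k :: field mat"
  assumes V: "\<And>i. V i \<in> carrier_mat N N"
  shows "(\<lambda>i. mat_endo N (V i)) \<in> nc_dom (algebra_of escale) R \<Longrightarrow>
    V \<in> nc_dom (module_mat TYPE('k) N N) R \<and>
    nc_eval (module_mat TYPE('k) N N) R V \<in> carrier_mat N N \<and>
    mat_endo N (nc_eval (module_mat TYPE('k) N N) R V) = nc_eval (algebra_of escale) R (\<lambda>i. mat_endo N (V i))"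
proof (induction R)
  case (Poly p)
  note w = word_eval_mat[of V, OF V]
  have "poly_eval (module_mat TYPE('k) N N) p V \<in> carrier_mat N N \<and>
      mat_endo N (poly_eval (module_mat TYPE('k) N N) p V) = poly_eval (algebra_of escale) p (\<lambda>i. mat_endo N (V i))"
    unfolding poly_eval_def finsum_algebra_of[OF finite_keys]
    using finsum_mat[OF finite_keys, of p "\<lambda>w. Poly_Mapping.lookup p w \<odot>\<^bsub>module_mat TYPE('k) N N\<^esub> word_eval (module_mat TYPE('k) N N) V w"] w
    by (simp add: mat_endo_scale)
  thus ?case using V by simp
next
  case (Add R S)
  thus ?case by (simp add: mat_endo_add)
next
  case (Mult R S)
  thus ?case by (auto simp: mat_endo_mult)
next
  case (Inv R)
  define A where "A = nc_eval (module_mat TYPE('k) N N) R V"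
  define u where "u = nc_eval (algebra_of escale) R (\<lambda>i. mat_endo N (V i))"
  have IH: "V \<in> nc_dom (module_mat TYPE('k) N N) R" "A \<in> carrier_mat N N" "mat_endo N A = u"
    using Inv by (auto simp: A_def u_def)
  obtain y where y: "y * u = 1" "u * y = 1" using Inv.prems by (auto simp: Units_algebra_of u_def)
  have yA: "y * mat_endo N A = 1" using y IH(3) by simp
  obtain B where B: "B \<in> carrier_mat N N" "B * A = 1\<^sub>m N" "A * B = 1\<^sub>m N"
    using mat_endo_unit[OF IH(2) yA] by blast
  have "inv\<^bsub>module_mat TYPE('k) N N\<^esub> A = B" unfolding m_inv_def
  proof (rule the_equality)
    show "B' = B" if "B' \<in> carrier (module_mat TYPE('k) N N) \<and> A \<otimes>\<^bsub>module_mat TYPE('k) N N\<^esub> B' = \<one>\<^bsub>module_mat TYPE('k) N N\<^esub> \<and>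
        B' \<otimes>\<^bsub>module_mat TYPE('k) N N\<^esub> A = \<one>\<^bsub>module_mat TYPE('k) N N\<^esub>" for B'
    proof -
      have B': "B' \<in> carrier_mat N N" "B' * A = 1\<^sub>m N" using that by auto
      have "B' = B' * (A * B)" using B' B by simp
      also have "\<dots> = (B' * A) * B" by (rule assoc_mult_mat[OF B'(1) IH(2) B(1), symmetric])
      also have "\<dots> = B" unfolding B'(2) by (rule left_mult_one_mat[OF B(1)])
      finally show ?thesis .
    qed
  qed (use B in simp)
  moreover have "mat_endo N B = inv\<^bsub>algebra_of escale\<^esub> u"
  proof (rule inv_algebra_of[symmetric])
    show "mat_endo N B * u = 1"
      unfolding IH(3)[symmetric] mat_endo_mult[OF B(1) IH(2), symmetric] B(2) by (rule mat_endo_one)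
    show "u * mat_endo N B = 1"
      unfolding IH(3)[symmetric] mat_endo_mult[OF IH(2) B(1), symmetric] B(3) by (rule mat_endo_one)
  qed
  moreover have "A \<in> Units (module_mat TYPE('k) N N)" using B IH(2) by (auto simp: Units_def)
  ultimately show ?case using IH(1) B(1) by (simp add: A_def u_def)
qed

end

section \<open>The pencil of a rational expression\<close>

text \<open>
  Direct sum of the one-by-one pencil \<open>x\<^sub>0\<close> (index \<open>None\<close>), which makes the variable of the constant
  terms invertible, and of the systems of all subexpressions. Invertibility of this pencil at a point
  is equivalent to the point being in the domain.
\<close>

definition block_index :: "('k, 'd) rexp option \<Rightarrow> nat list set" where
  "block_index b = (case b of None \<Rightarrow> {[]} | Some r \<Rightarrow> inner r)"

definition block_pencil :: "('k :: comm_ring_1, 'd) rexp option \<Rightarrow> 'd option \<Rightarrow> nat list \<Rightarrow> nat list \<Rightarrow> 'k" where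
  "block_pencil b x i j = (case b of None \<Rightarrow> scalar 1 x | Some r \<Rightarrow> pencil r x i j)"

definition system_index :: "('k, 'd) rexp \<Rightarrow> (('k, 'd) rexp option \<times> nat list) set" where
  "system_index r = Sigma (insert None (Some ` subs r)) block_index"

definition system_pencil ::
  "'d option \<Rightarrow> ('k :: comm_ring_1, 'd) rexp option \<times> nat list \<Rightarrow> ('k, 'd) rexp option \<times> nat list \<Rightarrow> 'k" where
  "system_pencil x s t = (if fst s = fst t then block_pencil (fst s) x (snd s) (snd t) else 0)"

lemma finite_system_index: "finite (system_index r)"
  unfolding system_index_def
  by (intro finite_SigmaI) (auto simp: finite_subs block_index_def finite_inner split: option.split)

lemma sum_block:
  assumes "finite (Sigma Bs J)" "b0 \<in> Bs" "\<And>b j. b \<noteq> b0 \<Longrightarrow> g (b, j) = 0"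
  shows "(\<Sum>t\<in>Sigma Bs J. g t) = (\<Sum>j\<in>J b0. g (b0, j))"
proof -
  have "(\<Sum>t\<in>Sigma Bs J. g t) = (\<Sum>t\<in>Pair b0 ` J b0. g t)"
  proof (rule sum.mono_neutral_right)
    show "\<forall>t\<in>Sigma Bs J - Pair b0 ` J b0. g t = 0"
    proof
      fix t assume t: "t \<in> Sigma Bs J - Pair b0 ` J b0"
      obtain b j where bj: "t = (b, j)" by (cases t)
      have "b \<noteq> b0" using t bj by auto
      thus "g t = 0" using assms(3) bj by simp
    qed
  qed (use assms in auto)
  also have "\<dots> = (\<Sum>j\<in>J b0. g (b0, j))"
    by (subst sum.reindex) (auto simp: inj_on_def)
  finally show ?thesis .
qed

text \<open>Restricted to the rows in \<open>J\<close>, the factor \<open>P\<close> is square and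
  \<open>Q W\<close> is a right inverse of it; stable finiteness makes this a left inverse. The
  vector \<open>y\<close>, the image under \<open>Q\<close> of \<open>u\<close> with entry 1 at
  \<open>z\<close>, is killed by these rows, hence zero, and then row \<open>z\<close> vanishes on
  it too.\<close>

lemma schur_complement_zero:
  fixes Z :: "'s \<Rightarrow> 's \<Rightarrow> 'a :: {ring, monoid_mult}"
  assumes sf: "stably_finite TYPE('a)" and fin: "finite J" "finite R" and card: "card R = card J"
    and Z: "\<And>s t. s \<in> insert z J \<Longrightarrow> t \<in> insert z J \<Longrightarrow> Z s t = (\<Sum>c\<in>R. P s c * Q c t)"
    and W: "\<And>s s'. s \<in> J \<Longrightarrow> s' \<in> J \<Longrightarrow> (\<Sum>t\<in>J. Z s t * W t s') = (if s = s' then 1 else 0)"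
    and u: "\<And>s. s \<in> J \<Longrightarrow> (\<Sum>t\<in>J. Z s t * u t) + Z s z = 0"
  shows "(\<Sum>t\<in>J. Z z t * u t) + Z z z = 0"
proof -
  have prod: "(\<Sum>t\<in>J. Z s t * v t) = (\<Sum>c\<in>R. P s c * (\<Sum>t\<in>J. Q c t * v t))" if s: "s \<in> insert z J" for s v
  proof -
    have "(\<Sum>t\<in>J. Z s t * v t) = (\<Sum>t\<in>J. \<Sum>c\<in>R. P s c * (Q c t * v t))"
      using Z[OF s] by (intro sum.cong refl) (simp add: sum_distrib_right mult.assoc)
    also have "\<dots> = (\<Sum>c\<in>R. \<Sum>t\<in>J. P s c * (Q c t * v t))" by (rule sum.swap)
    finally show ?thesis by (simp add: sum_distrib_left)
  qed
  define B where "B = (\<lambda>c s'. \<Sum>t\<in>J. Q c t * W t s')"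
  have PB: "(\<Sum>c\<in>R. P s c * B c s') = (if s = s' then 1 else 0)" if "s \<in> J" "s' \<in> J" for s s'
    using W[OF that] prod[of s "\<lambda>t. W t s'"] that by (simp add: B_def)
  have BP: "(\<Sum>s\<in>J. B c s * P s c') = (if c = c' then 1 else 0)" if "c \<in> R" "c' \<in> R" for c c'
    by (rule stably_finite_index[OF sf fin card[symmetric] PB that])
  define y where "y = (\<lambda>c. (\<Sum>t\<in>J. Q c t * u t) + Q c z)"
  have Py: "(\<Sum>c\<in>R. P s c * y c) = (\<Sum>t\<in>J. Z s t * u t) + Z s z" if "s \<in> insert z J" for s
    using Z[OF that, of z] prod[OF that, of u] by (simp add: y_def distrib_left sum.distrib)
  have "y c = 0" if c: "c \<in> R" for c
  proof -
    have "y c = (\<Sum>c'\<in>R. (if c = c' then 1 else 0) * y c')"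
      using c fin by (simp add: if_distrib[of "\<lambda>x. x * _"] cong: if_cong)
    also have "\<dots> = (\<Sum>c'\<in>R. (\<Sum>s\<in>J. B c s * P s c') * y c')"
      using BP[OF c] by (intro sum.cong) auto
    also have "\<dots> = (\<Sum>s\<in>J. B c s * (\<Sum>c'\<in>R. P s c' * y c'))"
      unfolding sum_distrib_left sum_distrib_right mult.assoc by (rule sum.swap)
    also have "\<dots> = 0" using Py u by (intro sum.neutral) auto
    finally show ?thesis .
  qed
  thus ?thesis using Py[of z] by simp
qed

section \<open>The full system evaluated in an algebra\<close>

context unital_algebra
begin

lemma inverse_imp_system:
  assumes left: "\<And>i i'. i \<in> inner r \<Longrightarrow> i' \<in> inner r \<Longrightarrow> (\<Sum>j\<in>inner r. W i j * entry a r j i') = (if i = i' then 1 else 0)"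
    and right: "\<And>i i'. i \<in> inner r \<Longrightarrow> i' \<in> inner r \<Longrightarrow> (\<Sum>j\<in>inner r. entry a r i j * W j i') = (if i = i' then 1 else 0)"
  shows "uniq a r \<and> solv a r"
proof
  have row_split: "row a r i w = entry a r i [] * w [] + (\<Sum>j\<in>inner r. entry a r i j * w j)" for i w
    unfolding row_def using finite_inner Nil_notin_inner by (subst sum.insert) auto
  have pick: "(\<Sum>k\<in>inner r. (if i = k then 1 else 0) * v k) = v i" if "i \<in> inner r" for i and v :: "_ \<Rightarrow> 'a"
    using that finite_inner[of r] by (simp add: if_distrib[of "\<lambda>x. x * _"] cong: if_cong)
  show "uniq a r" unfolding uniq_def
  proof (intro allI impI ballI)
    fix w i assume w: "w [] = 0" "\<forall>i\<in>inner r. row a r i w = 0" and i: "i \<in> inner r"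
    have "w i = (\<Sum>k\<in>inner r. (\<Sum>j\<in>inner r. W i j * entry a r j k) * w k)"
      using pick[OF i, of w] left[OF i] by simp
    also have "\<dots> = (\<Sum>j\<in>inner r. W i j * (\<Sum>k\<in>inner r. entry a r j k * w k))"
      unfolding sum_distrib_left sum_distrib_right mult.assoc by (rule sum.swap)
    also have "\<dots> = 0" using w row_split by (intro sum.neutral) auto
    finally show "w i = 0" .
  qed
  show "solv a r" unfolding solv_def
  proof (intro allI)
    fix g y
    define h where "h = (\<lambda>i. g i - entry a r i [] * y)"
    define w where "w = (\<lambda>k. if k = [] then y else \<Sum>i\<in>inner r. W k i * h i)"
    have "row a r j w = g j" if j: "j \<in> inner r" for j
    proof -
      have "(\<Sum>k\<in>inner r. entry a r j k * w k) = (\<Sum>k\<in>inner r. entry a r j k * (\<Sum>i\<in>inner r. W k i * h i))"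
        using Nil_notin_inner[of r] by (intro sum.cong refl) (auto simp: w_def)
      also have "\<dots> = (\<Sum>i\<in>inner r. (\<Sum>k\<in>inner r. entry a r j k * W k i) * h i)"
        unfolding sum_distrib_left sum_distrib_right mult.assoc by (rule sum.swap)
      also have "\<dots> = h j" using right[OF j] pick[OF j, of h] by simp
      finally show ?thesis unfolding row_split by (simp add: w_def h_def)
    qed
    thus "\<exists>w. w [] = y \<and> (\<forall>i\<in>inner r. row a r i w = g i)"
      by (intro exI[of _ w]) (simp add: w_def)
  qed
qed

definition system_entry where
  "system_entry a s t = lin_eval a (\<lambda>x. system_pencil x s t)"

lemma system_entry_simps:
  "b \<noteq> b' \<Longrightarrow> system_entry a (b, i) (b', j) = 0"
  "system_entry a (None, i) (None, j) = 1"
  "system_entry a (Some r, i) (Some r, j) = entry a r i j"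
  using lin_eval_scalar[of a 1]
  by (simp_all add: system_entry_def system_pencil_def block_pencil_def entry_def lin_eval_zero scalar_def[abs_def])

lemma system_row:
  assumes r: "r \<in> subs F" and s: "s \<in> system_index F" and w: "w [] = 0"
  shows "(\<Sum>t\<in>system_index F. system_entry a s t * (if fst t = Some r then w (snd t) else 0)) =
    (if fst s = Some r then row a r (snd s) w else 0)"
proof -
  have "(\<Sum>t\<in>system_index F. system_entry a s t * (if fst t = Some r then w (snd t) else 0)) =
      (\<Sum>j\<in>block_index (Some r). system_entry a s (Some r, j) * w j)"
    unfolding system_index_def
    by (subst sum_block[where ?b0.0 = "Some r"]) (use r finite_system_index[of F] in \<open>auto simp: system_index_def\<close>)
  also have "\<dots> = (if fst s = Some r then row a r (snd s) w else 0)"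
  proof (cases "fst s = Some r")
    case True
    then obtain i where i: "s = (Some r, i)" by (cases s) auto
    show ?thesis
      using w finite_inner[of r] Nil_notin_inner[of r]
      by (simp add: i block_index_def system_entry_simps row_def)
  next
    case False
    thus ?thesis by (cases s) (auto simp: system_entry_simps)
  qed
  finally show ?thesis .
qed

lemma size_subs: "r \<in> subs E \<Longrightarrow> size r \<le> size E"
  by (induction E) auto

text \<open>The row and column singled out have index \<open>[2]\<close> in the block of
  \<open>RInv E\<close>. Without them the system is right invertible at \<open>a\<close>, since
  \<open>E\<close> and its subexpressions have values there; the Schur complement belonging to
  \<open>[2]\<close> is the value of \<open>E\<close>.\<close>

theorem factored_system_val_zero:
  assumes sf: "stably_finite TYPE('a)" and E: "val a E x"
    and R: "finite R" "card R = card (system_index (RInv E)) - 1"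
    and PQ: "\<And>s t. s \<in> system_index (RInv E) \<Longrightarrow> t \<in> system_index (RInv E) \<Longrightarrow>
      system_entry a s t = (\<Sum>c\<in>R. P s c * Q c t)"
  shows "x = 0"
proof -
  let ?F = "RInv E"
  define I where "I = system_index ?F"
  define z where "z = (Some ?F, [2 :: nat])"
  define J where "J = I - {z}"
  have finI: "finite I" by (simp add: I_def finite_system_index)
  have finJ: "finite J" using finI by (simp add: J_def)
  have F_sub: "?F \<in> subs ?F" by simp
  have zI: "z \<in> I" by (simp add: I_def z_def system_index_def block_index_def)
  have IJ: "insert z J = I" using zI by (auto simp: J_def)
  have cardR: "card R = card J" using R(2) zI finI by (simp add: J_def I_def)
  \<comment> \<open>By size; the block of \<open>RInv E\<close> is thus different from the blocks of
    the subexpressions of \<open>E\<close>.\<close>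
  have F_notin: "?F \<notin> subs E" using size_subs[of ?F E] by auto
  have sum_I: "(\<Sum>t\<in>J. system_entry a s t * v t) = (\<Sum>t\<in>I. system_entry a s t * v t) - system_entry a s z * v z" for s v
    unfolding J_def using sum.remove[OF finI zI, of "\<lambda>t. system_entry a s t * v t"] by simp
  have sysE: "uniq a E" "solv a E" "io a E x" using val_imp_system[OF E] by auto
  have row_F: "row a ?F (0 # i) (mk 0 y w w) = row a E i w" if "i \<in> inner E" "w [] = y" for i y w
    unfolding row_simps(8)[OF that(1)] sel_mk(3)[of w, OF that(2)] ..
  have "\<exists>v. \<forall>s\<in>J. (\<Sum>t\<in>J. system_entry a s t * v t) = (if s = s' then 1 else 0)" if s': "s' \<in> J" for s'
  proof -
    obtain b i' where bi: "s' = (b, i')" "(b, i') \<in> I" "(b, i') \<noteq> z" using s' by (cases s') (auto simp: J_def)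
    have "b = None \<or> (\<exists>r\<in>subs E. b = Some r) \<or> b = Some ?F"
      using bi(2) by (auto simp: I_def system_index_def)
    \<comment> \<open>Column \<open>s'\<close> of the right inverse is found inside its own block:
      the trivial block, the system of a subexpression of \<open>E\<close>, or the block of
      \<open>RInv E\<close>, which without \<open>z\<close> is a copy of the system of
      \<open>E\<close>.\<close>
    then consider "b = None" | r where "r \<in> subs E" "b = Some r" | "b = Some ?F" by blast
    thus ?thesis
    proof cases
      case 1
      hence i': "i' = []" using bi(2) by (auto simp: I_def system_index_def block_index_def)
      show ?thesis
      proof (rule exI[of _ "\<lambda>t. if t = s' then 1 else 0"], rule ballI)
        fix s assume s: "s \<in> J"
        have "(\<Sum>t\<in>J. system_entry a s t * (if t = s' then 1 else 0)) = system_entry a s s'"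
          using s' finJ by (simp add: if_distrib[of "\<lambda>x. _ * x"] cong: if_cong)
        also have "\<dots> = (if s = s' then 1 else 0)"
        proof (cases "fst s = None")
          case True
          hence "s = s'" using s i' bi(1) 1
            by (cases s) (auto simp: J_def I_def system_index_def block_index_def)
          thus ?thesis using bi(1) 1 by (simp add: system_entry_simps)
        next
          case False
          thus ?thesis using bi(1) 1 by (cases s) (auto simp: system_entry_simps)
        qed
        finally show "(\<Sum>t\<in>J. system_entry a s t * (if t = s' then 1 else 0)) = (if s = s' then 1 else 0)" .
      qed
    next
      case 2
      obtain x' where "val a r x'" using val_subs[OF E 2(1)] by blast
      hence "solv a r" using val_imp_system by blast
      then obtain w where w: "w [] = 0" "\<forall>i\<in>inner r. row a r i w = (if i = i' then 1 else 0)"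
        using solvD[of a r 0 "\<lambda>i. if i = i' then 1 else 0"] by blast
      have r: "r \<in> subs ?F" "r \<noteq> ?F" using 2 F_notin by auto
      show ?thesis
      proof (rule exI[of _ "\<lambda>t. if fst t = Some r then w (snd t) else 0"], rule ballI)
        fix s assume s: "s \<in> J"
        hence sI: "s \<in> system_index ?F" by (simp add: J_def I_def)
        have "(\<Sum>t\<in>J. system_entry a s t * (if fst t = Some r then w (snd t) else 0)) =
            (if fst s = Some r then row a r (snd s) w else 0)"
          unfolding sum_I unfolding I_def system_row[where w = w, OF r(1) sI w(1)] using r(2) by (simp add: z_def)
        also have "\<dots> = (if s = s' then 1 else 0)"
          using w(2) sI bi(1) 2(2) by (cases s) (auto simp: system_index_def block_index_def)
        finally show "(\<Sum>t\<in>J. system_entry a s t * (if fst t = Some r then w (snd t) else 0)) = (if s = s' then 1 else 0)" .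
      qed
    next
      case 3
      then obtain i1 where i1: "i' = 0 # i1" "i1 \<in> inner E"
        using bi(2,3) by (auto simp: I_def system_index_def block_index_def z_def)
      obtain w where w: "w [] = 0" "\<forall>i\<in>inner E. row a E i w = (if i = i1 then 1 else 0)"
        using solvD[OF sysE(2), of 0 "\<lambda>i. if i = i1 then 1 else 0"] by blast
      \<comment> \<open>The entry 0 at \<open>[2]\<close>, that is at \<open>z\<close>, lets the sum
        over \<open>I\<close> replace the sum over \<open>J\<close>.\<close>
      let ?w = "mk 0 0 w w"
      have w0: "?w [] = 0" "?w [2] = 0" by (simp_all add: mk_def)
      show ?thesis
      proof (rule exI[of _ "\<lambda>t. if fst t = Some ?F then ?w (snd t) else 0"], rule ballI)
        fix s assume s: "s \<in> J"
        hence sI: "s \<in> system_index ?F" by (simp add: J_def I_def)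
        have "(\<Sum>t\<in>J. system_entry a s t * (if fst t = Some ?F then ?w (snd t) else 0)) =
            (if fst s = Some ?F then row a ?F (snd s) ?w else 0)"
          unfolding sum_I unfolding I_def system_row[where w = ?w, OF F_sub sI w0(1)] using w0(2) by (simp add: z_def)
        also have "\<dots> = (if s = s' then 1 else 0)"
        proof (cases "fst s = Some ?F")
          case True
          then obtain i where i: "s = (Some ?F, 0 # i)" "i \<in> inner E"
            using s by (cases s) (auto simp: J_def I_def system_index_def block_index_def z_def)
          show ?thesis using row_F[of _ w, OF i(2) w(1)] w(2) i i1 bi(1) 3 by simp
        next
          case False
          thus ?thesis using bi(1) 3 by auto
        qed
        finally show "(\<Sum>t\<in>J. system_entry a s t * (if fst t = Some ?F then ?w (snd t) else 0)) = (if s = s' then 1 else 0)" .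
      qed
    qed
  qed
  hence "\<forall>s'. \<exists>v. s' \<in> J \<longrightarrow> (\<forall>s\<in>J. (\<Sum>t\<in>J. system_entry a s t * v t) = (if s = s' then 1 else 0))" by blast
  from choice[OF this] obtain W where
    W: "\<forall>s'. s' \<in> J \<longrightarrow> (\<forall>s\<in>J. (\<Sum>t\<in>J. system_entry a s t * W s' t) = (if s = s' then 1 else 0))" by blast
  obtain w where w: "w [] = 1" "\<forall>i\<in>inner E. row a E i w = 0"
    using solvD[OF sysE(2), of 1 "\<lambda>_. 0"] by blast
  \<comment> \<open>Input 1 for \<open>E\<close> at \<open>[2]\<close> and 0 at \<open>[]\<close>:
    the rows of the copy of \<open>E\<close> vanish and row \<open>[2]\<close> becomes the value of
    \<open>E\<close>.\<close>
  let ?w = "mk 0 1 w w"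
  have w0: "?w [] = 0" "?w [2] = 1" by (simp_all add: mk_def)
  define u where "u = (\<lambda>t. if fst t = Some ?F then ?w (snd t) else 0)"
  have uz: "u z = 1" using w0(2) by (simp add: u_def z_def)
  have total: "(\<Sum>t\<in>J. system_entry a s t * u t) + system_entry a s z = (if fst s = Some ?F then row a ?F (snd s) ?w else 0)"
    if "s \<in> I" for s
    unfolding sum_I uz using system_row[where w = ?w, OF F_sub that[unfolded I_def] w0(1), of a] by (simp add: u_def I_def)
  have "(\<Sum>t\<in>J. system_entry a z t * u t) + system_entry a z z = 0"
  proof (rule schur_complement_zero[OF sf finJ R(1) cardR, where W = "\<lambda>t s'. W s' t" and P = P and Q = Q])
    show "system_entry a s t = (\<Sum>c\<in>R. P s c * Q c t)" if "s \<in> insert z J" "t \<in> insert z J" for s t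
      using PQ that unfolding IJ I_def by blast
    show "(\<Sum>t\<in>J. system_entry a s t * W s' t) = (if s = s' then 1 else 0)" if "s \<in> J" "s' \<in> J" for s s'
      using W that by blast
    show "(\<Sum>t\<in>J. system_entry a s t * u t) + system_entry a s z = 0" if s: "s \<in> J" for s
    proof (cases "fst s = Some ?F")
      case True
      then obtain i where i: "s = (Some ?F, 0 # i)" "i \<in> inner E"
        using s by (cases s) (auto simp: J_def I_def system_index_def block_index_def z_def)
      have "s \<in> I" using s by (simp add: J_def)
      thus ?thesis using row_F[of _ w, OF i(2) w(1)] w(2) i by (simp add: total)
    next
      case False
      have "s \<in> I" using s by (simp add: J_def)
      thus ?thesis using False by (simp add: total)
    qed
  qed
  hence "row a ?F [2] ?w = 0" using total[OF zI] by (simp add: z_def)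
  hence "row a E [] w = 0" unfolding row_simps(9) sel_mk(3)[of w, OF w(1)] by (simp add: mk_def)
  thus "x = 0" using ioD[OF sysE(3), of w] w by simp
qed

text \<open>\<open>M\<close> is written as \<open>(M S) S'\<close>. The first \<open>u\<close>
  columns of \<open>M S\<close> factor through \<open>u - 1\<close> coordinates and the other
  \<open>card I - u\<close> are kept, so one coordinate is saved; its number \<open>u - 1\<close> is
  removed from the index set. \<open>S\<close>, \<open>S'\<close> and \<open>B\<close> consist of
  scalars, which are central, so this persists after evaluation.\<close>

lemma pencil_factorization:
  fixes M :: "'d :: finite option \<Rightarrow> 's \<Rightarrow> 's \<Rightarrow> 'k"
  assumes fin: "finite I" and u: "0 < u" "u \<le> card I"
    and S: "\<And>i i'. i \<in> I \<Longrightarrow> i' \<in> I \<Longrightarrow> (\<Sum>b<card I. S i b * S' b i') = (if i = i' then 1 else 0)"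
    and MS: "\<And>x i b. i \<in> I \<Longrightarrow> b < u \<Longrightarrow> (\<Sum>j\<in>I. M x i j * S j b) = (\<Sum>l<u - 1. B i l * C x l b)"
  shows "\<exists>P Q. \<forall>s\<in>I. \<forall>t\<in>I. lin_eval a (\<lambda>x. M x s t) = (\<Sum>c\<in>{..<card I} - {u - 1}. P s c * Q c t)"
proof -
  define n where "n = card I"
  define Z where "Z = (\<lambda>s t. lin_eval a (\<lambda>x. M x s t))"
  define P where "P = (\<lambda>s c. if c < u - 1 then scale (B s c) 1 else (\<Sum>j\<in>I. scale (S j c) (Z s j)))"
  define Q where "Q = (\<lambda>c t. if c < u - 1 then (\<Sum>b<u. scale (S' b t) (lin_eval a (\<lambda>x. C x c b))) else scale (S' c t) 1)"
  have lin_sum: "lin_eval a (\<lambda>x. \<Sum>j\<in>J. l j x) = (\<Sum>j\<in>J. lin_eval a (l j))" for J :: "'j set" and l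
    by (induction J rule: infinite_finite_induct) (simp_all add: lin_eval_zero lin_eval_add)
  have lin_scale: "lin_eval a (\<lambda>x. c * l x) = scale c (lin_eval a l)" for c l
    by (simp add: lin_eval_def scale_sum_right)
  have ZS: "(\<Sum>j\<in>I. scale (S j b) (Z s j)) = (\<Sum>l<u - 1. scale (B s l) (lin_eval a (\<lambda>x. C x l b)))"
    if "s \<in> I" "b < u" for s b
  proof -
    have "(\<Sum>j\<in>I. scale (S j b) (Z s j)) = lin_eval a (\<lambda>x. \<Sum>j\<in>I. M x s j * S j b)"
      unfolding Z_def lin_sum lin_scale[symmetric] by (simp add: mult.commute)
    also have "\<dots> = lin_eval a (\<lambda>x. \<Sum>l<u - 1. B s l * C x l b)" using MS[OF that] by simp
    finally show ?thesis unfolding lin_sum lin_scale .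
  qed
  have "Z s t = (\<Sum>c\<in>{..<n} - {u - 1}. P s c * Q c t)" if st: "s \<in> I" "t \<in> I" for s t
  proof -
    have "Z s t = (\<Sum>j\<in>I. scale (\<Sum>b<n. S j b * S' b t) (Z s j))"
      using S st(2) fin st
      by (simp add: n_def if_distrib[of "\<lambda>c. scale c _"] cong: if_cong)
    also have "\<dots> = (\<Sum>b<n. scale (S' b t) (\<Sum>j\<in>I. scale (S j b) (Z s j)))"
      unfolding scale_sum_left scale_sum_right
      by (subst sum.swap) (simp add: mult.commute)
    also have "\<dots> = (\<Sum>b\<in>{..<u} \<union> {u..<n}. scale (S' b t) (\<Sum>j\<in>I. scale (S j b) (Z s j)))"
      by (rule sum.cong) (use u in \<open>auto simp: n_def\<close>)
    also have "\<dots> = (\<Sum>b<u. scale (S' b t) (\<Sum>j\<in>I. scale (S j b) (Z s j))) +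
        (\<Sum>b\<in>{u..<n}. scale (S' b t) (\<Sum>j\<in>I. scale (S j b) (Z s j)))"
      by (rule sum.union_disjoint) auto
    also have "(\<Sum>b<u. scale (S' b t) (\<Sum>j\<in>I. scale (S j b) (Z s j))) = (\<Sum>c<u - 1. P s c * Q c t)"
    proof -
      have "(\<Sum>b<u. scale (S' b t) (\<Sum>j\<in>I. scale (S j b) (Z s j))) =
          (\<Sum>b<u. \<Sum>c<u - 1. scale (B s c) (scale (S' b t) (lin_eval a (\<lambda>x. C x c b))))"
        using ZS[OF st(1)] by (intro sum.cong refl) (simp add: scale_sum_right mult.commute)
      also have "\<dots> = (\<Sum>c<u - 1. \<Sum>b<u. scale (B s c) (scale (S' b t) (lin_eval a (\<lambda>x. C x c b))))"
        by (rule sum.swap)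
      also have "\<dots> = (\<Sum>c<u - 1. P s c * Q c t)"
        by (intro sum.cong refl) (simp add: P_def Q_def scale_mult_left scale_sum_right)
      finally show ?thesis .
    qed
    also have "(\<Sum>b\<in>{u..<n}. scale (S' b t) (\<Sum>j\<in>I. scale (S j b) (Z s j))) = (\<Sum>c\<in>{u..<n}. P s c * Q c t)"
      by (intro sum.cong refl) (auto simp: P_def Q_def scale_mult_right)
    also have "(\<Sum>c<u - 1. P s c * Q c t) + (\<Sum>c\<in>{u..<n}. P s c * Q c t) = (\<Sum>c\<in>{..<u - 1} \<union> {u..<n}. P s c * Q c t)"
      by (rule sum.union_disjoint[symmetric]) auto
    also have "{..<u - 1} \<union> {u..<n} = {..<n} - {u - 1}" using u by (auto simp: n_def)
    finally show ?thesis .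
  qed
  thus ?thesis unfolding Z_def n_def by blast
qed

end

text \<open>The trivial block makes the value of the extra variable invertible. Multiplying the
  other values by its inverse turns the homogeneous point into a point of the affine
  systems.\<close>

lemma invertible_system_point:
  fixes F :: "('k :: field, 'd :: finite) rexp"
  assumes N: "N > 0"
    and full: "rank_ge (system_index F \<times> {..<N}) (blow system_pencil V) (card (system_index F) * N)"
  shows "\<exists>Y :: 'd \<Rightarrow> nat \<Rightarrow> nat \<Rightarrow> 'k. \<forall>r\<in>subs F.
    endo.uniq (\<lambda>d. block_endo N (Y d)) r \<and> endo.solv (\<lambda>d. block_endo N (Y d)) r"
proof -
  define I where "I = system_index F"
  let ?T = "I \<times> {..<N}"
  have finI: "finite I" by (simp add: I_def finite_system_index)
  have full': "rank_ge ?T (blow system_pencil V) (card ?T)"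
    using full by (simp add: I_def card_cartesian_product)
  show ?thesis
  proof (rule rank_ge_full_inverse[OF _ full'])
    show "finite ?T" using finI by simp
    fix Y
    assume right: "\<And>s t. s \<in> ?T \<Longrightarrow> t \<in> ?T \<Longrightarrow> (\<Sum>u\<in>?T. blow system_pencil V s u * Y u t) = (if s = t then 1 else 0)"
      and left: "\<And>s t. s \<in> ?T \<Longrightarrow> t \<in> ?T \<Longrightarrow> (\<Sum>u\<in>?T. Y s u * blow system_pencil V u t) = (if s = t then 1 else 0)"
    define Bs where "Bs = insert None (Some ` subs F)"
    have I: "I = Sigma Bs block_index" by (simp add: I_def system_index_def Bs_def)
    define Zb where "Zb = (\<lambda>b i j p q. \<Sum>x\<in>UNIV. block_pencil b x i j * V x p q)"
    \<comment> \<open>The blow-up is block diagonal, so the diagonal blocks of its inverse invert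
      its own diagonal blocks.\<close>
    define Yb where "Yb = (\<lambda>b i j p q. Y ((b, i), p) ((b, j), q))"
    have Z0: "blow system_pencil V ((b, i), p) ((b', j), q) = (if b = b' then Zb b i j p q else 0)" for b i p b' j q
      by (simp add: blow_def system_pencil_def Zb_def)
    have right': "(\<Sum>j\<in>block_index b. \<Sum>q<N. Zb b i j p q * Yb b j i' q p') = (if i = i' \<and> p = p' then 1 else 0)"
      if b: "b \<in> Bs" "i \<in> block_index b" "i' \<in> block_index b" "p < N" "p' < N" for b i i' p p'
    proof -
      have "(\<Sum>u\<in>?T. blow system_pencil V ((b, i), p) u * Y u ((b, i'), p')) =
          (\<Sum>t\<in>I. \<Sum>q<N. blow system_pencil V ((b, i), p) (t, q) * Y (t, q) ((b, i'), p'))"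
        by (simp add: sum.cartesian_product)
      also have "\<dots> = (\<Sum>j\<in>block_index b. \<Sum>q<N. blow system_pencil V ((b, i), p) ((b, j), q) * Y ((b, j), q) ((b, i'), p'))"
        unfolding I by (rule sum_block) (use finI b(1) in \<open>auto simp: I Z0\<close>)
      finally show ?thesis
        using right[of "((b, i), p)" "((b, i'), p')"] b by (simp add: Z0 Yb_def I)
    qed
    have left': "(\<Sum>j\<in>block_index b. \<Sum>q<N. Yb b i j p q * Zb b j i' q p') = (if i = i' \<and> p = p' then 1 else 0)"
      if b: "b \<in> Bs" "i \<in> block_index b" "i' \<in> block_index b" "p < N" "p' < N" for b i i' p p'
    proof -
      have "(\<Sum>u\<in>?T. Y ((b, i), p) u * blow system_pencil V u ((b, i'), p')) =
          (\<Sum>t\<in>I. \<Sum>q<N. Y ((b, i), p) (t, q) * blow system_pencil V (t, q) ((b, i'), p'))"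
        by (simp add: sum.cartesian_product)
      also have "\<dots> = (\<Sum>j\<in>block_index b. \<Sum>q<N. Y ((b, i), p) ((b, j), q) * blow system_pencil V ((b, j), q) ((b, i'), p'))"
        unfolding I by (rule sum_block) (use finI b(1) in \<open>auto simp: I Z0\<close>)
      finally show ?thesis
        using left[of "((b, i), p)" "((b, i'), p')"] b by (simp add: Z0 Yb_def I)
    qed
    have ZY: "(\<Sum>j\<in>block_index b. block_endo N (Zb b i j) * block_endo N (Yb b j i')) = (if i = i' then 1 else 0)"
      if b: "b \<in> Bs" "i \<in> block_index b" "i' \<in> block_index b" for b i i'
    proof -
      have "(\<Sum>j\<in>block_index b. block_endo N (Zb b i j) * block_endo N (Yb b j i')) =
          block_endo N (\<lambda>p p'. \<Sum>j\<in>block_index b. \<Sum>q<N. Zb b i j p q * Yb b j i' q p')"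
        by (simp add: block_endo_mult[OF N] block_endo_sum)
      also have "\<dots> = block_endo N (\<lambda>p p'. if i = i' \<and> p = p' then 1 else 0)"
        by (rule block_endo_cong[OF N]) (rule right'[OF b])
      finally show ?thesis by (cases "i = i'") (simp_all add: block_endo_one[OF N] block_endo_zero)
    qed
    have YZ: "(\<Sum>j\<in>block_index b. block_endo N (Yb b i j) * block_endo N (Zb b j i')) = (if i = i' then 1 else 0)"
      if b: "b \<in> Bs" "i \<in> block_index b" "i' \<in> block_index b" for b i i'
    proof -
      have "(\<Sum>j\<in>block_index b. block_endo N (Yb b i j) * block_endo N (Zb b j i')) =
          block_endo N (\<lambda>p p'. \<Sum>j\<in>block_index b. \<Sum>q<N. Yb b i j p q * Zb b j i' q p')"
        by (simp add: block_endo_mult[OF N] block_endo_sum)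
      also have "\<dots> = block_endo N (\<lambda>p p'. if i = i' \<and> p = p' then 1 else 0)"
        by (rule block_endo_cong[OF N]) (rule left'[OF b])
      finally show ?thesis by (cases "i = i'") (simp_all add: block_endo_one[OF N] block_endo_zero)
    qed
    have "Zb None [] [] = V None"
    proof (intro ext)
      fix p q
      have "Zb None [] [] p q = (\<Sum>x\<in>(UNIV :: 'd option set). if x = None then V None p q else 0)"
        unfolding Zb_def block_pencil_def by (intro sum.cong refl) (auto simp: scalar_def)
      thus "Zb None [] [] p q = V None p q" by simp
    qed
    hence unit: "block_endo N (V None) * block_endo N (Yb None [] []) = 1"
        "block_endo N (Yb None [] []) * block_endo N (V None) = 1"
      using ZY[of None "[]" "[]"] YZ[of None "[]" "[]"] by (simp_all add: Bs_def block_index_def)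
    define C where "C = Yb None [] []"
    define c where "c = block_endo N C"
    define c' where "c' = block_endo N (V None)"
    have cc: "c' * c = 1" "c * c' = 1" using unit by (simp_all add: c_def c'_def C_def)
    \<comment> \<open>\<open>c\<close> inverts the value of the extra variable. After this
      normalization every entry carries the same invertible left factor \<open>c\<close>, which
      preserves invertibility of each block.\<close>
    define a where "a = (\<lambda>d. block_endo N (\<lambda>p q. \<Sum>k<N. C p k * V (Some d) k q))"
    have a_x: "case_option 1 a x = c * block_endo N (V x)" for x
      using cc(2) by (cases x) (simp_all add: a_def c_def c'_def block_endo_mult[OF N])
    have entry: "endo.entry a r i j = c * block_endo N (Zb (Some r) i j)" for r i j
    proof -
      have "endo.entry a r i j = (\<Sum>x\<in>UNIV. c * block_endo N (\<lambda>p q. pencil r x i j * V x p q))"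
        unfolding endo.entry_def endo.lin_eval_def a_x block_endo_scale endo.scale_mult_right ..
      also have "\<dots> = c * (\<Sum>x\<in>UNIV. block_endo N (\<lambda>p q. pencil r x i j * V x p q))"
        by (rule sum_distrib_left[symmetric])
      also have "(\<Sum>x\<in>UNIV. block_endo N (\<lambda>p q. pencil r x i j * V x p q)) = block_endo N (Zb (Some r) i j)"
        by (simp add: Zb_def block_pencil_def block_endo_sum)
      finally show ?thesis .
    qed
    have "endo.uniq a r \<and> endo.solv a r" if r: "r \<in> subs F" for r
    proof (rule endo.inverse_imp_system)
      fix i i' assume i: "i \<in> inner r" "i' \<in> inner r"
      hence b: "Some r \<in> Bs" "i \<in> block_index (Some r)" "i' \<in> block_index (Some r)"
        using r by (simp_all add: Bs_def block_index_def)
      have inner: "block_index (Some r) = inner r" by (simp add: block_index_def)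
      have "(\<Sum>j\<in>inner r. block_endo N (Yb (Some r) i j) * c' * endo.entry a r j i') =
          (\<Sum>j\<in>inner r. block_endo N (Yb (Some r) i j) * block_endo N (Zb (Some r) j i'))"
      proof (rule sum.cong[OF refl])
        fix j
        have "block_endo N (Yb (Some r) i j) * c' * endo.entry a r j i' =
            block_endo N (Yb (Some r) i j) * (c' * c) * block_endo N (Zb (Some r) j i')"
          by (simp add: entry mult.assoc)
        thus "block_endo N (Yb (Some r) i j) * c' * endo.entry a r j i' =
            block_endo N (Yb (Some r) i j) * block_endo N (Zb (Some r) j i')" by (simp add: cc(1))
      qed
      thus "(\<Sum>j\<in>inner r. block_endo N (Yb (Some r) i j) * c' * endo.entry a r j i') = (if i = i' then 1 else 0)"
        using YZ[OF b] by (simp add: inner)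
      have "(\<Sum>j\<in>inner r. endo.entry a r i j * (block_endo N (Yb (Some r) j i') * c')) =
          c * (\<Sum>j\<in>inner r. block_endo N (Zb (Some r) i j) * block_endo N (Yb (Some r) j i')) * c'"
        by (simp add: entry sum_distrib_left sum_distrib_right mult.assoc)
      also have "\<dots> = c * (if i = i' then 1 else 0) * c'" using ZY[OF b] by (simp add: inner)
      also have "\<dots> = (if i = i' then 1 else 0)" by (simp add: cc(2))
      finally show "(\<Sum>j\<in>inner r. endo.entry a r i j * (block_endo N (Yb (Some r) j i') * c')) = (if i = i' then 1 else 0)" .
    qed
    thus ?thesis unfolding a_def by (intro exI[of _ "\<lambda>d p q. \<Sum>k<N. C p k * V (Some d) k q"]) blast
  qed
qed

text \<open>A value of \<open>RInv E\<close> would put the matrices into both domains. There the two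
  evaluations agree, so \<open>E\<close> has the value 0, which is not invertible because the
  algebra of endomorphisms is nonzero.\<close>

lemma difference_not_invertible:
  fixes R R' :: "('k :: field, 'd :: finite) nc_rat"
  assumes eq: "nc_space_evaluation_equivalent R R'" and N: "N > 0"
  defines "E \<equiv> RAdd (rexp_of R) (RMult (Lin (scalar (-1))) (rexp_of R'))"
  shows "\<not> endo.val (\<lambda>d :: 'd. block_endo N (Y d)) (RInv E) y"
proof
  define V :: "'d \<Rightarrow> 'k mat" where "V = (\<lambda>d. mat N N (\<lambda>(p, q). Y d p q))"
  have V: "V d \<in> carrier_mat N N" for d by (simp add: V_def)
  have a: "(\<lambda>d. block_endo N (Y d)) = (\<lambda>d. mat_endo N (V d))"
    unfolding mat_endo_def by (intro ext block_endo_cong[OF N]) (simp add: V_def)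
  assume "endo.val (\<lambda>d. block_endo N (Y d)) (RInv E) y"
  then obtain u1 u2 where u: "endo.val (\<lambda>d. mat_endo N (V d)) (rexp_of R) u1"
      "endo.val (\<lambda>d. mat_endo N (V d)) (rexp_of R') u2"
      "(u1 + escale (-1) 1 * u2) * y = 1"
    unfolding a E_def by (auto simp: endo.lin_eval_scalar)
  have dom: "(\<lambda>d. mat_endo N (V d)) \<in> nc_dom (algebra_of escale) R" "nc_eval (algebra_of escale) R (\<lambda>d. mat_endo N (V d)) = u1"
    "(\<lambda>d. mat_endo N (V d)) \<in> nc_dom (algebra_of escale) R'" "nc_eval (algebra_of escale) R' (\<lambda>d. mat_endo N (V d)) = u2"
    using u(1,2) unfolding endo.val_rexp_of by auto
  note R = nc_dom_mat[of N V R, OF N V dom(1)] and R' = nc_dom_mat[of N V R', OF N V dom(3)]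
  have "evaluation_equivalent (module_mat TYPE('k) N N) R R'"
    using eq N unfolding nc_space_evaluation_equivalent_def by simp
  hence "nc_eval (module_mat TYPE('k) N N) R V = nc_eval (module_mat TYPE('k) N N) R' V"
    unfolding evaluation_equivalent_def using R R' by blast
  hence "u1 = u2" using R R' dom by metis
  hence "u1 + escale (-1) 1 * u2 = 0" by (simp add: endo.scale_mult_left)
  thus False using u(3) by (simp add: endo_zero_neq_one)
qed

theorem theorem2p19:
  fixes R R' :: "('k :: field, 'd :: finite) nc_rat"
    and scale :: "'k \<Rightarrow> 'a :: {ring, monoid_mult} \<Rightarrow> 'a"
  assumes "nc_space_evaluation_equivalent R R'"
    and "unital_algebra scale"
    and "stably_finite TYPE('a)"
  shows "evaluation_equivalent (algebra_of scale) R R'"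
proof -
  interpret A: unital_algebra scale by (rule assms(2))
  define E where "E = RAdd (rexp_of R) (RMult (Lin (scalar (-1))) (rexp_of R'))"
  define I where "I = system_index (RInv E)"
  have finI: "finite I" by (simp add: I_def finite_system_index)
  show ?thesis unfolding evaluation_equivalent_def
  proof
    fix a assume a: "a \<in> nc_dom (algebra_of scale) R \<inter> nc_dom (algebra_of scale) R'"
    define x where "x = nc_eval (algebra_of scale) R a"
    define x' where "x' = nc_eval (algebra_of scale) R' a"
    have "A.val a (rexp_of R) x" "A.val a (rexp_of R') x'"
      using a by (simp_all add: A.val_rexp_of x_def x'_def)
    \<comment> \<open>The difference is encoded as a sum with the constant -1 times the second
      expression.\<close>
    hence E: "A.val a E (x - x')"
      unfolding E_def A.val.simps by (intro exI[of _ x] exI[of _ "- x'"] exI[of _ "- 1"] exI[of _ x'])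
        (simp add: A.lin_eval_scalar A.scale_minus_left)
    have "x - x' = 0"
    proof (rule max_rank_ratio_field[OF finI, of system_pencil])
      fix h N V
      assume N: "N > 0" and rank: "rank_ge (I \<times> {..<N}) (blow system_pencil V) (h * N)"
        and bound: "\<And>N V r. rank_ge (I \<times> {..<N}) (blow system_pencil V) r \<Longrightarrow> r \<le> h * N"
      have "h < card I"
      proof (rule ccontr)
        assume "\<not> h < card I"
        hence "rank_ge (I \<times> {..<N}) (blow system_pencil V) (card I * N)"
          by (intro rank_ge_mono[OF rank]) simp
        then obtain Y where "\<forall>r\<in>subs (RInv E). endo.uniq (\<lambda>d. block_endo N (Y d)) r \<and> endo.solv (\<lambda>d. block_endo N (Y d)) r"
          using invertible_system_point[OF N] unfolding I_def by blast
        hence "\<exists>y. endo.val (\<lambda>d. block_endo N (Y d)) (RInv E) y" by (intro endo.system_imp_val) blast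
        thus False using difference_not_invertible[OF assms(1) N] unfolding E_def by blast
      qed
      show "x - x' = 0"
      proof (rule shrunk_subspace[OF finI bound N rank \<open>h < card I\<close>])
        fix S S' u B C
        assume u: "0 < u" "u \<le> card I"
          and S: "\<And>i i'. i \<in> I \<Longrightarrow> i' \<in> I \<Longrightarrow> (\<Sum>b<card I. S i b * S' b i') = (if i = i' then 1 else 0)"
          and MS: "\<And>x i b. i \<in> I \<Longrightarrow> b < u \<Longrightarrow> (\<Sum>j\<in>I. system_pencil x i j * S j b) = (\<Sum>l<u - 1. B i l * C x l b)"
        have "\<exists>P Q. \<forall>s\<in>I. \<forall>t\<in>I. A.lin_eval a (\<lambda>x. system_pencil x s t) = (\<Sum>c\<in>{..<card I} - {u - 1}. P s c * Q c t)"
          by (rule A.pencil_factorization[where S = S and S' = S' and B = B and C = C, OF finI u]) (fact S, fact MS)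
        then obtain P Q where PQ: "\<forall>s\<in>I. \<forall>t\<in>I. A.lin_eval a (\<lambda>x. system_pencil x s t) = (\<Sum>c\<in>{..<card I} - {u - 1}. P s c * Q c t)"
          by blast
        show "x - x' = 0"
        proof (rule A.factored_system_val_zero[OF assms(3) E])
          show "finite ({..<card I} - {u - 1})" by simp
          show "card ({..<card I} - {u - 1}) = card (system_index (RInv E)) - 1"
            using u by (simp add: I_def)
          show "A.system_entry a s t = (\<Sum>c\<in>{..<card I} - {u - 1}. P s c * Q c t)"
            if "s \<in> system_index (RInv E)" "t \<in> system_index (RInv E)" for s t
            using PQ that by (simp add: A.system_entry_def I_def)
        qed
      qed
    qed
    thus "nc_eval (algebra_of scale) R a = nc_eval (algebra_of scale) R' a" by (simp add: x_def x'_def)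
  qed
qed

end
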